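(* Consider a stochastic frozen flow method as defined in the context. Its Talay–Tubaro expansion is an exotic Lie series: as formal power series in $h$, $$\mathbb{E}[\phi(X_1)|X_0=p]=\big(S_h(a)\triangleright\phi\big)(p),$$ where, for an exotic forest $\pi$ with set of nodes $V$, black nodes $V_\bullet$, numbered nodes $V_\circ$, edges $E$, roots $R$ and lianas $L$, the coefficient $a(\pi)$ is given by $$a(\pi)=\mathbb{E}\Big[\sum_{\substack{i_v=1,\dots,s\\ v\in V}}\ \sum^{!}_{\mathbf{k}\in\mathrm{Lab}_K(\pi)}\ \sum_{\substack{d_v=1,\dots,D\\ v\in V_\circ}}\delta_{d_L}\prod_{\substack{(v,w)\in E\\ v\in V_\bullet}}Z^0_{i_w,i_v,k_v}\prod_{\substack{(v,w)\in E\\ v\in V_\circ}}Z^{d_v}_{i_w,k_v}\prod_{r\in R\cap V_\bullet}z^0_{i_r,k_r}\prod_{r\in R\cap V_\circ}z^{d_r}_{k_r}\Big],$$ where $\delta_{d_L}=0$ if there exist $d_v\ne d_w$ with $(v,w)\in L$, and $\delta_{d_L}=1$ otherwise. Moreover, the coefficient map $a$ is a character on $(\mathcal{EF},\sqcup\!\sqcup)$, that is, $a(\pi_1\sqcup\!\sqcup\,\pi_2)=a(\pi_1)a(\pi_2)$.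
   Context: Setting. $E_1,\dots,E_D$ are smooth vector fields spanning the tangent spaces of a smooth manifold $\mathcal{M}$ (a frame, taken locally to be a frame basis); $F=\sum_df^dE_d$ is smooth; $\phi$ is a smooth test function; $v[\phi]$ is the directional derivative. For real constants $\alpha^d$, $\exp(\sum_d\alpha^dE_d)p$ is the time-one solution of $y'=\sum_d\alpha^dE_d(y)$, $y(0)=p$. Frozen flow method. With integers $s,K,L\ge1$ (here $L$ is a number of random variables), one step reads $$H^i_n=\exp\Big(\sum_{d}\big(h\sum_{j=1}^sZ^0_{i,j,K}f^d(H^j_n)+\sqrt h Z^d_{i,K}\big)E_d\Big)\cdots\exp\Big(\sum_{d}\big(h\sum_{j=1}^sZ^0_{i,j,1}f^d(H^j_n)+\sqrt hZ^d_{i,1}\big)E_d\Big)X_n,\quad i=1,\dots,s,$$ $$X_{n+1}=\exp\Big(\sum_{d}\big(h\sum_{i=1}^sz^0_{i,K}f^d(H^i_n)+\sqrt hz^d_K\big)E_d\Big)\cdots\exp\Big(\sum_{d}\big(h\sum_{i=1}^sz^0_{i,1}f^d(H^i_n)+\sqrt hz^d_1\big)E_d\Big)X_n$$ (rightmost exponential applied first), with deterministic $z^0_{i,k},Z^0_{i,j,k}$ and $z^d_k=\sum_{l=1}^L\hat z_{k,l}\xi^{d,l}_n$, $Z^d_{i,k}=\sum_{l=1}^L\hat Z_{i,k,l}\xi_n^{d,l}$, where $\hat z,\hat Z$ are deterministic and the $\xi_n^{d,l}$ are independent standard Gaussian random variables. Exotic forests. A planar forest is an ordered, possibly empty, sequence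 of planar rooted trees (children ordered left to right). An edge $(v,w)\in E$ goes from a node $v$ to its parent $w$. An exotic forest is a planar forest whose nodes are each decorated by $\bullet$ (black nodes, set $V_\bullet$) or by a positive integer (numbered nodes, set $V_\circ$), such that integers only decorate leaves (nodes without children) and every integer used decorates exactly two leaves; such a pair is called a liana. Exotic forests differing by a renumbering of the integers are identified. The order is $|\pi|=|V_\bullet|+\frac12|V_\circ|$. $EF$ is the set of exotic forests and $\mathcal{EF}$ its linear span. Elementary differential. $$\mathbb{F}(\pi)\triangleright\phi=\sum_{i_v=1,\dots,D;\,v\in V}\delta_{i_L}\Big(\prod_{v\in V_\bullet}E_{I_{\Pi(v)}}[f^{i_v}]\Big)E_{I_R}[\phi],$$ where $\delta_{i_L}=0$ if there exist $i_v\ne i_w$ with $\{v,w\}$ a liana and $1$ otherwise; if the roots are $r_1,\dots,r_n$ from left to right, $E_{I_R}[\phi]=E_{i_{r_1}}[E_{i_{r_2}}[\cdots E_{i_{r_n}}[\phi]\cdots]]$, and $E_{I_{\Pi(v)}}$ is defined likewise from the children $\Pi(v)$ of $v$. The exotic Lie series is the formal series $S_h(a)\triangleright\phi=\sum_{\pi\in EF}h^{|\pi|}a(\pi)\,\mathbb{F}(\pi)\triangleright\phi$. Labellings. $\mathrm{Lab}_K(\pi)$ is the set of multi-index maps $\mathbf{k}:V\to\{1,\dots,K\}$ such that $k_v\ge k_w$ if $v$ and $w$ are in the same tree, with the same height, and $v$ is on the right of $w$. Factorial sum. For a multi-index $\mathbf{k}$ that takes $r_1$ times one value, ..., $r_m$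 times another, $\mathbf{k}!=r_1!\cdots r_m!$, and $\sum^!_{\mathbf{k}\in S}f(\mathbf{k})=\sum_{\mathbf{k}\in S}\frac1{\mathbf{k}!}f(\mathbf{k})$. Shuffle product. $\pi\sqcup\!\sqcup\,\eta$ is the sum over all interleavings of the sequence of trees of $\pi$ with the sequence of trees of $\eta$ (preserving the order inside each), the integers of $\pi$ and $\eta$ being chosen disjoint.
   Formalization: In a(π), each liana has its own expectation, without the sum over d_v; i_v runs over black nodes only; k! is a product over sibling groups; Lab_K orders siblings, roots included. E is taken termwise in √h, for stages H^i→p as h→0; E[φ(X_1)] itself if φ, f^d have bounded frame derivatives. *)

theory Defs
  imports
    "HOL-Probability.Probability"
    "HOL-Computational_Algebra.Formal_Power_Series"
    "HOL-Library.Landau_Symbols"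
    "HOL-Library.Poly_Mapping"
begin

section \<open>Smooth manifolds, vector fields and flows\<close>

primrec C_k_on :: "nat \<Rightarrow> 'a::real_normed_vector set \<Rightarrow> ('a \<Rightarrow> 'b::real_normed_vector) \<Rightarrow> bool" where
  "C_k_on 0 S g \<longleftrightarrow> continuous_on S g"
| "C_k_on (Suc k) S g \<longleftrightarrow> (\<forall>x\<in>S. g differentiable (at x)) \<and>
     (\<forall>v. C_k_on k S (\<lambda>x. frechet_derivative g (at x) v))"

text \<open>Meaningful for open \<open>S\<close> only.\<close>

definition smooth_on :: "'a::real_normed_vector set \<Rightarrow> ('a \<Rightarrow> 'b::real_normed_vector) \<Rightarrow> bool" where
  "smooth_on S g \<longleftrightarrow> (\<forall>k. C_k_on k S g)"

text \<open>A chart is a pair of a domain and a coordinate map. The manifold is the whole type \<open>'m\<close>,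
  with the type's own topology.\<close>

type_synonym ('m, 'e) chart = "'m set \<times> ('m \<Rightarrow> 'e)"

definition chart_inv :: "('m, 'e) chart \<Rightarrow> 'e \<Rightarrow> 'm" where
  "chart_inv c = inv_into (fst c) (snd c)"

definition smooth_atlas ::
  "('m::topological_space, 'e::real_normed_vector) chart set \<Rightarrow> bool" where
  "smooth_atlas \<A> \<longleftrightarrow>
     (\<Union>c\<in>\<A>. fst c) = UNIV \<and>
     (\<forall>c\<in>\<A>. open (fst c) \<and> open (snd c ` fst c) \<and>
        homeomorphism (fst c) (snd c ` fst c) (snd c) (chart_inv c)) \<and>
     (\<forall>c\<in>\<A>. \<forall>c'\<in>\<A>. smooth_on (snd c ` (fst c \<inter> fst c')) (snd c' \<circ> chart_inv c))"

definition smooth_function ::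
  "('m, 'e::real_normed_vector) chart set \<Rightarrow> ('m \<Rightarrow> real) \<Rightarrow> bool" where
  "smooth_function \<A> \<phi> \<longleftrightarrow> (\<forall>c\<in>\<A>. smooth_on (snd c ` fst c) (\<phi> \<circ> chart_inv c))"

text \<open>A vector field is given by its coordinate vector in each chart; coordinate vectors in two
  charts are related by the derivative of the change of charts.\<close>

type_synonym ('m, 'e) vfield = "('m, 'e) chart \<Rightarrow> 'm \<Rightarrow> 'e"

definition smooth_vector_field ::
  "('m, 'e::real_normed_vector) chart set \<Rightarrow> ('m, 'e) vfield \<Rightarrow> bool" where
  "smooth_vector_field \<A> v \<longleftrightarrow>
     (\<forall>c\<in>\<A>. smooth_on (snd c ` fst c) (v c \<circ> chart_inv c)) \<and>
     (\<forall>c\<in>\<A>. \<forall>c'\<in>\<A>. \<forall>q \<in> fst c \<inter> fst c'.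
        v c' q = frechet_derivative (snd c' \<circ> chart_inv c) (at (snd c q)) (v c q))"

text \<open>Directional derivative \<open>v[\<phi>]\<close>; by the compatibility of coordinate vectors it does not
  depend on the chart chosen around \<open>q\<close>.\<close>

definition dir_deriv ::
  "('m, 'e::real_normed_vector) chart set \<Rightarrow> ('m, 'e) vfield \<Rightarrow> ('m \<Rightarrow> real) \<Rightarrow> 'm \<Rightarrow> real" where
  "dir_deriv \<A> v \<phi> q =
     (let c = (SOME c. c \<in> \<A> \<and> q \<in> fst c)
      in frechet_derivative (\<phi> \<circ> chart_inv c) (at (snd c q)) (v c q))"

definition spanning_fields ::
  "('m, 'e::real_normed_vector) chart set \<Rightarrow> nat \<Rightarrow> (nat \<Rightarrow> ('m, 'e) vfield) \<Rightarrow> bool" where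
  "spanning_fields \<A> D E \<longleftrightarrow>
     (\<forall>c\<in>\<A>. \<forall>q\<in>fst c. span ((\<lambda>d. E d c q) ` {1..D}) = UNIV)"

definition integral_curve ::
  "('m::topological_space, 'e::real_normed_vector) chart set \<Rightarrow> ('m, 'e) vfield
    \<Rightarrow> (real \<Rightarrow> 'm) \<Rightarrow> bool" where
  "integral_curve \<A> v y \<longleftrightarrow> continuous_on {0..1} y \<and>
     (\<forall>t\<in>{0..1}. \<forall>c\<in>\<A>. y t \<in> fst c \<longrightarrow>
        ((snd c \<circ> y) has_vector_derivative v c (y t)) (at t within {0..1}))"

text \<open>\<open>is_exp \<A> D E \<alpha> p q\<close> says that \<open>exp(\<Sum>d. \<alpha> d E d) p\<close> exists and equals \<open>q\<close>. A relation is
  used because the flow need not be complete.\<close>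

definition is_exp ::
  "('m::topological_space, 'e::real_normed_vector) chart set \<Rightarrow> nat \<Rightarrow> (nat \<Rightarrow> ('m, 'e) vfield)
    \<Rightarrow> (nat \<Rightarrow> real) \<Rightarrow> 'm \<Rightarrow> 'm \<Rightarrow> bool" where
  "is_exp \<A> D E \<alpha> p q \<longleftrightarrow>
     (\<exists>y. integral_curve \<A> (\<lambda>c x. \<Sum>d=1..D. \<alpha> d *\<^sub>R E d c x) y \<and> y 0 = p \<and> y 1 = q)"

text \<open>\<open>exp(\<Sum>d. \<alpha> K d E d) \<dots> exp(\<Sum>d. \<alpha> 1 d E d) p = q\<close>\<close>

definition is_exp_product ::
  "('m::topological_space, 'e::real_normed_vector) chart set \<Rightarrow> nat \<Rightarrow> (nat \<Rightarrow> ('m, 'e) vfield)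
    \<Rightarrow> nat \<Rightarrow> (nat \<Rightarrow> nat \<Rightarrow> real) \<Rightarrow> 'm \<Rightarrow> 'm \<Rightarrow> bool" where
  "is_exp_product \<A> D E K \<alpha> p q \<longleftrightarrow>
     (\<exists>u. u 0 = p \<and> u K = q \<and> (\<forall>k\<in>{1..K}. is_exp \<A> D E (\<alpha> k) (u (k - 1)) (u k)))"

section \<open>Stochastic frozen flow methods\<close>

text \<open>\<open>stg\<close>, \<open>nexp\<close>, \<open>nrv\<close> are \<open>s\<close>, \<open>K\<close>, \<open>L\<close>; \<open>Zi\<close> and \<open>zf\<close> are the deterministic coefficients with upper
  index \<open>0\<close>; \<open>Zh\<close> and \<open>zh\<close> are the hatted coefficients.\<close>

record ff_tableau =
  stg :: nat
  nexp :: nat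
  nrv :: nat
  Zi :: "nat \<Rightarrow> nat \<Rightarrow> nat \<Rightarrow> real"
  zf :: "nat \<Rightarrow> nat \<Rightarrow> real"
  Zh :: "nat \<Rightarrow> nat \<Rightarrow> nat \<Rightarrow> real"
  zh :: "nat \<Rightarrow> nat \<Rightarrow> real"

text \<open>\<open>x d l\<close> is the value of the random variable with indices \<open>d, l\<close>.\<close>

definition noise_stage :: "ff_tableau \<Rightarrow> (nat \<Rightarrow> nat \<Rightarrow> real) \<Rightarrow> nat \<Rightarrow> nat \<Rightarrow> nat \<Rightarrow> real" where
  "noise_stage T x d i k = (\<Sum>l=1..nrv T. Zh T i k l * x d l)"

definition noise_final :: "ff_tableau \<Rightarrow> (nat \<Rightarrow> nat \<Rightarrow> real) \<Rightarrow> nat \<Rightarrow> nat \<Rightarrow> real" where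
  "noise_final T x d k = (\<Sum>l=1..nrv T. zh T k l * x d l)"

text \<open>\<open>H 1, \<dots>, H s\<close> are internal stages and \<open>q\<close> is an outcome of one step of size \<open>h\<close> from \<open>p\<close>.\<close>

definition ff_step ::
  "('m::topological_space, 'e::real_normed_vector) chart set \<Rightarrow> nat \<Rightarrow> (nat \<Rightarrow> ('m, 'e) vfield)
    \<Rightarrow> (nat \<Rightarrow> 'm \<Rightarrow> real) \<Rightarrow> ff_tableau \<Rightarrow> (nat \<Rightarrow> nat \<Rightarrow> real) \<Rightarrow> real \<Rightarrow> 'm
    \<Rightarrow> (nat \<Rightarrow> 'm) \<Rightarrow> 'm \<Rightarrow> bool" where
  "ff_step \<A> D E f T x h p H q \<longleftrightarrow>
     (\<forall>i\<in>{1..stg T}. is_exp_product \<A> D E (nexp T)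
        (\<lambda>k d. h * (\<Sum>j=1..stg T. Zi T i j k * f d (H j)) + sqrt h * noise_stage T x d i k)
        p (H i)) \<and>
     is_exp_product \<A> D E (nexp T)
        (\<lambda>k d. h * (\<Sum>i=1..stg T. zf T i k * f d (H i)) + sqrt h * noise_final T x d k)
        p q"

section \<open>Exotic forests\<close>

text \<open>Only leaves can carry numbers, which the type enforces. A planar forest is a list of trees.\<close>

datatype 'n ptree = Black "'n ptree list" | Num 'n

fun children :: "'n ptree \<Rightarrow> 'n ptree list" where
  "children (Black ts) = ts"
| "children (Num n) = []"

fun labels :: "'n ptree \<Rightarrow> 'n list" where
  "labels (Black ts) = concat (map labels ts)"
| "labels (Num n) = [n]"

definition is_exotic :: "nat ptree list \<Rightarrow> bool" where
  "is_exotic ts \<longleftrightarrow> (let ls = concat (map labels ts) in \<forall>n\<in>set ls. n > 0 \<and> count_list ls n = 2)"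

definition renumber :: "(nat \<Rightarrow> nat) \<Rightarrow> nat ptree list \<Rightarrow> nat ptree list" where
  "renumber \<sigma> = map (map_ptree \<sigma>)"

definition same_exotic :: "nat ptree list \<Rightarrow> nat ptree list \<Rightarrow> bool" where
  "same_exotic ts us \<longleftrightarrow> is_exotic ts \<and> is_exotic us \<and> (\<exists>\<sigma>. bij \<sigma> \<and> us = renumber \<sigma> ts)"

lemma renumber_comp: "renumber \<sigma> (renumber \<tau> ts) = renumber (\<sigma> \<circ> \<tau>) ts"
  by (simp add: renumber_def ptree.map_comp)

lemma renumber_id: "renumber id ts = ts"
  by (simp add: renumber_def ptree.map_id0)

lemma part_equivp_same_exotic: "part_equivp same_exotic"
proof (rule part_equivpI)
  show "\<exists>x. same_exotic x x"
    by (rule exI[of _ "[]"]) (auto simp: same_exotic_def is_exotic_def renumber_def intro!: exI[of _ id])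
  show "symp same_exotic"
  proof (rule sympI)
    fix ts us assume "same_exotic ts us"
    then obtain \<sigma> where s: "bij \<sigma>" "us = renumber \<sigma> ts" and e: "is_exotic ts" "is_exotic us"
      by (auto simp: same_exotic_def)
    then have "ts = renumber (inv \<sigma>) us"
      by (simp add: renumber_comp bij_is_inj renumber_id)
    with s e show "same_exotic us ts"
      unfolding same_exotic_def using bij_imp_bij_inv by blast
  qed
  show "transp same_exotic"
  proof (rule transpI)
    fix ts us vs assume "same_exotic ts us" "same_exotic us vs"
    then show "same_exotic ts vs"
      unfolding same_exotic_def by (metis bij_comp renumber_comp)
  qed
qed

quotient_type exotic_forest = "nat ptree list" / partial: same_exotic
  by (rule part_equivp_same_exotic)

subsection \<open>Nodes\<close>

text \<open>A node is addressed by the positions of its ancestors and of itself: \<open>[i]\<close> is the root of the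
  tree number \<open>i\<close>, and \<open>v @ [j]\<close> is child number \<open>j\<close> of \<open>v\<close>, both counted from 0 and from the left. The
  parent of \<open>v\<close> is \<open>butlast v\<close>. The empty address is not a node; it plays the role of a common parent
  of all the roots.\<close>

fun node_at :: "'n ptree list \<Rightarrow> nat list \<Rightarrow> 'n ptree option" where
  "node_at ts [] = None"
| "node_at ts [i] = (if i < length ts then Some (ts ! i) else None)"
| "node_at ts (i # j # v) =
     (if i < length ts then node_at (children (ts ! i)) (j # v) else None)"

definition nodes :: "'n ptree list \<Rightarrow> nat list set" where
  "nodes ts = {v. node_at ts v \<noteq> None}"

definition black_nodes :: "'n ptree list \<Rightarrow> nat list set" where
  "black_nodes ts = {v. \<exists>us. node_at ts v = Some (Black us)}"

definition num_nodes :: "'n ptree list \<Rightarrow> nat list set" where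
  "num_nodes ts = {v. \<exists>n. node_at ts v = Some (Num n)}"

definition lianas :: "'n ptree list \<Rightarrow> nat list set set" where
  "lianas ts = {{v, w} |v w n. v \<noteq> w \<and> node_at ts v = Some (Num n) \<and> node_at ts w = Some (Num n)}"

definition parent :: "nat list \<Rightarrow> nat list" where
  "parent v = butlast v"

definition is_root :: "nat list \<Rightarrow> bool" where
  "is_root v \<longleftrightarrow> parent v = []"

text \<open>Children of \<open>v\<close> from left to right; the roots if \<open>v = []\<close>.\<close>

definition kids :: "'n ptree list \<Rightarrow> nat list \<Rightarrow> nat list list" where
  "kids ts v = map (\<lambda>j. v @ [j]) [0..<card {j. v @ [j] \<in> nodes ts}]"

lemma children_map_ptree: "children (map_ptree \<sigma> t) = map (map_ptree \<sigma>) (children t)"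
  by (cases t) auto

lemma node_at_renumber: "node_at (renumber \<sigma> ts) v = map_option (map_ptree \<sigma>) (node_at ts v)"
  unfolding renumber_def
  by (induction ts v rule: node_at.induct) (auto simp: children_map_ptree)

lemma nodes_renumber: "nodes (renumber \<sigma> ts) = nodes ts"
  by (simp add: nodes_def node_at_renumber)

lemma map_ptree_eq_Black: "(\<exists>us. map_ptree \<sigma> t = Black us) \<longleftrightarrow> (\<exists>us. t = Black us)"
  by (cases t) auto

lemma map_ptree_eq_Num: "map_ptree \<sigma> t = Num n \<longleftrightarrow> (\<exists>m. t = Num m \<and> n = \<sigma> m)"
  by (cases t) auto

lemma black_nodes_renumber: "black_nodes (renumber \<sigma> ts) = black_nodes ts"
  unfolding black_nodes_def node_at_renumber
proof (rule Collect_cong)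
  fix v show "(\<exists>us. map_option (map_ptree \<sigma>) (node_at ts v) = Some (Black us)) \<longleftrightarrow>
      (\<exists>us. node_at ts v = Some (Black us))"
    by (cases "node_at ts v") (auto simp: map_ptree_eq_Black)
qed

lemma num_nodes_renumber: "num_nodes (renumber \<sigma> ts) = num_nodes ts"
  unfolding num_nodes_def node_at_renumber by (fastforce simp: map_ptree_eq_Num)

lemma lianas_renumber: "bij \<sigma> \<Longrightarrow> lianas (renumber \<sigma> ts) = lianas ts"
  unfolding lianas_def node_at_renumber map_option_eq_Some map_ptree_eq_Num
  by (metis (no_types, opaque_lifting) bij_is_inj inj_eq)

lemma kids_renumber: "kids (renumber \<sigma> ts) = kids ts"
  by (simp add: kids_def nodes_renumber fun_eq_iff)

lemmas renumber_simps =
  nodes_renumber black_nodes_renumber num_nodes_renumber lianas_renumber kids_renumber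

lift_definition forest_order :: "exotic_forest \<Rightarrow> nat" is
  "\<lambda>\<pi>. card (black_nodes \<pi>) + card (num_nodes \<pi>) div 2"
  by (auto simp: same_exotic_def renumber_simps)

subsection \<open>Elementary differentials and exotic Lie series\<close>

text \<open>\<open>E\<^bsub>d\<^sub>1\<^esub>[E\<^bsub>d\<^sub>2\<^esub>[\<dots>[\<phi>]\<dots>]]\<close> for the word \<open>d\<^sub>1 d\<^sub>2 \<dots>\<close>\<close>

definition word_deriv ::
  "('m, 'e::real_normed_vector) chart set \<Rightarrow> (nat \<Rightarrow> ('m, 'e) vfield) \<Rightarrow> nat list
    \<Rightarrow> ('m \<Rightarrow> real) \<Rightarrow> 'm \<Rightarrow> real" where
  "word_deriv \<A> E ds \<phi> = foldr (\<lambda>d. dir_deriv \<A> (E d)) ds \<phi>"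

lift_definition elementary_differential ::
  "('m, 'e::real_normed_vector) chart set \<Rightarrow> nat \<Rightarrow> (nat \<Rightarrow> ('m, 'e) vfield)
    \<Rightarrow> (nat \<Rightarrow> 'm \<Rightarrow> real) \<Rightarrow> exotic_forest \<Rightarrow> ('m \<Rightarrow> real) \<Rightarrow> 'm \<Rightarrow> real" is
  "\<lambda>\<A> D E f \<pi> \<phi> q.
     \<Sum>i \<in> nodes \<pi> \<rightarrow>\<^sub>E {1..D}.
       (if \<exists>v w. {v, w} \<in> lianas \<pi> \<and> i v \<noteq> i w then 0 else 1) *
       (\<Prod>v \<in> black_nodes \<pi>. word_deriv \<A> E (map i (kids \<pi> v)) (f (i v)) q) *
       word_deriv \<A> E (map i (kids \<pi> [])) \<phi> q"
  by (auto simp: same_exotic_def renumber_simps fun_eq_iff)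

text \<open>The exotic Lie series \<open>S\<^sub>h(a) \<triangleright> \<phi>\<close> evaluated at \<open>p\<close>, as a formal power series in \<open>h\<close>. There are
  finitely many exotic forests of each order.\<close>

definition exotic_Lie_series ::
  "('m, 'e::real_normed_vector) chart set \<Rightarrow> nat \<Rightarrow> (nat \<Rightarrow> ('m, 'e) vfield)
    \<Rightarrow> (nat \<Rightarrow> 'm \<Rightarrow> real) \<Rightarrow> (exotic_forest \<Rightarrow> real) \<Rightarrow> ('m \<Rightarrow> real) \<Rightarrow> 'm \<Rightarrow> real fps" where
  "exotic_Lie_series \<A> D E f a \<phi> p =
     Abs_fps (\<lambda>m. \<Sum>\<pi> | forest_order \<pi> = m. a \<pi> * elementary_differential \<A> D E f \<pi> \<phi> p)"

subsection \<open>The coefficient map of a frozen flow method\<close>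

text \<open>A labelling increases weakly from left to right among siblings, the roots being siblings.\<close>

definition Lab :: "nat \<Rightarrow> 'n ptree list \<Rightarrow> (nat list \<Rightarrow> nat) set" where
  "Lab K \<pi> = {k \<in> nodes \<pi> \<rightarrow>\<^sub>E {1..K}.
     \<forall>v\<in>nodes \<pi>. \<forall>w\<in>nodes \<pi>. parent v = parent w \<and> last w < last v \<longrightarrow> k w \<le> k v}"

text \<open>Each group of siblings carries its own multi-index, with factorial \<open>r\<^sub>1! \<dots> r\<^sub>m!\<close>; that of a labelling
  is the product over all groups, indexed by the common parent.\<close>

definition lab_fact :: "nat \<Rightarrow> 'n ptree list \<Rightarrow> (nat list \<Rightarrow> nat) \<Rightarrow> real" where
  "lab_fact K \<pi> k =
     (\<Prod>w \<in> insert [] (nodes \<pi>). \<Prod>c=1..K. fact (card {v \<in> nodes \<pi>. parent v = w \<and> k v = c}))"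

text \<open>The two Gaussian factors of each liana carry the same upper index and are averaged separately
  from those of the other lianas, in accordance with Isserlis' formula: all pairings of the factors
  of a Gaussian moment are already accounted for by the sum over exotic forests. By the law of
  \<open>\<xi>\<close>, the average does not depend on the upper index (below: \<open>1\<close>), whose sum is the one over \<open>i\<close> in the
  elementary differential.\<close>

lift_definition ff_coeff ::
  "'w measure \<Rightarrow> (nat \<Rightarrow> nat \<Rightarrow> 'w \<Rightarrow> real) \<Rightarrow> ff_tableau \<Rightarrow> exotic_forest \<Rightarrow> real" is
  "\<lambda>M \<xi> T \<pi>.
     \<Sum>i \<in> black_nodes \<pi> \<rightarrow>\<^sub>E {1..stg T}. \<Sum>k \<in> Lab (nexp T) \<pi>. 1 / lab_fact (nexp T) \<pi> k *
       ((\<Prod>v \<in> {v \<in> black_nodes \<pi>. \<not> is_root v}. Zi T (i (parent v)) (i v) (k v)) *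
        (\<Prod>r \<in> {r \<in> black_nodes \<pi>. is_root r}. zf T (i r) (k r)) *
        (\<Prod>e \<in> lianas \<pi>. \<integral>\<omega>.
           (\<Prod>v \<in> {v \<in> e. \<not> is_root v}. noise_stage T (\<lambda>d l. \<xi> d l \<omega>) 1 (i (parent v)) (k v)) *
           (\<Prod>r \<in> {r \<in> e. is_root r}. noise_final T (\<lambda>d l. \<xi> d l \<omega>) 1 (k r)) \<partial>M))"
  by (auto simp: same_exotic_def renumber_simps Lab_def lab_fact_def)

subsection \<open>Shuffle product and characters\<close>

lift_definition empty_forest :: exotic_forest is "[]"
  by (auto simp: same_exotic_def is_exotic_def renumber_def intro!: exI[of _ id])

text \<open>All interleavings with multiplicity (unlike \<open>shuffles\<close>, which is a set).\<close>

fun interleavings :: "'a list \<Rightarrow> 'a list \<Rightarrow> 'a list list" where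
  "interleavings [] ys = [ys]"
| "interleavings (x # xs) [] = [x # xs]"
| "interleavings (x # xs) (y # ys) =
     map ((#) x) (interleavings xs (y # ys)) @ map ((#) y) (interleavings (x # xs) ys)"

lemma interleavings_map:
  "interleavings (map g xs) (map g ys) = map (map g) (interleavings xs ys)"
  by (induction xs ys rule: interleavings.induct) (simp_all add: comp_def)

lemma mset_interleavings: "zs \<in> set (interleavings xs ys) \<Longrightarrow> mset zs = mset xs + mset ys"
  by (induction xs ys arbitrary: zs rule: interleavings.induct) auto

lemma count_labels_concat:
  "count_list (concat (map labels ts)) n = (\<Sum>t\<in>#mset ts. count_list (labels t) n)"
  by (induction ts) auto

lemma is_exotic_iff:
  "is_exotic ts \<longleftrightarrow> (\<forall>n. let c = count_list (concat (map labels ts)) n in c = 0 \<or> n > 0 \<and> c = 2)"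
  unfolding is_exotic_def Let_def by (metis count_list_0_iff zero_neq_numeral)

lemma labels_map_ptree: "labels (map_ptree \<sigma> t) = map \<sigma> (labels t)"
  by (induction t) (auto simp: map_concat comp_def intro!: arg_cong[of _ _ concat])

lemma labels_renumber:
  "concat (map labels (renumber \<sigma> ts)) = map \<sigma> (concat (map labels ts))"
  by (simp add: renumber_def map_concat comp_def labels_map_ptree)

lemma count_map_inj: "inj \<sigma> \<Longrightarrow> count_list (map \<sigma> xs) (\<sigma> n) = count_list xs n"
  by (induction xs) (auto dest: injD)

lemma is_exotic_interleaving:
  assumes "is_exotic ts" "is_exotic us"
    and zs: "zs \<in> set (interleavings (renumber (\<lambda>n. 2 * n) ts) (renumber (\<lambda>n. 2 * n + 1) us))"
  shows "is_exotic zs"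
  unfolding is_exotic_iff Let_def
proof
  fix n
  let ?c = "\<lambda>ts n. count_list (concat (map labels ts)) n"
  have eq: "?c zs n = ?c (renumber (\<lambda>n. 2 * n) ts) n + ?c (renumber (\<lambda>n. 2 * n + 1) us) n"
    using mset_interleavings[OF zs] by (simp add: count_labels_concat)
  show "?c zs n = 0 \<or> 0 < n \<and> ?c zs n = 2"
  proof (cases "even n")
    case True
    then obtain m where m: "n = 2 * m" by (rule evenE)
    have "?c (renumber (\<lambda>n. 2 * n) ts) n = ?c ts m"
      unfolding labels_renumber m by (rule count_map_inj) (simp add: inj_def)
    moreover have "?c (renumber (\<lambda>n. 2 * n + 1) us) n = 0"
      unfolding labels_renumber m count_list_0_iff by (auto, presburger)
    ultimately show ?thesis
      using eq assms(1) m unfolding is_exotic_iff Let_def by auto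
  next
    case False
    then obtain m where m: "n = 2 * m + 1" by (rule oddE)
    have "?c (renumber (\<lambda>n. 2 * n + 1) us) n = ?c us m"
      unfolding labels_renumber m by (rule count_map_inj[of "\<lambda>n. 2 * n + 1"]) (simp add: inj_def)
    moreover have "?c (renumber (\<lambda>n. 2 * n) ts) n = 0"
      unfolding labels_renumber m count_list_0_iff by (auto, presburger)
    ultimately show ?thesis
      using eq assms(2) m unfolding is_exotic_iff Let_def by auto
  qed
qed

definition merge_bij :: "(nat \<Rightarrow> nat) \<Rightarrow> (nat \<Rightarrow> nat) \<Rightarrow> nat \<Rightarrow> nat" where
  "merge_bij \<sigma> \<tau> n = (if even n then 2 * \<sigma> (n div 2) else 2 * \<tau> (n div 2) + 1)"

lemma bij_merge_bij:
  assumes "bij \<sigma>" "bij \<tau>" shows "bij (merge_bij \<sigma> \<tau>)"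
proof (rule o_bij)
  show "merge_bij (inv \<sigma>) (inv \<tau>) \<circ> merge_bij \<sigma> \<tau> = id"
    using assms by (auto simp: fun_eq_iff merge_bij_def bij_is_inj)
  show "merge_bij \<sigma> \<tau> \<circ> merge_bij (inv \<sigma>) (inv \<tau>) = id"
    using assms by (auto simp: fun_eq_iff merge_bij_def bij_is_surj surj_f_inv_f)
qed

lemma renumber_merge:
  "renumber (\<lambda>n. 2 * n) (renumber \<sigma> ts) = renumber (merge_bij \<sigma> \<tau>) (renumber (\<lambda>n. 2 * n) ts)"
  "renumber (\<lambda>n. 2 * n + 1) (renumber \<tau> ts) = renumber (merge_bij \<sigma> \<tau>) (renumber (\<lambda>n. 2 * n + 1) ts)"
  unfolding renumber_comp by (simp_all add: comp_def merge_bij_def)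

text \<open>The integers of the two forests are first made disjoint.\<close>

lift_definition forest_interleavings :: "exotic_forest \<Rightarrow> exotic_forest \<Rightarrow> exotic_forest list" is
  "\<lambda>\<pi> \<eta>. interleavings (renumber (\<lambda>n. 2 * n) \<pi>) (renumber (\<lambda>n. 2 * n + 1) \<eta>)"
proof -
  fix ts ts' us us' assume "same_exotic ts ts'" "same_exotic us us'"
  then obtain \<sigma> \<tau> where b: "bij \<sigma>" "bij \<tau>"
    and ex: "is_exotic ts" "is_exotic ts'" "is_exotic us" "is_exotic us'"
    and eq: "ts' = renumber \<sigma> ts" "us' = renumber \<tau> us"
    by (auto simp: same_exotic_def)
  let ?xs = "interleavings (renumber (\<lambda>n. 2 * n) ts) (renumber (\<lambda>n. 2 * n + 1) us)"
  let ?ys = "interleavings (renumber (\<lambda>n. 2 * n) ts') (renumber (\<lambda>n. 2 * n + 1) us')"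
  have ys: "?ys = map (renumber (merge_bij \<sigma> \<tau>)) ?xs"
    unfolding eq renumber_merge(1)[of \<sigma> ts \<tau>] renumber_merge(2)[of \<tau> us \<sigma>]
    by (simp only: renumber_def interleavings_map)
  have "same_exotic x (renumber (merge_bij \<sigma> \<tau>) x)" if "x \<in> set ?xs" for x
  proof -
    have "renumber (merge_bij \<sigma> \<tau>) x \<in> set ?ys" using that ys by simp
    then show ?thesis
      using that is_exotic_interleaving ex bij_merge_bij[OF b] unfolding same_exotic_def by blast
  qed
  then show "list_all2 same_exotic ?xs ?ys"
    unfolding ys by (simp add: list_all2_map2 list.rel_refl_strong)
qed

text \<open>\<open>exotic_forest \<Rightarrow>\<^sub>0 real\<close> is the linear span of the exotic forests.\<close>

definition shuffle_prod ::
  "(exotic_forest \<Rightarrow>\<^sub>0 real) \<Rightarrow> (exotic_forest \<Rightarrow>\<^sub>0 real) \<Rightarrow> (exotic_forest \<Rightarrow>\<^sub>0 real)" where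
  "shuffle_prod x y =
     (\<Sum>\<pi> \<in> Poly_Mapping.keys x. \<Sum>\<eta> \<in> Poly_Mapping.keys y. \<Sum>\<zeta> \<leftarrow> forest_interleavings \<pi> \<eta>.
        Poly_Mapping.single \<zeta> (Poly_Mapping.lookup x \<pi> * Poly_Mapping.lookup y \<eta>))"

definition lin_ext :: "(exotic_forest \<Rightarrow> real) \<Rightarrow> (exotic_forest \<Rightarrow>\<^sub>0 real) \<Rightarrow> real" where
  "lin_ext a x = (\<Sum>\<pi> \<in> Poly_Mapping.keys x. Poly_Mapping.lookup x \<pi> * a \<pi>)"

definition shuffle_character :: "(exotic_forest \<Rightarrow> real) \<Rightarrow> bool" where
  "shuffle_character a \<longleftrightarrow> a empty_forest = 1 \<and>
     (\<forall>x y. lin_ext a (shuffle_prod x y) = lin_ext a x * lin_ext a y)"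

section \<open>Talay--Tubaro expansions\<close>

text \<open>\<open>c\<close> is the asymptotic expansion of \<open>g h\<close> in powers of \<open>sqrt h\<close> as \<open>h\<close> decreases to 0.\<close>

definition sqrt_expansion :: "(real \<Rightarrow> real) \<Rightarrow> real fps \<Rightarrow> bool" where
  "sqrt_expansion g c \<longleftrightarrow>
     (\<forall>N. (\<lambda>h. g h - (\<Sum>n\<le>N. fps_nth c n * sqrt h ^ n)) \<in> o[at_right 0](\<lambda>h. sqrt h ^ N))"

text \<open>The expectation of \<open>Y h\<close> as a formal power series: almost every realisation of \<open>Y h\<close> is expanded
  in powers of \<open>sqrt h\<close>, the expectation is taken coefficient by coefficient, and the result is the
  series \<open>S\<close> in \<open>h = (sqrt h)\<^sup>2\<close>.\<close>

definition formal_expectation ::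
  "'w measure \<Rightarrow> (real \<Rightarrow> 'w \<Rightarrow> real) \<Rightarrow> real fps \<Rightarrow> bool" where
  "formal_expectation M Y S \<longleftrightarrow>
     (\<exists>C. (AE \<omega> in M. sqrt_expansion (\<lambda>h. Y h \<omega>) (C \<omega>)) \<and>
          (\<forall>n. integrable M (\<lambda>\<omega>. fps_nth (C \<omega>) n)) \<and>
          Abs_fps (\<lambda>n. \<integral>\<omega>. fps_nth (C \<omega>) n \<partial>M) = fps_compose S (fps_X ^ 2))"

text \<open>The expectation of \<open>Y h\<close> itself has the asymptotic expansion \<open>S\<close> in powers of \<open>h\<close>.\<close>

definition weak_expansion ::
  "'w measure \<Rightarrow> (real \<Rightarrow> 'w \<Rightarrow> real) \<Rightarrow> real fps \<Rightarrow> bool" where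
  "weak_expansion M Y S \<longleftrightarrow>
     (\<forall>\<^sub>F h in at_right 0. integrable M (Y h)) \<and>
     (\<forall>N. (\<lambda>h. (\<integral>\<omega>. Y h \<omega> \<partial>M) - (\<Sum>m\<le>N. fps_nth S m * h ^ m)) \<in> O[at_right 0](\<lambda>h. h ^ Suc N))"

text \<open>All iterated derivatives along the frame are bounded; automatic on a compact manifold.\<close>

definition bounded_derivs ::
  "('m, 'e::real_normed_vector) chart set \<Rightarrow> nat \<Rightarrow> (nat \<Rightarrow> ('m, 'e) vfield)
    \<Rightarrow> ('m \<Rightarrow> real) \<Rightarrow> bool" where
  "bounded_derivs \<A> D E \<phi> \<longleftrightarrow> (\<forall>ds. set ds \<subseteq> {1..D} \<longrightarrow> bounded (range (word_deriv \<A> E ds \<phi>)))"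

end

(*
  Freezing the coefficients turns one step into a product of exponentials with scalar coefficients,
  so phi(X_1) is, up to a Taylor remainder, a sum over words of derivatives of phi along the frame,
  weighted by the coefficients of these words in the product of the exponentials; these weights are the
  weakly increasing labels with their factorials. Each letter carries either sqrt h times a Gaussian
  linear form (a leaf) or h times f at an internal stage, which is again a function of a product of
  exponentials and is expanded in the same way (a black node with its children). Iterating gives a sum
  over planar forests with unpaired leaves. Its remainder is a power of sqrt h times a polynomial in the
  noise: on a small chart ball for almost every realisation, and uniformly if all derivatives are bounded.

  By Isserlis' formula the expectation sums over the pairings of the leaves of each forest, and a
  planar forest with paired leaves is the same as an exotic forest.

  For the shuffle product, the covariance of each liana is written as a sum over an index of a random
  variable. For fixed indices the trees decouple, and the coefficient of a forest is the one of a word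
  of trees in a product of exponentials, which is a character.
*)
theory Submission
  imports Defs
begin

section \<open>Words in a product of exponentials\<close>

text \<open>The stages are implicit: the exponents contain \<open>f\<close> at points that depend on
  \<open>h\<close> through the same exponents. No solution is constructed; any stages that satisfy
  the equations are expanded, by strong induction on the order in \<open>sqrt h\<close>. The drift
  carries the factor \<open>h\<close>, which is two orders, so an expansion of \<open>f\<close> at
  the stages up to order \<open>N - 2\<close> suffices for order \<open>N\<close>, and boundedness
  of \<open>f\<close> starts the induction.

  All estimates are made along an arbitrary filter and with an explicit power of the noise size.
  Along \<open>at_right 0\<close> with a fixed realisation they give the pathwise expansion. Along
  the principal filter of all admissible pairs of a step size and a realisation they give uniform
  constants, and the remainder can be integrated because Gaussian variables have all
  moments.\<close>

lemma sum_lists_PiE: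
  "(\<Sum>xs | length xs = m \<and> set xs \<subseteq> A. F xs) = (\<Sum>r\<in>{..<m} \<rightarrow>\<^sub>E A. F (map r [0..<m]))"
  by (rule sum.reindex_bij_witness[where j = "\<lambda>xs. \<lambda>a\<in>{..<m}. xs ! a" and i = "\<lambda>r. map r [0..<m]"])
     (auto simp: PiE_def extensional_def fun_eq_iff subset_iff in_set_conv_nth intro!: nth_equalityI
         arg_cong[of _ _ F])

text \<open>On functions a composition of flows acts in reverse order, so the flow applied first
  gives the leftmost operators. Labels therefore increase from left to right, and each block of
  equal labels has the reciprocal factorial of its exponential series.\<close>

definition label_weight :: "nat \<Rightarrow> nat list \<Rightarrow> real" where
  "label_weight K ks = (if sorted ks then \<Prod>c=1..K. 1 / fact (count_list ks c) else 0)"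

text \<open>The coefficient of the word \<open>bs\<close> in a product of \<open>K\<close> exponentials, where \<open>b k\<close> is the coefficient
  of the letter \<open>b\<close> in exponent number \<open>k\<close>. As such it is a character for the shuffle product.\<close>

definition chi :: "nat \<Rightarrow> (nat \<Rightarrow> real) list \<Rightarrow> real" where
  "chi K bs = (\<Sum>ks | length ks = length bs \<and> set ks \<subseteq> {1..K}.
     label_weight K ks * (\<Prod>a<length bs. (bs ! a) (ks ! a)))"

lemma chi_0: "chi 0 bs = (if bs = [] then 1 else 0)"
proof (cases "bs = []")
  case False
  then show ?thesis unfolding chi_def by (auto intro!: sum.neutral)
qed (auto simp: chi_def label_weight_def)

text \<open>Sortedness forces everything behind the first label \<open>Suc K\<close> to be
  \<open>Suc K\<close> as well.\<close>

lemma takeWhile_sorted_split: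
  assumes "sorted ks" "set ks \<subseteq> {1..Suc K}"
  shows "takeWhile (\<lambda>k. k \<le> K) ks @ replicate (length ks - length (takeWhile (\<lambda>k. k \<le> K) ks)) (Suc K) = ks"
  using assms
proof (induction ks)
  case (Cons k ks)
  show ?case
  proof (cases "k \<le> K")
    case True then show ?thesis using Cons by auto
  next
    case False
    then have "k = Suc K" using Cons.prems by auto
    moreover from this have "\<forall>x\<in>set ks. x = Suc K"
      using Cons.prems by (force intro: antisym)
    then have "replicate (length ks) (Suc K) = ks" by (intro replicate_eqI[symmetric]) auto
    ultimately show ?thesis by simp
  qed
qed simp

lemma count_list_replicate: "count_list (replicate n x) y = (if x = y then n else 0)"
  by (induction n) auto

lemma label_weight_append:
  assumes "set ks \<subseteq> {1..K}" "sorted ks"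
  shows "label_weight (Suc K) (ks @ replicate n (Suc K)) = label_weight K ks / fact n"
proof -
  have s: "sorted (ks @ replicate n (Suc K))"
    using assms by (auto simp: sorted_append subset_iff le_SucI)
  have 0: "count_list ks (Suc K) = 0" using assms by (auto simp: count_list_0_iff)
  show ?thesis unfolding label_weight_def
    using s assms(2) by (simp add: count_list_append count_list_replicate 0)
qed

text \<open>In a sorted labelling the largest label fills a suffix. Cutting the word there leaves a
  word in the first \<open>K\<close> exponentials and one term of the series of the last
  exponential.\<close>

lemma chi_Suc:
  "chi (Suc K) bs = (\<Sum>j\<le>length bs. chi K (take j bs) *
     (prod_list (map (\<lambda>b. b (Suc K)) (drop j bs)) / fact (length bs - j)))"
proof -
  let ?m = "length bs"
  let ?L = "\<lambda>K m. {ks. length ks = m \<and> set ks \<subseteq> {1..K} \<and> sorted ks}"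
  have fin: "finite {ks. length ks = m \<and> set ks \<subseteq> {1..K}}" for m and K :: nat
    using finite_lists_length_eq[of "{1..K}" m] by (simp add: conj_commute)
  have finL: "finite (?L K m)" for K m :: nat by (rule finite_subset[OF _ fin[of m K]]) auto
  \<comment> \<open>Unsorted labellings have weight 0; the cut into prefix and suffix makes sense
    for the sorted ones.\<close>
  have chi_sorted: "chi K bs = (\<Sum>ks\<in>?L K (length bs). label_weight K ks * (\<Prod>a<length bs. (bs ! a) (ks ! a)))"
    for K bs
    unfolding chi_def by (rule sum.mono_neutral_right[OF fin]) (auto simp: label_weight_def)
  let ?f = "\<lambda>ks. label_weight (Suc K) ks * (\<Prod>a<?m. (bs ! a) (ks ! a))"
  have "chi (Suc K) bs = (\<Sum>(j, ks)\<in>Sigma {..?m} (?L K). ?f (ks @ replicate (?m - j) (Suc K)))"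
    unfolding chi_sorted
  proof (rule sum.reindex_bij_witness[where i = "\<lambda>(j, ks). ks @ replicate (?m - j) (Suc K)"
        and j = "\<lambda>ks. (length (takeWhile (\<lambda>k. k \<le> K) ks), takeWhile (\<lambda>k. k \<le> K) ks)"], goal_cases)
    case (1 ks) then show ?case using takeWhile_sorted_split[of ks K] by simp
  next
    case (2 ks) then show ?case 
      by (force dest!: set_takeWhileD intro: length_takeWhile_le[THEN order_trans] sorted_takeWhile)
  next
    case (3 jk)
    then obtain j ks where jk: "jk = (j, ks)" "j \<le> ?m" "length ks = j" "set ks \<subseteq> {1..K}" by auto
    have "takeWhile (\<lambda>k. k \<le> K) (ks @ replicate (?m - j) (Suc K)) = ks"
      using jk(4) by (subst takeWhile_append2) (auto simp: takeWhile_replicate)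
    then show ?case using jk by simp
  next
    case (4 jk) then show ?case by (fastforce simp: sorted_append)
  next
    case (5 ks) then show ?case using takeWhile_sorted_split[of ks K] by simp
  qed
  also have "\<dots> = (\<Sum>j\<le>?m. \<Sum>ks\<in>?L K j. ?f (ks @ replicate (?m - j) (Suc K)))"
    by (subst sum.Sigma) (use finL in auto)
  also have "\<dots> = (\<Sum>j\<le>?m. chi K (take j bs) * (prod_list (map (\<lambda>b. b (Suc K)) (drop j bs)) / fact (?m - j)))"
  proof (rule sum.cong[OF refl])
    fix j assume j: "j \<in> {..?m}"
    have "?f (ks @ replicate (?m - j) (Suc K)) =
        (label_weight K ks * (\<Prod>a<j. (take j bs ! a) (ks ! a))) *
        (prod_list (map (\<lambda>b. b (Suc K)) (drop j bs)) / fact (?m - j))" if ks: "ks \<in> ?L K j" for ks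
    proof -
      have "(\<Prod>a<?m. (bs ! a) ((ks @ replicate (?m - j) (Suc K)) ! a)) =
          (\<Prod>a<j. (bs ! a) ((ks @ replicate (?m - j) (Suc K)) ! a)) *
          (\<Prod>a=j..<?m. (bs ! a) ((ks @ replicate (?m - j) (Suc K)) ! a))"
        using j by (subst lessThan_atLeast0, subst prod.atLeastLessThan_concat[symmetric, of 0 j])
          (auto simp: lessThan_atLeast0)
      also have "(\<Prod>a<j. (bs ! a) ((ks @ replicate (?m - j) (Suc K)) ! a)) = (\<Prod>a<j. (take j bs ! a) (ks ! a))"
        using ks by (intro prod.cong) (auto simp: nth_append)
      also have "(\<Prod>a=j..<?m. (bs ! a) ((ks @ replicate (?m - j) (Suc K)) ! a)) = (\<Prod>a=j..<?m. (bs ! a) (Suc K))"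
        using ks by (intro prod.cong) (auto simp: nth_append)
      also have "\<dots> = (\<Prod>a<?m - j. (drop j bs ! a) (Suc K))"
        using j by (intro prod.reindex_bij_witness[where i = "\<lambda>a. a + j" and j = "\<lambda>a. a - j"])
          (auto simp: add.commute)
      also have "\<dots> = prod_list (map (\<lambda>b. b (Suc K)) (drop j bs))"
        by (simp add: prod.list_conv_set_nth lessThan_atLeast0)
      finally show ?thesis using ks label_weight_append[of ks K "?m - j"] by simp
    qed
    then have "(\<Sum>ks\<in>?L K j. ?f (ks @ replicate (?m - j) (Suc K))) =
        (\<Sum>ks\<in>?L K j. (label_weight K ks * (\<Prod>a<j. (take j bs ! a) (ks ! a))) *
        (prod_list (map (\<lambda>b. b (Suc K)) (drop j bs)) / fact (?m - j)))"
      by (rule sum.cong[OF refl])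
    then show "(\<Sum>ks\<in>?L K j. ?f (ks @ replicate (?m - j) (Suc K))) =
        chi K (take j bs) * (prod_list (map (\<lambda>b. b (Suc K)) (drop j bs)) / fact (?m - j))"
      using j by (simp only: chi_sorted sum_distrib_right length_take min_absorb2 atMost_iff)
  qed
  finally show ?thesis .
qed

section \<open>The shuffle identity for word coefficients\<close>

lemma sum_splits_Cons:
  "(\<Sum>j\<le>length (x # xs). F (take j (x # xs)) (drop j (x # xs))) =
   F [] (x # xs) + (\<Sum>j\<le>length xs. F (x # take j xs) (drop j xs))"
  by (simp add: sum.atMost_Suc_shift del: sum.atMost_Suc)

lemma interleavings_Nil2 [simp]: "interleavings xs [] = [xs]"
  by (cases xs) auto

text \<open>Deconcatenation is a morphism for the shuffle product: a cut of an interleaving cuts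
  both words, and its two sides are arbitrary interleavings of the two initial and of the two final
  pieces.\<close>

lemma sum_interleavings_splits:
  fixes F G :: "'a list \<Rightarrow> real"
  shows "(\<Sum>zs\<leftarrow>interleavings xs ys. \<Sum>j\<le>length zs. F (take j zs) * G (drop j zs)) =
    (\<Sum>i\<le>length xs. \<Sum>j\<le>length ys. (\<Sum>zs\<leftarrow>interleavings (take i xs) (take j ys). F zs) *
       (\<Sum>zs\<leftarrow>interleavings (drop i xs) (drop j ys). G zs))"
\<comment> \<open>The first letter of an interleaving is absorbed into \<open>F\<close>, which is
  why \<open>F\<close> must vary; \<open>G\<close> only sees final pieces and stays fixed.\<close>
proof (induction xs ys arbitrary: F rule: interleavings.induct)
  case (3 x xs y ys)
  have split: "(\<Sum>j\<le>length (z # zs). F (take j (z # zs)) * G (drop j (z # zs))) =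
      F [] * G (z # zs) + (\<Sum>j\<le>length zs. F (z # take j zs) * G (drop j zs))" for z zs
    by (rule sum_splits_Cons)
  let ?I = "interleavings" and ?S = "\<lambda>F zss. \<Sum>zs\<leftarrow>zss. F zs"
  have "(\<Sum>zs\<leftarrow>?I (x # xs) (y # ys). \<Sum>j\<le>length zs. F (take j zs) * G (drop j zs)) =
     F [] * ?S G (?I (x # xs) (y # ys)) +
     (\<Sum>zs\<leftarrow>?I xs (y # ys). \<Sum>j\<le>length zs. F (x # take j zs) * G (drop j zs)) +
     (\<Sum>zs\<leftarrow>?I (x # xs) ys. \<Sum>j\<le>length zs. F (y # take j zs) * G (drop j zs))"
    by (simp only: interleavings.simps map_append map_map sum_list_append comp_def split sum_list_addf
        sum_list_const_mult distrib_left add.assoc add.left_commute)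
  also have "(\<Sum>zs\<leftarrow>?I xs (y # ys). \<Sum>j\<le>length zs. F (x # take j zs) * G (drop j zs)) =
     (\<Sum>i\<le>length xs. ?S F [x # take i xs] * ?S G (?I (drop i xs) (y # ys))) +
     (\<Sum>i\<le>length xs. \<Sum>j\<le>length ys. ?S (\<lambda>z. F (x # z)) (?I (take i xs) (y # take j ys)) *
       ?S G (?I (drop i xs) (drop j ys)))"
    unfolding "3.IH"(1)[of "\<lambda>z. F (x # z)"]
    by (simp add: sum.atMost_Suc_shift sum.distrib del: sum.atMost_Suc)
  also have "(\<Sum>zs\<leftarrow>?I (x # xs) ys. \<Sum>j\<le>length zs. F (y # take j zs) * G (drop j zs)) =
     (\<Sum>j\<le>length ys. ?S F [y # take j ys] * ?S G (?I (x # xs) (drop j ys))) +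
     (\<Sum>i\<le>length xs. \<Sum>j\<le>length ys. ?S (\<lambda>z. F (y # z)) (?I (x # take i xs) (take j ys)) *
       ?S G (?I (drop i xs) (drop j ys)))"
    unfolding "3.IH"(2)[of "\<lambda>z. F (y # z)"]
    by (simp add: sum.atMost_Suc_shift sum.distrib del: sum.atMost_Suc)
  also have "F [] * ?S G (?I (x # xs) (y # ys)) +
     ((\<Sum>i\<le>length xs. ?S F [x # take i xs] * ?S G (?I (drop i xs) (y # ys))) +
     (\<Sum>i\<le>length xs. \<Sum>j\<le>length ys. ?S (\<lambda>z. F (x # z)) (?I (take i xs) (y # take j ys)) *
       ?S G (?I (drop i xs) (drop j ys)))) +
     ((\<Sum>j\<le>length ys. ?S F [y # take j ys] * ?S G (?I (x # xs) (drop j ys))) +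
     (\<Sum>i\<le>length xs. \<Sum>j\<le>length ys. ?S (\<lambda>z. F (y # z)) (?I (x # take i xs) (take j ys)) *
       ?S G (?I (drop i xs) (drop j ys)))) =
     (\<Sum>i\<le>length (x # xs). \<Sum>j\<le>length (y # ys). ?S F (?I (take i (x # xs)) (take j (y # ys))) *
       ?S G (?I (drop i (x # xs)) (drop j (y # ys))))"
    by (simp add: sum.atMost_Suc_shift sum.distrib comp_def distrib_right del: sum.atMost_Suc)
  finally show ?case .
qed simp_all

lemma length_interleavings: "length (interleavings xs ys) = (length xs + length ys) choose length xs"
  by (induction xs ys rule: interleavings.induct) auto

text \<open>Cuts are compatible with shuffles, so multiplicativity passes from \<open>K\<close>
  exponentials and from a single one to \<open>Suc K\<close>. For a single exponential all
  interleavings have the same product of letters, and their number divided by the factorial of the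
  total length is the product of the two reciprocal factorials.\<close>

lemma chi_shuffle: "(\<Sum>zs\<leftarrow>interleavings xs ys. chi K zs) = chi K xs * chi K ys"
proof (induction K arbitrary: xs ys)
  case 0
  then show ?case by (cases xs; cases ys) (auto simp: chi_0 comp_def)
next
  case (Suc K)
  define G where "G = (\<lambda>bs :: (nat \<Rightarrow> real) list. prod_list (map (\<lambda>b. b (Suc K)) bs) / fact (length bs))"
  have chi: "chi (Suc K) bs = (\<Sum>j\<le>length bs. chi K (take j bs) * G (drop j bs))" for bs
    unfolding chi_Suc G_def by simp
  have "(\<Sum>zs\<leftarrow>interleavings xs ys. G zs) = G xs * G ys" for xs ys
  proof -
    have "G zs = prod_list (map (\<lambda>b. b (Suc K)) xs) * prod_list (map (\<lambda>b. b (Suc K)) ys) /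
        fact (length xs + length ys)" if "zs \<in> set (interleavings xs ys)" for zs
    proof -
      have "prod_mset (image_mset (\<lambda>b. b (Suc K)) (mset zs)) = prod_list (map (\<lambda>b. b (Suc K)) xs) *
          prod_list (map (\<lambda>b. b (Suc K)) ys)"
        by (simp add: mset_interleavings[OF that] prod_mset_prod_list flip: mset_map)
      moreover have "prod_mset (image_mset (\<lambda>b. b (Suc K)) (mset zs)) = prod_list (map (\<lambda>b. b (Suc K)) zs)"
        by (simp add: prod_mset_prod_list flip: mset_map)
      moreover have "length zs = length xs + length ys"
        using arg_cong[OF mset_interleavings[OF that], of size] by simp
      ultimately show ?thesis by (simp add: G_def)
    qed
    then have "(\<Sum>zs\<leftarrow>interleavings xs ys. G zs) =
       (\<Sum>zs\<leftarrow>interleavings xs ys. prod_list (map (\<lambda>b. b (Suc K)) xs) * prod_list (map (\<lambda>b. b (Suc K)) ys) /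
        fact (length xs + length ys))" by (intro arg_cong[of _ _ sum_list] map_cong) auto
    also have "\<dots> = G xs * G ys"
      by (simp add: sum_list_triv length_interleavings binomial_fact G_def)
    finally show ?thesis .
  qed
  then show ?case
    unfolding chi sum_interleavings_splits Suc.IH
    by (simp add: sum_product mult_ac)
qed

section \<open>Sums over the nodes of a forest\<close>

lemma node_at_Cons:
  "node_at ts (a # v) =
     (if a < length ts then if v = [] then Some (ts ! a) else node_at (children (ts ! a)) v else None)"
  by (cases v) auto

lemma Nil_notin_nodes [simp]: "[] \<notin> nodes ts"
  by (simp add: nodes_def)

lemma Cons_in_nodes:
  "a # v \<in> nodes ts \<longleftrightarrow> a < length ts \<and> (v = [] \<or> v \<in> nodes (children (ts ! a)))"
  by (auto simp: nodes_def node_at_Cons)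

lemma nodes_eq: "nodes ts = (\<Union>a<length ts. insert [a] ((#) a ` nodes (children (ts ! a))))"
proof (rule set_eqI)
  fix v show "v \<in> nodes ts \<longleftrightarrow> v \<in> (\<Union>a<length ts. insert [a] ((#) a ` nodes (children (ts ! a))))"
    by (cases v) (auto simp: Cons_in_nodes)
qed

lemma nodes_Nil [simp]: "nodes [] = {}"
  by (subst nodes_eq) simp

lemma finite_nodes_children: "finite (nodes (children t))"
proof (induction t)
  case (Black ts)
  then show ?case by (subst nodes_eq) simp
qed simp

lemma finite_nodes [simp]: "finite (nodes ts)"
  by (subst nodes_eq) (auto simp: finite_nodes_children)

lemma prod_nodes:
  "(\<Prod>v\<in>nodes ts. F v) = (\<Prod>a<length ts. F [a] * (\<Prod>v\<in>nodes (children (ts ! a)). F (a # v)))"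
proof -
  have "(\<Prod>v\<in>nodes ts. F v) = (\<Prod>a<length ts. \<Prod>v\<in>insert [a] ((#) a ` nodes (children (ts ! a))). F v)"
    by (subst nodes_eq, rule prod.UNION_disjoint) auto
  also have "\<dots> = (\<Prod>a<length ts. F [a] * (\<Prod>v\<in>nodes (children (ts ! a)). F (a # v)))"
    by (intro prod.cong refl, subst prod.insert) (auto simp: prod.reindex)
  finally show ?thesis .
qed

lemma node_at_snoc:
  "v \<noteq> [] \<Longrightarrow> node_at ts (v @ [j]) = (case node_at ts v of None \<Rightarrow> None
     | Some t \<Rightarrow> if j < length (children t) then Some (children t ! j) else None)"
  by (induction v arbitrary: ts) (auto simp: node_at_Cons)

lemma kids_Nil: "kids ts [] = map (\<lambda>j. [j]) [0..<length ts]"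
proof -
  have "{j. [j] \<in> nodes ts} = {..<length ts}" by (auto simp: Cons_in_nodes)
  then show ?thesis by (simp add: kids_def)
qed

lemma kids_node:
  assumes "node_at ts v = Some t"
  shows "kids ts v = map (\<lambda>j. v @ [j]) [0..<length (children t)]"
proof -
  have "v \<noteq> []" using assms by auto
  then have "{j. v @ [j] \<in> nodes ts} = {..<length (children t)}"
    using assms by (auto simp: nodes_def node_at_snoc split: if_splits)
  then show ?thesis by (simp add: kids_def)
qed

lemma kids_Cons: "a < length ts \<Longrightarrow> kids ts (a # v) = map ((#) a) (kids (children (ts ! a)) v)"
  by (simp add: kids_def Cons_in_nodes comp_def)

text \<open>\<open>kids\<close> counts the children and lists that many initial positions. This
  agrees with the actual children because their positions form an initial segment.\<close>

lemma set_kids: "v = [] \<or> v \<in> nodes ts \<Longrightarrow> set (kids ts v) = {w \<in> nodes ts. parent w = v}"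
proof -
  assume v: "v = [] \<or> v \<in> nodes ts"
  have *: "\<exists>n. {j. v @ [j] \<in> nodes ts} = {..<n}"
  proof (cases "v = []")
    case True
    then have "{j. v @ [j] \<in> nodes ts} = {..<length ts}" by (auto simp: Cons_in_nodes)
    then show ?thesis by blast
  next
    case False
    then obtain t where "node_at ts v = Some t" using v by (auto simp: nodes_def)
    then have "{j. v @ [j] \<in> nodes ts} = {..<length (children t)}"
      using False by (auto simp: nodes_def node_at_snoc split: if_splits)
    then show ?thesis by blast
  qed
  then obtain n where n: "{j. v @ [j] \<in> nodes ts} = {..<n}" ..
  have "set (kids ts v) = (\<lambda>j. v @ [j]) ` {j. v @ [j] \<in> nodes ts}"
    unfolding kids_def n by (simp add: atLeast0LessThan)
  also have "\<dots> = {w \<in> nodes ts. parent w = v}"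
  proof (intro equalityI subsetI)
    fix w assume w: "w \<in> {w \<in> nodes ts. parent w = v}"
    then have "w \<noteq> []" by auto
    then have "w = v @ [last w]" using w append_butlast_last_id[of w] by (simp add: parent_def)
    then show "w \<in> (\<lambda>j. v @ [j]) ` {j. v @ [j] \<in> nodes ts}" using w
      by (metis (mono_tags, lifting) image_eqI mem_Collect_eq)
  qed (auto simp: parent_def)
  finally show ?thesis .
qed

lemma parent_in_nodes:
  assumes "v \<in> nodes ts" "\<not> is_root v" shows "parent v \<in> nodes ts"
proof -
  have "v \<noteq> []" using assms by auto
  then have "v = parent v @ [last v]" by (simp add: parent_def)
  moreover have "parent v \<noteq> []" using assms by (simp add: is_root_def)
  ultimately show ?thesis using assms(1) node_at_snoc[of "parent v" ts "last v"]
    by (auto simp: nodes_def split: option.splits)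
qed

lemma parent_Cons: "v \<noteq> [] \<Longrightarrow> parent (a # v) = a # parent v"
  by (simp add: parent_def)

section \<open>Decorations of nodes and local weights\<close>

definition node_label :: "'n ptree list \<Rightarrow> nat list \<Rightarrow> 'n option" where
  "node_label ts v = (case node_at ts v of Some (Num n) \<Rightarrow> Some n | _ \<Rightarrow> None)"

lemma node_label_Cons:
  "a < length ts \<Longrightarrow> v \<noteq> [] \<Longrightarrow> node_label ts (a # v) = node_label (children (ts ! a)) v"
  by (simp add: node_label_def node_at_Cons)

lemma node_label_root:
  "a < length ts \<Longrightarrow> node_label ts [a] = (case ts ! a of Num n \<Rightarrow> Some n | _ \<Rightarrow> None)"
  by (simp add: node_label_def)

text \<open>Inverse of restricting a decoration to the roots and to the forests below them. An
  address of length one is a root, so an empty tail selects \<open>r\<close>.\<close>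

definition glue :: "'n ptree list \<Rightarrow> (nat \<Rightarrow> 's) \<Rightarrow> (nat \<Rightarrow> nat list \<Rightarrow> 's) \<Rightarrow> nat list \<Rightarrow> 's" where
  "glue ts r \<tau> = (\<lambda>v\<in>nodes ts. if tl v = [] then r (hd v) else \<tau> (hd v) (tl v))"

lemma sum_PiE_nodes:
  "(\<Sum>\<sigma>\<in>PiE (nodes ts) S. F \<sigma>) =
   (\<Sum>r\<in>PiE {..<length ts} (\<lambda>a. S [a]).
      \<Sum>\<tau>\<in>PiE {..<length ts} (\<lambda>a. PiE (nodes (children (ts ! a))) (\<lambda>v. S (a # v))). F (glue ts r \<tau>))"
proof -
  let ?m = "length ts" and ?N = "\<lambda>a. nodes (children (ts ! a))"
  have ne: "v \<in> nodes ts \<Longrightarrow> v \<noteq> []" for v by auto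
  show ?thesis
    unfolding sum.cartesian_product
  proof (rule sum.reindex_bij_witness[where i = "\<lambda>(r, \<tau>). glue ts r \<tau>" and
        j = "\<lambda>\<sigma>. (\<lambda>a\<in>{..<?m}. \<sigma> [a], \<lambda>a\<in>{..<?m}. \<lambda>v\<in>?N a. \<sigma> (a # v))"], goal_cases)
    case (1 \<sigma>)
    have "glue ts (\<lambda>a\<in>{..<?m}. \<sigma> [a]) (\<lambda>a\<in>{..<?m}. \<lambda>v\<in>?N a. \<sigma> (a # v)) v = \<sigma> v" for v
      using 1 by (cases v) (auto simp: glue_def Cons_in_nodes PiE_def extensional_def)
    then show ?case by auto
  next
    case (2 \<sigma>) then show ?case by (auto simp: Cons_in_nodes PiE_def Pi_def extensional_def)
  next
    case (3 p)
    obtain r \<tau> where p: "p = (r, \<tau>)" by (cases p)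
    have r: "(\<lambda>a\<in>{..<?m}. glue ts r \<tau> [a]) = r"
      using 3 p by (auto simp: glue_def Cons_in_nodes PiE_def extensional_def fun_eq_iff)
    have "(\<lambda>v\<in>?N a. glue ts r \<tau> (a # v)) = \<tau> a" if "a < ?m" for a
    proof
      fix v show "(\<lambda>v\<in>?N a. glue ts r \<tau> (a # v)) v = \<tau> a v"
        using 3 p that by (cases "v = []") (auto simp: glue_def Cons_in_nodes PiE_def extensional_def Pi_def)
    qed
    then have "(\<lambda>a\<in>{..<?m}. \<lambda>v\<in>?N a. glue ts r \<tau> (a # v)) = \<tau>"
      using 3 p by (auto simp: PiE_def extensional_def fun_eq_iff)
    with r p show ?case by simp
  next
    case (4 p)
    obtain r \<tau> where p: "p = (r, \<tau>)" by (cases p)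
    have "glue ts r \<tau> v \<in> S v" if "v \<in> nodes ts" for v
      using 4 p that by (cases v) (auto simp: glue_def Cons_in_nodes PiE_def Pi_def)
    then show ?case unfolding p by (auto simp: glue_def PiE_def Pi_def)
  next
    case (5 \<sigma>)
    have "glue ts (\<lambda>a\<in>{..<?m}. \<sigma> [a]) (\<lambda>a\<in>{..<?m}. \<lambda>v\<in>?N a. \<sigma> (a # v)) v = \<sigma> v" for v
      using 5 by (cases v) (auto simp: glue_def Cons_in_nodes PiE_def extensional_def)
    then have "glue ts (\<lambda>a\<in>{..<?m}. \<sigma> [a]) (\<lambda>a\<in>{..<?m}. \<lambda>v\<in>?N a. \<sigma> (a # v)) = \<sigma>" by auto
    then show ?case by simp
  qed
qed

text \<open>A local weight, as for a Markov field on a tree: a node interacts with its parent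
  through \<open>ed\<close> and with the word of its children through \<open>lo\<close>. The roots
  are the children of a virtual node with state \<open>s0\<close> and factor
  \<open>lo0\<close>.\<close>

definition tree_weight :: "('n option \<Rightarrow> 's \<Rightarrow> 's \<Rightarrow> real) \<Rightarrow> ('n option \<Rightarrow> 's \<Rightarrow> 's list \<Rightarrow> real) \<Rightarrow> 's \<Rightarrow>
    ('s list \<Rightarrow> real) \<Rightarrow> 'n ptree list \<Rightarrow> (nat list \<Rightarrow> 's) \<Rightarrow> real" where
  "tree_weight ed lo s0 lo0 ts \<sigma> = lo0 (map \<sigma> (kids ts [])) *
     (\<Prod>v\<in>nodes ts. ed (node_label ts v) (if is_root v then s0 else \<sigma> (parent v)) (\<sigma> v) *
        lo (node_label ts v) (\<sigma> v) (map \<sigma> (kids ts v)))"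

definition tree_sum :: "('n option \<Rightarrow> 's set) \<Rightarrow> ('n option \<Rightarrow> 's \<Rightarrow> 's \<Rightarrow> real) \<Rightarrow>
    ('n option \<Rightarrow> 's \<Rightarrow> 's list \<Rightarrow> real) \<Rightarrow> 's \<Rightarrow> ('s list \<Rightarrow> real) \<Rightarrow> 'n ptree list \<Rightarrow> real" where
  "tree_sum S ed lo s0 lo0 ts =
     (\<Sum>\<sigma>\<in>PiE (nodes ts) (\<lambda>v. S (node_label ts v)). tree_weight ed lo s0 lo0 ts \<sigma>)"

text \<open>Below a root, that root takes the place of the virtual node: its state becomes
  \<open>s0\<close> and its \<open>lo\<close> becomes \<open>lo0\<close>. This self-similarity turns
  the global sum into a recursion.\<close>

lemma tree_weight_glue:
  "tree_weight ed lo s0 lo0 ts (glue ts r \<tau>) = lo0 (map r [0..<length ts]) *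
     (\<Prod>a<length ts. ed (node_label ts [a]) s0 (r a) *
        tree_weight ed lo (r a) (lo (node_label ts [a]) (r a)) (children (ts ! a)) (\<tau> a))"
proof -
  let ?\<sigma> = "glue ts r \<tau>"
  have root: "?\<sigma> [a] = r a" if "a < length ts" for a
    using that by (simp add: glue_def Cons_in_nodes)
  have sub: "?\<sigma> (a # v) = \<tau> a v" if "a < length ts" "v \<in> nodes (children (ts ! a))" for a v
    using that by (auto simp: glue_def Cons_in_nodes)
  have kids: "map ?\<sigma> (kids ts (a # v)) = map (\<tau> a) (kids (children (ts ! a)) v)"
    if "a < length ts" "v = [] \<or> v \<in> nodes (children (ts ! a))" for a v
    using that set_kids[OF that(2)] by (auto simp: kids_Cons sub)
  have 1: "map ?\<sigma> (kids ts []) = map r [0..<length ts]"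
    by (simp add: kids_Nil root)
  have par: "(if is_root (a # v) then s0 else ?\<sigma> (parent (a # v))) = (if is_root v then r a else \<tau> a
      (parent v))"
    if "a < length ts" "v \<in> nodes (children (ts ! a))" for a v
  proof -
    have "v \<noteq> []" using that(2) by auto
    then have "parent (a # v) = a # parent v" by (rule parent_Cons)
    then show ?thesis using that parent_in_nodes[OF that(2)] by (auto simp: is_root_def root sub)
  qed
  have 2: "(\<Prod>v\<in>nodes ts. ed (node_label ts v) (if is_root v then s0 else ?\<sigma> (parent v)) (?\<sigma> v) *
        lo (node_label ts v) (?\<sigma> v) (map ?\<sigma> (kids ts v))) =
     (\<Prod>a<length ts. ed (node_label ts [a]) s0 (r a) *
        tree_weight ed lo (r a) (lo (node_label ts [a]) (r a)) (children (ts ! a)) (\<tau> a))"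
    unfolding prod_nodes[of _ ts]
  proof (intro prod.cong refl)
    fix a assume a: "a \<in> {..<length ts}"
    have "(\<Prod>v\<in>nodes (children (ts ! a)). ed (node_label ts (a # v)) (if is_root (a # v) then s0 else ?\<sigma>
        (parent (a # v))) (?\<sigma> (a # v)) *
        lo (node_label ts (a # v)) (?\<sigma> (a # v)) (map ?\<sigma> (kids ts (a # v)))) =
      (\<Prod>v\<in>nodes (children (ts ! a)). ed (node_label (children (ts ! a)) v) (if is_root v then r a else \<tau> a
          (parent v)) (\<tau> a v) *
        lo (node_label (children (ts ! a)) v) (\<tau> a v) (map (\<tau> a) (kids (children (ts ! a)) v)))"
    proof (rule prod.cong[OF refl])
      fix v assume v: "v \<in> nodes (children (ts ! a))"
      have "v \<noteq> []" using v by auto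
      then have "node_label ts (a # v) = node_label (children (ts ! a)) v"
        using a by (simp add: node_label_Cons)
      then show "ed (node_label ts (a # v)) (if is_root (a # v) then s0 else ?\<sigma> (parent (a # v))) (?\<sigma> (a # v)) *
        lo (node_label ts (a # v)) (?\<sigma> (a # v)) (map ?\<sigma> (kids ts (a # v))) =
        ed (node_label (children (ts ! a)) v) (if is_root v then r a else \<tau> a (parent v)) (\<tau> a v) *
        lo (node_label (children (ts ! a)) v) (\<tau> a v) (map (\<tau> a) (kids (children (ts ! a)) v))"
        using a v by (subst par) (simp_all add: kids sub)
    qed
    moreover have "is_root [a]" by (simp add: is_root_def parent_def)
    ultimately show "ed (node_label ts [a]) (if is_root [a] then s0 else ?\<sigma> (parent [a])) (?\<sigma> [a]) *
         lo (node_label ts [a]) (?\<sigma> [a]) (map ?\<sigma> (kids ts [a])) *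
         (\<Prod>v\<in>nodes (children (ts ! a)).
           ed (node_label ts (a # v)) (if is_root (a # v) then s0 else ?\<sigma> (parent (a # v))) (?\<sigma> (a # v)) *
           lo (node_label ts (a # v)) (?\<sigma> (a # v)) (map ?\<sigma> (kids ts (a # v)))) =
         ed (node_label ts [a]) s0 (r a) *
         tree_weight ed lo (r a) (lo (node_label ts [a]) (r a)) (children (ts ! a)) (\<tau> a)"
      using a by (simp add: tree_weight_def root kids mult_ac)
  qed
  show ?thesis unfolding tree_weight_def[of ed lo s0 lo0 ts ?\<sigma>] 1 2 ..
qed

text \<open>Once the states of the roots are fixed, the forests below them are independent, so the
  sum over their decorations is a product of sums.\<close>

lemma tree_sum_rec:
  assumes "\<And>n. finite (S n)"
  shows "tree_sum S ed lo s0 lo0 ts =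
    (\<Sum>r\<in>PiE {..<length ts} (\<lambda>a. S (node_label ts [a])). lo0 (map r [0..<length ts]) *
       (\<Prod>a<length ts. ed (node_label ts [a]) s0 (r a) *
          tree_sum S ed lo (r a) (lo (node_label ts [a]) (r a)) (children (ts ! a))))"
proof -
  have S: "PiE {..<length ts} (\<lambda>a. PiE (nodes (children (ts ! a))) (\<lambda>v. S (node_label ts (a # v)))) =
     PiE {..<length ts} (\<lambda>a. PiE (nodes (children (ts ! a))) (\<lambda>v. S (node_label (children (ts ! a)) v)))"
  proof (intro PiE_cong)
    fix a v assume "a \<in> {..<length ts}" "v \<in> nodes (children (ts ! a))"
    moreover from this have "v \<noteq> []" by auto
    ultimately show "S (node_label ts (a # v)) = S (node_label (children (ts ! a)) v)"
      by (simp add: node_label_Cons)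
  qed
  have fin: "finite (PiE (nodes (children (ts ! a))) (\<lambda>v. S (node_label (children (ts ! a)) v)))" for a
    by (intro finite_PiE) (auto simp: assms)
  have expand: "tree_sum S ed lo s0 lo0 ts =
     (\<Sum>r\<in>PiE {..<length ts} (\<lambda>a. S (node_label ts [a])). lo0 (map r [0..<length ts]) *
       (\<Sum>\<tau>\<in>PiE {..<length ts} (\<lambda>a. PiE (nodes (children (ts ! a))) (\<lambda>v. S (node_label (children (ts ! a)) v))).
       (\<Prod>a<length ts. ed (node_label ts [a]) s0 (r a) *
          tree_weight ed lo (r a) (lo (node_label ts [a]) (r a)) (children (ts ! a)) (\<tau> a))))"
    unfolding tree_sum_def sum_PiE_nodes S tree_weight_glue sum_distrib_left ..
  have "(\<Sum>\<tau>\<in>PiE {..<length ts} (\<lambda>a. PiE (nodes (children (ts ! a))) (\<lambda>v. S (node_label (children (ts ! a)) v))).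
       (\<Prod>a<length ts. ed (node_label ts [a]) s0 (r a) *
          tree_weight ed lo (r a) (lo (node_label ts [a]) (r a)) (children (ts ! a)) (\<tau> a))) =
       (\<Prod>a<length ts. ed (node_label ts [a]) s0 (r a) *
          tree_sum S ed lo (r a) (lo (node_label ts [a]) (r a)) (children (ts ! a)))" for r
    unfolding tree_sum_def sum_distrib_left by (rule prod_sum_PiE[symmetric]) (simp_all add: fin)
  then show ?thesis unfolding expand by simp
qed

lemma tree_sum_Nil: "tree_sum S ed lo s0 lo0 [] = lo0 []"
  by (simp add: tree_sum_def tree_weight_def kids_Nil)

section \<open>Isserlis' formula\<close>

definition gauss_moment :: "nat \<Rightarrow> real" where
  "gauss_moment n = (\<integral>x. std_normal_density x * x ^ n \<partial>lborel)"

lemma gauss_moment_even: "gauss_moment (2 * k) = fact (2 * k) / (2 ^ k * fact k)"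
  unfolding gauss_moment_def using std_normal_moment_even[of k] by (simp add: has_bochner_integral_iff)

lemma gauss_moment_odd: "gauss_moment (Suc (2 * k)) = 0"
  unfolding gauss_moment_def using std_normal_moment_odd[of k] by (simp add: has_bochner_integral_iff)

text \<open>Integration by parts against the standard normal density, read off from the closed
  formulas of the moments. For \<open>n = 0\<close> the truncated \<open>n - 1\<close> is harmless
  because of the factor \<open>n\<close>.\<close>

lemma gauss_moment_rec: "gauss_moment (Suc n) = n * gauss_moment (n - 1)"
proof (cases "even n")
  case True
  then obtain k where k: "n = 2 * k" by (rule evenE)
  show ?thesis
  proof (cases k)
    case (Suc j)
    then have "n - 1 = Suc (2 * j)" using k by simp
    then show ?thesis by (simp only: k gauss_moment_odd)
  qed (use k gauss_moment_odd[of 0] in simp)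
next
  case False
  then obtain k where k: "n = 2 * k + 1" by (rule oddE)
  have "gauss_moment (Suc n) = gauss_moment (2 * Suc k)" using k by simp
  also have "\<dots> = n * gauss_moment (2 * k)"
  proof -
    have "(fact (2 * Suc k) :: real) = (2 * (real k + 1)) * ((2 * real k + 1) * fact (2 * k))"
      by (simp add: algebra_simps)
    moreover have "(2 ^ Suc k * fact (Suc k) :: real) = (2 * (real k + 1)) * (2 ^ k * fact k)"
      by (simp add: algebra_simps)
    moreover have "2 * (real k + 1) \<noteq> 0" by simp
    ultimately show ?thesis unfolding gauss_moment_even k by (simp only: mult_divide_mult_cancel_left) simp
  qed
  finally show ?thesis using k by simp
qed

section \<open>Perfect matchings of a finite set\<close>

definition pairings :: "'a set \<Rightarrow> 'a set set set" where
  "pairings V = {P. \<Union>P = V \<and> disjoint P \<and> (\<forall>e\<in>P. card e = 2)}"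

lemma pairings_subset: "pairings V \<subseteq> Pow (Pow V)"
  by (auto simp: pairings_def)

lemma finite_pairings: "finite V \<Longrightarrow> finite (pairings V)"
  by (rule finite_subset[OF pairings_subset]) simp

lemma pairings_empty: "pairings {} = {{}}"
proof -
  have "P = {}" if "P \<in> pairings ({} :: 'a set)" for P
  proof (rule ccontr)
    assume "P \<noteq> {}"
    then obtain e where "e \<in> P" by blast
    moreover from this have "e = {}" using that by (auto simp: pairings_def)
    ultimately show False using that by (auto simp: pairings_def)
  qed
  then show ?thesis by (auto simp: pairings_def)
qed

lemma finite_pairing: "finite V \<Longrightarrow> P \<in> pairings V \<Longrightarrow> finite P"
  using pairings_subset[of V] by (meson PowD finite_Pow_iff finite_subset subset_eq)

lemma pairings_even: "finite V \<Longrightarrow> P \<in> pairings V \<Longrightarrow> card V = 2 * card P"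
proof -
  assume V: "finite V" and P: "P \<in> pairings V"
  have "card (\<Union>P) = sum card P"
    using P V by (intro card_Union_disjoint) (auto simp: pairings_def disjoint_def pairwise_def
        card_ge_0_finite)
  then show ?thesis using P by (simp add: pairings_def)
qed

lemma insert_pairing:
  assumes "w \<in> V - {v}" "v \<in> V" "P \<in> pairings (V - {v, w})"
  shows "insert {v, w} P \<in> pairings V"
proof -
  have U: "\<Union>P = V - {v, w}" and D: "disjoint P" and C: "\<forall>e\<in>P. card e = 2"
    using assms(3) by (auto simp: pairings_def)
  have "e \<inter> {v, w} = {}" if "e \<in> P" for e using U that by auto
  then have "disjoint (insert {v, w} P)"
    using D by (simp add: disjoint_def Int_commute)
  moreover have "\<Union>(insert {v, w} P) = V" using U assms(1,2) by auto
  ultimately show ?thesis using C assms(1) by (simp add: pairings_def eq_commute[of v w])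
qed

lemma pairing_remove:
  assumes "P \<in> pairings V" "{v, w} \<in> P"
  shows "P - {{v, w}} \<in> pairings (V - {v, w})"
proof -
  have U: "\<Union>P = V" and D: "disjoint P" and C: "\<forall>e\<in>P. card e = 2"
    using assms(1) by (auto simp: pairings_def)
  have "e \<inter> {v, w} = {}" if "e \<in> P - {{v, w}}" for e
    using D assms(2) that by (auto simp: disjoint_def)
  then have "\<Union>(P - {{v, w}}) = V - {v, w}" using U by auto
  moreover have "disjoint (P - {{v, w}})" using D by (simp add: disjoint_def)
  ultimately show ?thesis using C by (simp add: pairings_def)
qed

lemma pairing_partner:
  assumes "P \<in> pairings V" "v \<in> V"
  shows "\<exists>!w. w \<noteq> v \<and> {v, w} \<in> P"
proof -
  obtain e where e: "e \<in> P" "v \<in> e" using assms by (auto simp: pairings_def)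
  then have "card e = 2" using assms by (auto simp: pairings_def)
  then obtain w where w: "e = {v, w}" "w \<noteq> v" using e(2) by (auto simp: card_2_iff)
  moreover have "w' = w" if "w' \<noteq> v" "{v, w'} \<in> P" for w'
  proof -
    have "\<forall>a\<in>P. \<forall>b\<in>P. a \<noteq> b \<longrightarrow> a \<inter> b = {}"
      using assms(1) by (simp add: pairings_def disjoint_def)
    moreover have "{v, w'} \<inter> {v, w} \<noteq> {}" by auto
    ultimately have "{v, w'} = {v, w}" using that(2) e(1) w(1) by metis
    then show ?thesis using that w by (auto simp: doubleton_eq_iff)
  qed
  ultimately show ?thesis using e(1) by blast
qed

text \<open>Every matching is determined by the partner \<open>w\<close> of the fixed element
  \<open>v\<close> and a matching of the remaining elements, which is the recursion that Gaussian
  integration by parts produces.\<close>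

lemma sum_pairings:
  fixes F :: "'a set set \<Rightarrow> real"
  assumes "finite V" "v \<in> V"
  shows "(\<Sum>P\<in>pairings V. F P) = (\<Sum>w\<in>V - {v}. \<Sum>P\<in>pairings (V - {v, w}). F (insert {v, w} P))"
proof -
  define p where "p P = (THE w. w \<noteq> v \<and> {v, w} \<in> P)" for P
  have p: "p P \<noteq> v \<and> {v, p P} \<in> P" if "P \<in> pairings V" for P
    unfolding p_def by (rule theI') (rule pairing_partner[OF that assms(2)])
  have p_eq: "p P = w" if "P \<in> pairings V" "w \<noteq> v" "{v, w} \<in> P" for P w
    using pairing_partner[OF that(1) assms(2)] p[OF that(1)] that by blast
  have notin: "{v, w} \<notin> P" if "P \<in> pairings (V - {v, w})" for w P
    using that by (auto simp: pairings_def)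
  have "(\<Sum>P\<in>pairings V. F P) = (\<Sum>(w, P)\<in>Sigma (V - {v}) (\<lambda>w. pairings (V - {v, w})). F (insert {v, w} P))"
  proof (rule sum.reindex_bij_witness[where i = "\<lambda>(w, P). insert {v, w} P" and j = "\<lambda>P. (p P, P - {{v, p
      P}})"], goal_cases)
    case (2 P)
    then have "p P \<in> V" using p[OF 2] by (auto simp: pairings_def)
    then show ?case using p[OF 2] pairing_remove[OF 2] by auto
  next
    case (3 wP)
    obtain w P where wP: "wP = (w, P)" "w \<in> V - {v}" "P \<in> pairings (V - {v, w})" using 3 by auto
    have "p (insert {v, w} P) = w"
      by (rule p_eq) (use insert_pairing[OF wP(2) assms(2) wP(3)] wP in auto)
    then show ?case using wP notin[OF wP(3)] by simp
  next
    case (4 wP)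
    then obtain w P where wP: "wP = (w, P)" "w \<in> V - {v}" "P \<in> pairings (V - {v, w})" by auto
    show ?case using insert_pairing[OF wP(2) assms(2) wP(3)] wP(1) by simp
  qed (auto dest: p simp: insert_absorb)
  also have "\<dots> = (\<Sum>w\<in>V - {v}. \<Sum>P\<in>pairings (V - {v, w}). F (insert {v, w} P))"
    by (subst sum.Sigma) (auto simp: assms finite_pairings)
  finally show ?thesis .
qed

section \<open>Gaussian words and linear forms\<close>

context
  fixes M :: "'w measure" and A :: "'a set" and \<xi> :: "'a \<Rightarrow> 'w \<Rightarrow> real"
  assumes prob: "prob_space M" and A: "finite A"
    and gaussian: "\<And>b. b \<in> A \<Longrightarrow> distributed M lborel (\<xi> b) std_normal_density"
    and indep: "prob_space.indep_vars M (\<lambda>_. borel) \<xi> A"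
begin

lemma gaussian_power:
  assumes b: "b \<in> A"
  shows "integrable M (\<lambda>\<omega>. \<xi> b \<omega> ^ n)" "(\<integral>\<omega>. \<xi> b \<omega> ^ n \<partial>M) = gauss_moment n"
proof -
  have "integrable lborel (\<lambda>x. std_normal_density x * x ^ n)"
    by (rule integrable_std_normal_moment)
  then show "integrable M (\<lambda>\<omega>. \<xi> b \<omega> ^ n)"
    by (subst distributed_integrable[OF gaussian[OF b], symmetric]) auto
  show "(\<integral>\<omega>. \<xi> b \<omega> ^ n \<partial>M) = gauss_moment n"
    unfolding gauss_moment_def by (subst distributed_integral[OF gaussian[OF b], symmetric]) auto
qed

lemma gaussian_monomial:
  "integrable M (\<lambda>\<omega>. \<Prod>b\<in>A. \<xi> b \<omega> ^ n b)"
  "(\<integral>\<omega>. (\<Prod>b\<in>A. \<xi> b \<omega> ^ n b) \<partial>M) = (\<Prod>b\<in>A. gauss_moment (n b))"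
proof -
  interpret prob_space M by (rule prob)
  have ind: "indep_vars (\<lambda>_. borel) (\<lambda>b \<omega>. \<xi> b \<omega> ^ n b) A"
    by (rule indep_vars_compose2[OF indep, where Y = "\<lambda>b x. x ^ n b"]) auto
  show "integrable M (\<lambda>\<omega>. \<Prod>b\<in>A. \<xi> b \<omega> ^ n b)"
    by (rule indep_vars_integrable[OF A ind]) (rule gaussian_power)
  show "(\<integral>\<omega>. (\<Prod>b\<in>A. \<xi> b \<omega> ^ n b) \<partial>M) = (\<Prod>b\<in>A. gauss_moment (n b))"
    by (subst indep_vars_lebesgue_integral[OF A ind]) (auto simp: gaussian_power)
qed

text \<open>Equal letters are collected because independence speaks about distinct
  variables.\<close>

lemma monomial_as_powers:
  assumes "finite W" "a \<in> W \<rightarrow> A"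
  shows "(\<Prod>v\<in>W. \<xi> (a v) \<omega>) = (\<Prod>b\<in>A. \<xi> b \<omega> ^ card {v \<in> W. a v = b})"
proof -
  have "(\<Prod>v\<in>W. \<xi> (a v) \<omega>) = (\<Prod>b\<in>A. \<Prod>v\<in>{v \<in> W. a v = b}. \<xi> (a v) \<omega>)"
    by (subst prod.group) (use assms A in auto)
  also have "\<dots> = (\<Prod>b\<in>A. \<xi> b \<omega> ^ card {v \<in> W. a v = b})"
    by (intro prod.cong refl) simp
  finally show ?thesis .
qed

lemma gaussian_word:
  assumes "finite W" "a \<in> W \<rightarrow> A"
  shows "integrable M (\<lambda>\<omega>. \<Prod>v\<in>W. \<xi> (a v) \<omega>)"
    "(\<integral>\<omega>. (\<Prod>v\<in>W. \<xi> (a v) \<omega>) \<partial>M) = (\<Prod>b\<in>A. gauss_moment (card {v \<in> W. a v = b}))"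
  unfolding monomial_as_powers[OF assms] by (rule gaussian_monomial)+

text \<open>Independence leaves only the variable \<open>\<xi> v\<close>, for which this is the
  recursion of the moments; its factor \<open>n v\<close> counts the positions \<open>w\<close> with
  \<open>a w = v\<close>, and all of them contribute equally.\<close>

lemma gaussian_integration_by_parts:
  assumes W: "finite W" "a \<in> W \<rightarrow> A" and v: "v \<in> A"
  shows "integrable M (\<lambda>\<omega>. \<xi> v \<omega> * (\<Prod>u\<in>W. \<xi> (a u) \<omega>))"
    "(\<integral>\<omega>. \<xi> v \<omega> * (\<Prod>u\<in>W. \<xi> (a u) \<omega>) \<partial>M) =
      (\<Sum>w\<in>W. if v = a w then \<integral>\<omega>. (\<Prod>u\<in>W - {w}. \<xi> (a u) \<omega>) \<partial>M else 0)"
proof -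
  define n where "n b = card {u \<in> W. a u = b}" for b
  have eq: "\<xi> v \<omega> * (\<Prod>u\<in>W. \<xi> (a u) \<omega>) = (\<Prod>b\<in>A. \<xi> b \<omega> ^ (n(v := Suc (n v))) b)" for \<omega>
  proof -
    have "(\<Prod>b\<in>A. \<xi> b \<omega> ^ (n(v := Suc (n v))) b) = \<xi> v \<omega> ^ Suc (n v) * (\<Prod>b\<in>A - {v}. \<xi> b \<omega> ^ n b)"
      using A v by (subst prod.remove[of _ v]) (auto intro!: prod.cong)
    also have "\<dots> = \<xi> v \<omega> * (\<Prod>b\<in>A. \<xi> b \<omega> ^ n b)"
      using A v by (subst prod.remove[of A v]) (auto intro!: prod.cong)
    finally show ?thesis unfolding n_def using monomial_as_powers[OF W] by simp
  qed
  show "integrable M (\<lambda>\<omega>. \<xi> v \<omega> * (\<Prod>u\<in>W. \<xi> (a u) \<omega>))"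
    unfolding eq by (rule gaussian_monomial)
  let ?R = "\<Prod>b\<in>A - {v}. gauss_moment (n b)"
  have "(\<integral>\<omega>. \<xi> v \<omega> * (\<Prod>u\<in>W. \<xi> (a u) \<omega>) \<partial>M) = gauss_moment (Suc (n v)) * ?R"
    unfolding eq gaussian_monomial using A v by (subst prod.remove[of _ v]) (auto intro!: prod.cong)
  also have "\<dots> = n v * (gauss_moment (n v - 1) * ?R)"
    by (simp add: gauss_moment_rec)
  also have "\<dots> = (\<Sum>w\<in>{w \<in> W. a w = v}. gauss_moment (n v - 1) * ?R)"
    by (simp add: n_def)
  also have "\<dots> = (\<Sum>w\<in>{w \<in> W. a w = v}. \<integral>\<omega>. (\<Prod>u\<in>W - {w}. \<xi> (a u) \<omega>) \<partial>M)"
  proof (rule sum.cong[OF refl])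
    fix w assume w: "w \<in> {w \<in> W. a w = v}"
    have "{u \<in> W - {w}. a u = v} = {u \<in> W. a u = v} - {w}" by auto
    then have 1: "card {u \<in> W - {w}. a u = v} = n v - 1" using w W by (simp add: n_def)
    have 2: "{u \<in> W - {w}. a u = b} = {u \<in> W. a u = b}" if "b \<noteq> v" for b using w that by auto
    have "(\<integral>\<omega>. (\<Prod>u\<in>W - {w}. \<xi> (a u) \<omega>) \<partial>M) = (\<Prod>b\<in>A. gauss_moment (card {u \<in> W - {w}. a u = b}))"
      using W by (intro gaussian_word) auto
    also have "\<dots> = gauss_moment (n v - 1) * ?R"
      unfolding prod.remove[OF A v] 1
      by (rule arg_cong2[where f = "(*)"], rule refl, rule prod.cong[OF refl])
        (subst 2, auto simp: n_def)
    finally show "gauss_moment (n v - 1) * ?R = (\<integral>\<omega>. (\<Prod>u\<in>W - {w}. \<xi> (a u) \<omega>) \<partial>M)" ..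
  qed
  also have "\<dots> = (\<Sum>w\<in>W. if v = a w then \<integral>\<omega>. (\<Prod>u\<in>W - {w}. \<xi> (a u) \<omega>) \<partial>M else 0)"
    using W by (subst sum.inter_filter[symmetric]) (auto intro!: sum.cong)
  finally show "(\<integral>\<omega>. \<xi> v \<omega> * (\<Prod>u\<in>W. \<xi> (a u) \<omega>) \<partial>M) =
      (\<Sum>w\<in>W. if v = a w then \<integral>\<omega>. (\<Prod>u\<in>W - {w}. \<xi> (a u) \<omega>) \<partial>M else 0)" .
qed

lemma linear_forms_expand:
  assumes "finite W"
  shows "(\<Prod>v\<in>W. \<Sum>b\<in>A. c v b * \<xi> b \<omega>) =
    (\<Sum>a\<in>W \<rightarrow>\<^sub>E A. (\<Prod>v\<in>W. c v (a v)) * (\<Prod>v\<in>W. \<xi> (a v) \<omega>))"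
  using assms A by (simp add: prod_sum_PiE prod.distrib)

lemma gaussian_linear_forms:
  assumes "finite W"
  shows "integrable M (\<lambda>\<omega>. \<Prod>v\<in>W. \<Sum>b\<in>A. c v b * \<xi> b \<omega>)"
    "(\<integral>\<omega>. (\<Prod>v\<in>W. \<Sum>b\<in>A. c v b * \<xi> b \<omega>) \<partial>M) =
      (\<Sum>a\<in>W \<rightarrow>\<^sub>E A. (\<Prod>v\<in>W. c v (a v)) * (\<integral>\<omega>. (\<Prod>v\<in>W. \<xi> (a v) \<omega>) \<partial>M))"
proof -
  have int: "integrable M (\<lambda>\<omega>. \<Prod>v\<in>W. \<xi> (a v) \<omega>)" if "a \<in> W \<rightarrow>\<^sub>E A" for a
    using assms that by (intro gaussian_word) (auto simp: PiE_def)
  show "integrable M (\<lambda>\<omega>. \<Prod>v\<in>W. \<Sum>b\<in>A. c v b * \<xi> b \<omega>)"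
    unfolding linear_forms_expand[OF assms]
    by (intro Bochner_Integration.integrable_sum integrable_mult_right int) auto
  show "(\<integral>\<omega>. (\<Prod>v\<in>W. \<Sum>b\<in>A. c v b * \<xi> b \<omega>) \<partial>M) =
      (\<Sum>a\<in>W \<rightarrow>\<^sub>E A. (\<Prod>v\<in>W. c v (a v)) * (\<integral>\<omega>. (\<Prod>v\<in>W. \<xi> (a v) \<omega>) \<partial>M))"
    unfolding linear_forms_expand[OF assms]
    by (subst Bochner_Integration.integral_sum) (auto intro!: integrable_mult_right int)
qed

lemma sum_PiE_insert:
  fixes F :: "('b \<Rightarrow> 'a) \<Rightarrow> real"
  assumes "w \<notin> W"
  shows "(\<Sum>a\<in>insert w W \<rightarrow>\<^sub>E B. F a) = (\<Sum>b\<in>B. \<Sum>a\<in>W \<rightarrow>\<^sub>E B. F (a(w := b)))"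
  unfolding PiE_insert_eq sum.cartesian_product
  by (subst sum.reindex) (use inj_combinator[OF assms, of "\<lambda>_. B"] in \<open>auto simp: comp_def case_prod_beta\<close>)

text \<open>Linear forms are expanded into words, the letter at \<open>v\<close> is contracted with
  the letter at each \<open>w\<close>, and the words are summed up again. The condition that both
  letters agree turns the two coefficient vectors into their scalar product, the covariance of the
  forms.\<close>

lemma gaussian_linear_forms_insert:
  assumes W: "finite W" and v: "v \<notin> W"
  shows "(\<integral>\<omega>. (\<Prod>u\<in>insert v W. \<Sum>b\<in>A. c u b * \<xi> b \<omega>) \<partial>M) =
    (\<Sum>w\<in>W. (\<Sum>b\<in>A. c v b * c w b) * (\<integral>\<omega>. (\<Prod>u\<in>W - {w}. \<Sum>b\<in>A. c u b * \<xi> b \<omega>) \<partial>M))"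
proof -
  let ?E = "\<lambda>W a. \<integral>\<omega>. (\<Prod>u\<in>W. \<xi> (a u) \<omega>) \<partial>M"
  have ins: "(\<integral>\<omega>. (\<Prod>u\<in>insert v W. \<xi> ((a(v := b)) u) \<omega>) \<partial>M) = (\<Sum>w\<in>W. if b = a w then ?E (W - {w}) a else 0)"
    if "a \<in> W \<rightarrow>\<^sub>E A" "b \<in> A" for a b
  proof -
    have "(\<Prod>u\<in>insert v W. \<xi> ((a(v := b)) u) \<omega>) = \<xi> b \<omega> * (\<Prod>u\<in>W. \<xi> (a u) \<omega>)" for \<omega>
      using W v by (subst prod.insert) (auto intro!: prod.cong)
    then show ?thesis using gaussian_integration_by_parts(2)[of W a b] that W by (simp add: PiE_def)
  qed
  have cprod: "(\<Prod>u\<in>insert v W. c u ((a(v := b)) u)) = c v b * (\<Prod>u\<in>W. c u (a u))" for a b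
    using W v by (subst prod.insert) (auto intro!: prod.cong)
  have "(\<integral>\<omega>. (\<Prod>u\<in>insert v W. \<Sum>b\<in>A. c u b * \<xi> b \<omega>) \<partial>M) =
     (\<Sum>b\<in>A. \<Sum>a\<in>W \<rightarrow>\<^sub>E A. c v b * (\<Prod>u\<in>W. c u (a u)) * (\<Sum>w\<in>W. if b = a w then ?E (W - {w}) a else 0))"
    unfolding gaussian_linear_forms(2)[OF finite.insertI[OF W]] sum_PiE_insert[OF v] cprod
    by (intro sum.cong refl) (subst ins, simp_all)
  \<comment> \<open>The sum over the letter \<open>b\<close> at \<open>v\<close> is moved inside,
    where only \<open>b = a w\<close> survives.\<close>
  also have "\<dots> = (\<Sum>a\<in>W \<rightarrow>\<^sub>E A. \<Sum>w\<in>W. \<Sum>b\<in>A. if b = a w then c v b * (\<Prod>u\<in>W. c u (a u)) * ?E (W - {w}) a else 0)"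
    by (subst sum.swap) (simp add: sum_distrib_left if_distrib sum.swap[of _ W A] cong: if_cong)
  also have "\<dots> = (\<Sum>a\<in>W \<rightarrow>\<^sub>E A. \<Sum>w\<in>W. c v (a w) * (\<Prod>u\<in>W. c u (a u)) * ?E (W - {w}) a)"
    using A by (intro sum.cong refl) (auto simp: sum.delta)
  also have "\<dots> = (\<Sum>w\<in>W. \<Sum>a\<in>W \<rightarrow>\<^sub>E A. c v (a w) * (\<Prod>u\<in>W. c u (a u)) * ?E (W - {w}) a)"
    by (rule sum.swap)
  also have "\<dots> = (\<Sum>w\<in>W. (\<Sum>b\<in>A. c v b * c w b) * (\<integral>\<omega>. (\<Prod>u\<in>W - {w}. \<Sum>b\<in>A. c u b * \<xi> b \<omega>) \<partial>M))"
  proof (rule sum.cong[OF refl])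
    fix w assume w: "w \<in> W"
    have Ww: "W = insert w (W - {w})" using w by auto
    have 1: "(\<Prod>u\<in>insert w (W - {w}). c u ((a(w := b)) u)) = c w b * (\<Prod>u\<in>W - {w}. c u (a u))" for a b
      using W by (subst prod.insert) (auto intro!: prod.cong)
    \<comment> \<open>The remaining product does not contain the position \<open>w\<close>, so the
      letter there can be summed separately.\<close>
    have 2: "?E (W - {w}) (a(w := b)) = ?E (W - {w}) a" for a b
      by (intro Bochner_Integration.integral_cong refl prod.cong) auto
    have "(\<Sum>a\<in>W \<rightarrow>\<^sub>E A. c v (a w) * (\<Prod>u\<in>W. c u (a u)) * ?E (W - {w}) a) =
      (\<Sum>a\<in>insert w (W - {w}) \<rightarrow>\<^sub>E A. c v (a w) * (\<Prod>u\<in>insert w (W - {w}). c u (a u)) * ?E (W - {w}) a)"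
      using Ww by simp
    also have "\<dots> = (\<Sum>b\<in>A. \<Sum>a\<in>(W - {w}) \<rightarrow>\<^sub>E A. c v b * (c w b * (\<Prod>u\<in>W - {w}. c u (a u))) * ?E (W - {w}) a)"
      by (subst sum_PiE_insert) (simp_all only: 1 2 fun_upd_same Diff_iff singletonI, simp_all)
    also have "\<dots> = (\<Sum>b\<in>A. c v b * c w b) * (\<integral>\<omega>. (\<Prod>u\<in>W - {w}. \<Sum>b\<in>A. c u b * \<xi> b \<omega>) \<partial>M)"
      using W by (subst gaussian_linear_forms, simp, subst sum.swap) (simp add: sum_distrib_left
          sum_distrib_right mult_ac)
    finally show "(\<Sum>a\<in>W \<rightarrow>\<^sub>E A. c v (a w) * (\<Prod>u\<in>W. c u (a u)) * ?E (W - {w}) a) =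
      (\<Sum>b\<in>A. c v b * c w b) * (\<integral>\<omega>. (\<Prod>u\<in>W - {w}. \<Sum>b\<in>A. c u b * \<xi> b \<omega>) \<partial>M)" .
  qed
  finally show ?thesis .
qed

text \<open>Contracting one element with every other one is the recursion of the matchings by the
  partner of this element. Odd sets are covered as well: they lead to a single element with no
  possible partner, where both sides vanish.\<close>

lemma isserlis:
  assumes "finite V"
  shows "(\<integral>\<omega>. (\<Prod>v\<in>V. \<Sum>b\<in>A. c v b * \<xi> b \<omega>) \<partial>M) =
    (\<Sum>P\<in>pairings V. \<Prod>e\<in>P. \<Sum>b\<in>A. \<Prod>v\<in>e. c v b)"
  using assms
\<comment> \<open>Each contraction removes two elements at once.\<close>
proof (induction "card V" arbitrary: V rule: less_induct)
  case less
  show ?case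
  proof (cases "V = {}")
    case True
    interpret prob_space M by (rule prob)
    show ?thesis using True by (simp add: pairings_empty prob_space)
  next
    case False
    then obtain v where v: "v \<in> V" by blast
    have eq: "V = insert v (V - {v})" using v by auto
    have "(\<integral>\<omega>. (\<Prod>v\<in>V. \<Sum>b\<in>A. c v b * \<xi> b \<omega>) \<partial>M) =
       (\<Sum>w\<in>V - {v}. (\<Sum>b\<in>A. c v b * c w b) * (\<integral>\<omega>. (\<Prod>u\<in>V - {v} - {w}. \<Sum>b\<in>A. c u b * \<xi> b \<omega>) \<partial>M))"
      using gaussian_linear_forms_insert[of "V - {v}" v c] less.prems eq by simp
    also have "\<dots> = (\<Sum>w\<in>V - {v}. \<Sum>P\<in>pairings (V - {v, w}). \<Prod>e\<in>insert {v, w} P. \<Sum>b\<in>A. \<Prod>v\<in>e. c v b)"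
    proof (rule sum.cong[OF refl])
      fix w assume w: "w \<in> V - {v}"
      have Vw: "V - {v} - {w} = V - {v, w}" by auto
      have "card (V - {v, w}) < card V" using less.prems v by (intro psubset_card_mono) auto
      note IH = less.hyps[OF this] 
      have "(\<Prod>e\<in>insert {v, w} P. \<Sum>b\<in>A. \<Prod>v\<in>e. c v b) = (\<Sum>b\<in>A. c v b * c w b) * (\<Prod>e\<in>P. \<Sum>b\<in>A. \<Prod>v\<in>e. c v b)"
        if "P \<in> pairings (V - {v, w})" for P
      proof -
        have "finite P" using finite_pairing[OF _ that] less.prems by simp
        moreover have "{v, w} \<notin> P" using that by (auto simp: pairings_def)
        ultimately show ?thesis using w by (subst prod.insert) auto
      qed
      then show "(\<Sum>b\<in>A. c v b * c w b) * (\<integral>\<omega>. (\<Prod>u\<in>V - {v} - {w}. \<Sum>b\<in>A. c u b * \<xi> b \<omega>) \<partial>M) =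
          (\<Sum>P\<in>pairings (V - {v, w}). \<Prod>e\<in>insert {v, w} P. \<Sum>b\<in>A. \<Prod>v\<in>e. c v b)"
        using less.prems by (simp add: Vw IH sum_distrib_left)
    qed
    also have "\<dots> = (\<Sum>P\<in>pairings V. \<Prod>e\<in>P. \<Sum>b\<in>A. \<Prod>v\<in>e. c v b)"
      by (rule sum_pairings[symmetric]) (use less.prems v in auto)
    finally show ?thesis .
  qed
qed

end

section \<open>Derivatives along vector fields\<close>

text \<open>Derivative formulas hold on \<open>S\<close> only, whereas \<open>C_k_on\<close> speaks
  about functions on the whole space. The closure rules replace a derivative by its formula through
  this lemma, and openness of \<open>S\<close> makes the derivatives agree.\<close>

lemma C_k_on_cong:
  assumes "open S" "\<And>x. x \<in> S \<Longrightarrow> g x = g' x" "C_k_on k S g"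
  shows "C_k_on k S g'"
  using assms(2,3)
proof (induction k arbitrary: g g')
  case 0
  then show ?case by (simp cong: continuous_on_cong)
next
  case (Suc k)
  have fd: "frechet_derivative g (at x) = frechet_derivative g' (at x)" and "g' differentiable (at x)" if
      "x \<in> S" for x
  proof -
    have d: "g differentiable (at x)" using Suc.prems(2) that by simp
    then show "frechet_derivative g (at x) = frechet_derivative g' (at x)"
      by (rule frechet_derivative_transform_within_open[OF _ assms(1) that]) (rule Suc.prems(1))
    from d obtain D where "(g has_derivative D) (at x)" by (auto simp: differentiable_def)
    then have "(g' has_derivative D) (at x)"
      by (rule has_derivative_transform_within_open[OF _ assms(1) that]) (rule Suc.prems(1))
    then show "g' differentiable (at x)" by (auto simp: differentiable_def)
  qed
  moreover have "C_k_on k S (\<lambda>x. frechet_derivative g' (at x) v)" for v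
    by (rule Suc.IH[of "\<lambda>x. frechet_derivative g (at x) v"]) (use Suc.prems(2) fd in auto)
  ultimately show ?case by simp
qed

lemma C_k_on_SucD: "C_k_on (Suc k) S g \<Longrightarrow> C_k_on k S g"
proof (induction k arbitrary: g)
  case 0
  then show ?case
    by (auto intro!: differentiable_imp_continuous_on differentiable_at_imp_differentiable_on)
qed auto

lemma C_k_on_const: "C_k_on k S (\<lambda>x. c)"
proof (induction k arbitrary: c)
  case (Suc k)
  have "frechet_derivative (\<lambda>x. c) (at x) = (\<lambda>v. 0)" for x :: 'a
    using frechet_derivative_at[OF has_derivative_const, of c x] by simp
  then show ?case using Suc[of 0] by simp
qed simp

lemma C_k_on_bounded_linear:
  assumes "open S" "bounded_linear L" "C_k_on k S g" shows "C_k_on k S (\<lambda>x. L (g x))"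
  using assms(3)
proof (induction k arbitrary: g)
  case 0
  then show ?case using assms(2) by (simp add: bounded_linear.continuous_on)
next
  case (Suc k)
  have fd: "((\<lambda>x. L (g x)) has_derivative (\<lambda>v. L (frechet_derivative g (at x) v))) (at x)" if "x \<in> S" for x
    using Suc.prems that by (intro bounded_linear.has_derivative[OF assms(2)])
      (simp flip: frechet_derivative_works)
  have "C_k_on k S (\<lambda>x. frechet_derivative (\<lambda>x. L (g x)) (at x) v)" for v
    by (rule C_k_on_cong[OF assms(1) _ Suc.IH[of "\<lambda>x. frechet_derivative g (at x) v"]])
      (use Suc.prems frechet_derivative_at[OF fd] in \<open>auto simp: fun_eq_iff\<close>)
  then show ?case using fd by (auto simp: differentiable_def)
qed

lemma C_k_on_add:
  assumes "open S" "C_k_on k S g" "C_k_on k S g'" shows "C_k_on k S (\<lambda>x. g x + g' x)"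
  using assms(2,3)
proof (induction k arbitrary: g g')
  case 0
  then show ?case by (simp add: continuous_on_add)
next
  case (Suc k)
  have fd: "((\<lambda>x. g x + g' x) has_derivative
      (\<lambda>v. frechet_derivative g (at x) v + frechet_derivative g' (at x) v)) (at x)" if "x \<in> S" for x
    using Suc.prems that by (intro has_derivative_add) (simp_all flip: frechet_derivative_works)
  have "C_k_on k S (\<lambda>x. frechet_derivative (\<lambda>x. g x + g' x) (at x) v)" for v
    by (rule C_k_on_cong[OF assms(1) _ Suc.IH[of "\<lambda>x. frechet_derivative g (at x) v" "\<lambda>x.
        frechet_derivative g' (at x) v"]])
      (use Suc.prems frechet_derivative_at[OF fd] in \<open>auto simp: fun_eq_iff\<close>)
  then show ?case using fd by (auto simp: differentiable_def)
qed

lemma C_k_on_sum: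
  assumes "open S" "\<And>i. i \<in> I \<Longrightarrow> C_k_on k S (g i)" shows "C_k_on k S (\<lambda>x. \<Sum>i\<in>I. g i x)"
  using assms(2) by (induction I rule: infinite_finite_induct) (auto intro: C_k_on_const C_k_on_add[OF
      assms(1)])

lemma C_k_on_mult:
  fixes g g' :: "'a::real_normed_vector \<Rightarrow> real"
  assumes "open S" "C_k_on k S g" "C_k_on k S g'" shows "C_k_on k S (\<lambda>x. g x * g' x)"
  using assms(2,3)
proof (induction k arbitrary: g g')
  case 0
  then show ?case by (simp add: continuous_on_mult)
next
  case (Suc k)
  have fd: "((\<lambda>x. g x * g' x) has_derivative
      (\<lambda>v. g x * frechet_derivative g' (at x) v + frechet_derivative g (at x) v * g' x)) (at x)" if "x \<in>
          S" for x
    using Suc.prems that by (intro has_derivative_mult) (simp_all flip: frechet_derivative_works)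
  \<comment> \<open>The product rule keeps one undifferentiated factor in each term, which
    \<open>C_k_on_SucD\<close> lowers from \<open>Suc k\<close> to \<open>k\<close>.\<close>
  have "C_k_on k S (\<lambda>x. g x * frechet_derivative g' (at x) v + frechet_derivative g (at x) v * g' x)" for v
    using Suc.prems by (intro C_k_on_add[OF assms(1)] Suc.IH) (auto intro: C_k_on_SucD)
  then have "C_k_on k S (\<lambda>x. frechet_derivative (\<lambda>x. g x * g' x) (at x) v)" for v
    by (rule C_k_on_cong[OF assms(1), rotated])
      (use frechet_derivative_at[OF fd] in \<open>auto simp: fun_eq_iff\<close>)
  then show ?case using fd by (auto simp: differentiable_def)
qed

text \<open>\<open>C_k_on\<close> controls derivatives in constant directions only. The varying
  direction is expanded in a basis, and the derivative becomes a sum of products.\<close>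

lemma C_k_on_directional_derivative:
  fixes g :: "'e::euclidean_space \<Rightarrow> real"
  assumes S: "open S" and g: "C_k_on (Suc k) S g" and V: "C_k_on k S V"
  shows "C_k_on k S (\<lambda>x. frechet_derivative g (at x) (V x))"
proof (rule C_k_on_cong[OF S])
  show "C_k_on k S (\<lambda>x. \<Sum>b\<in>Basis. (V x \<bullet> b) * frechet_derivative g (at x) b)"
    using g by (intro C_k_on_sum[OF S] C_k_on_mult[OF S] C_k_on_bounded_linear[OF S _ V]
        bounded_linear_inner_left) auto
next
  fix x assume "x \<in> S"
  then have "linear (frechet_derivative g (at x))"
    using g by (intro linear_frechet_derivative) simp
  then show "(\<Sum>b\<in>Basis. (V x \<bullet> b) * frechet_derivative g (at x) b) = frechet_derivative g (at x) (V x)"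
    by (subst (2) euclidean_representation[of "V x", symmetric])
      (simp add: linear_sum linear_cmul)
qed

lemma smooth_on_differentiable: "smooth_on S g \<Longrightarrow> x \<in> S \<Longrightarrow> g differentiable (at x)"
  unfolding smooth_on_def using C_k_on.simps(2)[of 0] by blast

lemma smooth_on_continuous: "smooth_on S g \<Longrightarrow> continuous_on S g"
  unfolding smooth_on_def using C_k_on.simps(1) by blast

section \<open>Derivatives along vector fields in charts\<close>

context
  fixes \<A> :: "('m::{t2_space,second_countable_topology}, 'e::euclidean_space) chart set"
  assumes atlas: "smooth_atlas \<A>"
begin

lemma chart_exists: "\<exists>c. c \<in> \<A> \<and> q \<in> fst c"
proof -
  have "q \<in> (\<Union>c\<in>\<A>. fst c)" using atlas by (simp add: smooth_atlas_def)
  then show ?thesis by blast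
qed

lemma chart_homeo:
  assumes "c \<in> \<A>"
  shows "open (fst c)" "open (snd c ` fst c)" "homeomorphism (fst c) (snd c ` fst c) (snd c) (chart_inv c)"
  using atlas assms by (auto simp: smooth_atlas_def)

lemma chart_inv_eq: "c \<in> \<A> \<Longrightarrow> q \<in> fst c \<Longrightarrow> chart_inv c (snd c q) = q"
  using chart_homeo(3) by (auto simp: homeomorphism_def)

lemma chart_open_image:
  assumes "c \<in> \<A>" "open U" shows "open (snd c ` (fst c \<inter> U))"
proof -
  note h = chart_homeo[OF assms(1)]
  have "openin (top_of_set (snd c ` fst c)) (snd c ` (fst c \<inter> U))"
    using assms(2) by (intro homeomorphism_imp_open_map[OF h(3)]) auto
  then show ?thesis using h(2) by (auto simp: openin_open_eq)
qed

text \<open>Chain rule for the change of charts, whose derivative carries the coordinates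
  \<open>v c q\<close> to \<open>v c' q\<close>. It makes the arbitrary choice of a chart in
  \<open>dir_deriv\<close> immaterial.\<close>

lemma frechet_chart_change:
  assumes c: "c \<in> \<A>" "q \<in> fst c" and c': "c' \<in> \<A>" "q \<in> fst c'"
    and v: "smooth_vector_field \<A> v" and \<phi>: "smooth_function \<A> \<phi>"
  shows "frechet_derivative (\<phi> \<circ> chart_inv c) (at (snd c q)) (v c q) =
    frechet_derivative (\<phi> \<circ> chart_inv c') (at (snd c' q)) (v c' q)"
proof -
  let ?x = "snd c q" and ?\<tau> = "snd c' \<circ> chart_inv c"
  let ?O = "snd c ` (fst c \<inter> fst c')"
  have O: "open ?O" "?x \<in> ?O"
    using chart_open_image[OF c(1) chart_homeo(1)[OF c'(1)]] c(2) c'(2) by auto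
  have \<tau>: "?\<tau> differentiable (at ?x)"
    using atlas c(1) c'(1) O(2) unfolding smooth_atlas_def by (intro smooth_on_differentiable[of ?O]) simp_all
  have \<tau>x: "?\<tau> ?x = snd c' q" using c by (simp add: chart_inv_eq)
  have \<phi>': "(\<phi> \<circ> chart_inv c') differentiable (at (?\<tau> ?x))"
    using \<phi> c' by (auto simp: \<tau>x smooth_function_def simp del: comp_apply intro!: smooth_on_differentiable)
  have \<phi>c: "(\<phi> \<circ> chart_inv c) differentiable (at ?x)"
    using \<phi> c by (auto simp: smooth_function_def intro!: smooth_on_differentiable)
  have "frechet_derivative (\<phi> \<circ> chart_inv c) (at ?x) = frechet_derivative ((\<phi> \<circ> chart_inv c') \<circ> ?\<tau>) (at ?x)"
    by (rule frechet_derivative_transform_within_open[OF \<phi>c O]) (use c c' in \<open>auto simp: chart_inv_eq\<close>)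
  also have "\<dots> = frechet_derivative (\<phi> \<circ> chart_inv c') (at (snd c' q)) \<circ> frechet_derivative ?\<tau> (at ?x)"
    by (subst frechet_derivative_compose[OF \<tau> \<phi>']) (simp add: \<tau>x c chart_inv_eq)
  finally have "frechet_derivative (\<phi> \<circ> chart_inv c) (at ?x) (v c q) =
     frechet_derivative (\<phi> \<circ> chart_inv c') (at (snd c' q)) (frechet_derivative ?\<tau> (at ?x) (v c q))"
    by simp
  moreover have "frechet_derivative ?\<tau> (at ?x) (v c q) = v c' q"
    using conjunct2[OF v[unfolded smooth_vector_field_def]] c c' by (metis IntI)
  ultimately show ?thesis by simp
qed

text \<open>The chart chosen by \<open>dir_deriv\<close> depends on the point alone, so one chart
  serves all vector fields and all functions there. Linear combinations and derivatives along curves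
  can then be computed in it.\<close>

lemma dir_deriv_chart_some:
  "\<exists>c. c \<in> \<A> \<and> q \<in> fst c \<and>
    (\<forall>v \<phi>. dir_deriv \<A> v \<phi> q = frechet_derivative (\<phi> \<circ> chart_inv c) (at (snd c q)) (v c q))"
  using someI_ex[OF chart_exists[of q]] unfolding dir_deriv_def Let_def by blast

lemma dir_deriv_chart:
  assumes "c \<in> \<A>" "q \<in> fst c" "smooth_vector_field \<A> v" "smooth_function \<A> \<phi>"
  shows "dir_deriv \<A> v \<phi> q = frechet_derivative (\<phi> \<circ> chart_inv c) (at (snd c q)) (v c q)"
proof -
  obtain c' where "c' \<in> \<A> \<and> q \<in> fst c' \<and>
    (\<forall>v \<phi>. dir_deriv \<A> v \<phi> q = frechet_derivative (\<phi> \<circ> chart_inv c') (at (snd c' q)) (v c' q))"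
    using dir_deriv_chart_some[of q] by (rule exE)
  then show ?thesis using frechet_chart_change[of c q c' v \<phi>] assms by simp
qed

text \<open>The definition of \<open>dir_deriv\<close> may choose another chart at every point. By
  independence of the chart it equals, on a whole chart domain, one directional derivative in
  coordinates, and this is smooth.\<close>

lemma smooth_dir_deriv:
  assumes v: "smooth_vector_field \<A> v" and \<phi>: "smooth_function \<A> \<phi>"
  shows "smooth_function \<A> (dir_deriv \<A> v \<phi>)"
  unfolding smooth_function_def smooth_on_def
proof (intro ballI allI)
  fix c k assume c: "c \<in> \<A>"
  note O = chart_homeo(2)[OF c]
  show "C_k_on k (snd c ` fst c) (dir_deriv \<A> v \<phi> \<circ> chart_inv c)"
  proof (rule C_k_on_cong[OF O])
    have "C_k_on (Suc k) (snd c ` fst c) (\<phi> \<circ> chart_inv c)"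
      using \<phi> c by (simp add: smooth_function_def smooth_on_def del: C_k_on.simps)
    moreover have "C_k_on k (snd c ` fst c) (v c \<circ> chart_inv c)"
      using conjunct1[OF v[unfolded smooth_vector_field_def smooth_on_def]] c by blast
    ultimately show "C_k_on k (snd c ` fst c) (\<lambda>x. frechet_derivative (\<phi> \<circ> chart_inv c) (at x) ((v c \<circ>
        chart_inv c) x))"
      by (rule C_k_on_directional_derivative[OF O])
  qed (use c in \<open>auto simp: chart_inv_eq dir_deriv_chart[OF c _ v \<phi>]\<close>)
qed

lemma curve_derivative:
  assumes y: "integral_curve \<A> v y" and t: "t \<in> {0..1}" and \<phi>: "smooth_function \<A> \<phi>"
  shows "((\<phi> \<circ> y) has_vector_derivative dir_deriv \<A> v \<phi> (y t)) (at t within {0..1})"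
proof -
  obtain c where "c \<in> \<A> \<and> y t \<in> fst c \<and>
      (\<forall>v \<phi>. dir_deriv \<A> v \<phi> (y t) = frechet_derivative (\<phi> \<circ> chart_inv c) (at (snd c (y t))) (v c (y t)))"
    using dir_deriv_chart_some[of "y t"] by (rule exE)
  then have c: "c \<in> \<A>" "y t \<in> fst c"
    and d: "\<And>v \<phi>. dir_deriv \<A> v \<phi> (y t) = frechet_derivative (\<phi> \<circ> chart_inv c) (at (snd c (y t))) (v c (y t))"
    by simp_all
  let ?D = "frechet_derivative (\<phi> \<circ> chart_inv c) (at (snd c (y t)))"
  have diff: "(\<phi> \<circ> chart_inv c) differentiable (at (snd c (y t)))"
    using \<phi> c by (auto simp: smooth_function_def intro!: smooth_on_differentiable)
  have x: "((snd c \<circ> y) has_derivative (\<lambda>h. h *\<^sub>R v c (y t))) (at t within {0..1})"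
    using y t c by (simp add: integral_curve_def has_vector_derivative_def)
  have "((\<phi> \<circ> chart_inv c) has_derivative ?D) (at ((snd c \<circ> y) t))"
    using diff by (simp add: frechet_derivative_works)
  from diff_chain_within[OF x has_derivative_at_withinI[OF this]]
  have "((\<phi> \<circ> chart_inv c) \<circ> (snd c \<circ> y) has_derivative ?D \<circ> (\<lambda>h. h *\<^sub>R v c (y t))) (at t within {0..1})" .
  moreover have "?D \<circ> (\<lambda>h. h *\<^sub>R v c (y t)) = (\<lambda>h. h *\<^sub>R dir_deriv \<A> v \<phi> (y t))"
    using linear_frechet_derivative[OF diff] by (auto simp: d linear_cmul)
  ultimately have "((\<phi> \<circ> chart_inv c) \<circ> (snd c \<circ> y) has_derivative (\<lambda>h. h *\<^sub>R dir_deriv \<A> v \<phi> (y t))) (at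
      t within {0..1})"
    by simp
  then show ?thesis unfolding has_vector_derivative_def
  proof (rule has_derivative_transform_eventually)
    \<comment> \<open>The passage through coordinates is the identity only inside the chart, where
      continuity keeps the curve near \<open>t\<close>.\<close>
    have "(y \<longlongrightarrow> y t) (at t within {0..1})"
      using y t unfolding integral_curve_def continuous_on_def by blast
    then have "\<forall>\<^sub>F s in at t within {0..1}. y s \<in> fst c"
      using c(2) chart_homeo(1)[OF c(1)] by (auto dest: topological_tendstoD)
    then show "\<forall>\<^sub>F s in at t within {0..1}. (\<phi> \<circ> chart_inv c \<circ> (snd c \<circ> y)) s = (\<phi> \<circ> y) s"
      by eventually_elim (simp add: chart_inv_eq[OF c(1)])
  qed (use c t in \<open>auto simp: chart_inv_eq\<close>)
qed

lemma dir_deriv_lincomb: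
  assumes "smooth_function \<A> \<phi>"
  shows "dir_deriv \<A> (\<lambda>c x. \<Sum>d=1..D. \<alpha> d *\<^sub>R E d c x) \<phi> q = (\<Sum>d=1..D. \<alpha> d * dir_deriv \<A> (E d) \<phi> q)"
proof -
  obtain c where "c \<in> \<A> \<and> q \<in> fst c \<and>
      (\<forall>v \<phi>. dir_deriv \<A> v \<phi> q = frechet_derivative (\<phi> \<circ> chart_inv c) (at (snd c q)) (v c q))"
    using dir_deriv_chart_some[of "q"] by (rule exE)
  then have c: "c \<in> \<A>" "q \<in> fst c"
    and d: "\<And>v \<phi>. dir_deriv \<A> v \<phi> q = frechet_derivative (\<phi> \<circ> chart_inv c) (at (snd c q)) (v c q)"
    by simp_all
  have "linear (frechet_derivative (\<phi> \<circ> chart_inv c) (at (snd c q)))"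
    using assms c by (auto simp: smooth_function_def intro!: linear_frechet_derivative smooth_on_differentiable)
  then show ?thesis by (simp add: d linear_sum linear_cmul)
qed

end

section \<open>Taylor expansion of products of exponentials\<close>

definition words :: "nat \<Rightarrow> nat \<Rightarrow> nat list set" where
  "words D n = {w. length w = n \<and> set w \<subseteq> {1..D}}"

definition words_upto :: "nat \<Rightarrow> nat \<Rightarrow> nat list set" where
  "words_upto D N = {w. length w \<le> N \<and> set w \<subseteq> {1..D}}"

lemma finite_words [simp]: "finite (words D n)"
  using finite_lists_length_eq[of "{1..D}" n] by (simp add: words_def conj_commute)

lemma finite_words_upto [simp]: "finite (words_upto D N)"
  using finite_lists_length_le[of "{1..D}" N] by (simp add: words_upto_def conj_commute)

lemma card_words: "card (words D n) = D ^ n"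
  using card_lists_length_eq[of "{1..D}" n] by (simp add: words_def conj_commute)

lemma words_0: "words D 0 = {[]}"
  by (auto simp: words_def)

lemma sum_words_Suc: "(\<Sum>w\<in>words D (Suc n). F w) = (\<Sum>d=1..D. \<Sum>w\<in>words D n. F (d # w))"
  unfolding sum.cartesian_product
  by (rule sum.reindex_bij_witness[where i = "\<lambda>(d, w). d # w" and j = "\<lambda>w. (hd w, tl w)"])
    (auto simp: words_def length_Suc_conv)

lemma sum_words_upto: "(\<Sum>w\<in>words_upto D N. F w) = (\<Sum>n\<le>N. \<Sum>w\<in>words D n. F w)"
proof -
  have "words_upto D N = (\<Union>n\<le>N. words D n)" by (auto simp: words_def words_upto_def)
  then show ?thesis by (simp only:) (rule sum.UNION_disjoint, simp, simp, auto simp: words_def)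
qed

text \<open>A word with a marked cut is a pair of words whose lengths add up to at most
  \<open>N\<close>. The right part stems from the last exponential, which is peeled off first; the
  left part gets the order that remains.\<close>

lemma sum_words_upto_splits:
  "(\<Sum>w\<in>words_upto D N. \<Sum>j\<le>length w. F (take j w) (drop j w)) =
   (\<Sum>w2\<in>words_upto D N. \<Sum>w1\<in>words_upto D (N - length w2). F w1 w2)"
proof -
  have "(\<Sum>w\<in>words_upto D N. \<Sum>j\<le>length w. F (take j w) (drop j w)) =
    (\<Sum>(w, j)\<in>Sigma (words_upto D N) (\<lambda>w. {..length w}). F (take j w) (drop j w))"
    by (subst sum.Sigma) auto
  also have "\<dots> = (\<Sum>(w2, w1)\<in>Sigma (words_upto D N) (\<lambda>w2. words_upto D (N - length w2)). F w1 w2)"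
    by (rule sum.reindex_bij_witness[where j = "\<lambda>(w, j). (drop j w, take j w)" and i = "\<lambda>(w2, w1). (w1 @
        w2, length w1)"])
      (auto simp: words_upto_def subset_iff dest: in_set_takeD in_set_dropD)
  also have "\<dots> = (\<Sum>w2\<in>words_upto D N. \<Sum>w1\<in>words_upto D (N - length w2). F w1 w2)"
    by (subst sum.Sigma) auto
  finally show ?thesis .
qed

lemma word_deriv_append: "word_deriv \<A> E (w @ w') g = word_deriv \<A> E w (word_deriv \<A> E w' g)"
  by (simp add: word_deriv_def)

lemma word_deriv_Nil [simp]: "word_deriv \<A> E [] g = g"
  by (simp add: word_deriv_def)

lemma word_deriv_Cons: "word_deriv \<A> E (d # w) g = dir_deriv \<A> (E d) (word_deriv \<A> E w g)"
  by (simp add: word_deriv_def)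

text \<open>The whole trajectories are required to lie in \<open>S\<close>, since the Taylor
  remainder involves derivatives at all intermediate times and not only at the points
  \<open>u k\<close>.\<close>

definition exp_product_in where
  "exp_product_in \<A> D E S K \<alpha> p q \<longleftrightarrow> (\<exists>u. u 0 = p \<and> u K = q \<and> (\<forall>k\<in>{1..K}. \<exists>y.
     integral_curve \<A> (\<lambda>c x. \<Sum>d=1..D. \<alpha> k d *\<^sub>R E d c x) y \<and> y 0 = u (k - 1) \<and> y 1 = u k \<and> y ` {0..1} \<subseteq> S))"

text \<open>The recursion mirrors the proof of the Taylor bound: the remainder of the last flow,
  plus the remainders of expanding each derivative along a word of length \<open>n\<close> through
  the first \<open>K\<close> flows; there are \<open>D ^ n\<close> such words.\<close>

primrec taylor_const :: "real \<Rightarrow> nat \<Rightarrow> nat \<Rightarrow> nat \<Rightarrow> real" where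
  "taylor_const B D 0 N = 0"
| "taylor_const B D (Suc K) N = B * real D ^ Suc N + (\<Sum>n\<le>N. real D ^ n * taylor_const B D K (N - n))"

lemma abs_prod_list_le:
  fixes \<alpha> :: "nat \<Rightarrow> real"
  assumes "set w \<subseteq> {1..D}" "\<And>d. d \<in> {1..D} \<Longrightarrow> \<bar>\<alpha> d\<bar> \<le> a"
  shows "\<bar>prod_list (map \<alpha> w)\<bar> \<le> a ^ length w"
  using assms(1)
proof (induction w)
  case (Cons d w)
  then have "\<bar>\<alpha> d\<bar> \<le> a" "\<bar>prod_list (map \<alpha> w)\<bar> \<le> a ^ length w" using assms(2) by auto
  then show ?case by (auto simp: abs_mult intro!: mult_mono order_trans[OF abs_ge_zero])
qed simp

context
  fixes \<A> :: "('m::{t2_space,second_countable_topology}, 'e::euclidean_space) chart set"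
    and D :: nat and E :: "nat \<Rightarrow> ('m, 'e) vfield"
  assumes atlas: "smooth_atlas \<A>"
    and fields: "\<And>d. d \<in> {1..D} \<Longrightarrow> smooth_vector_field \<A> (E d)"
begin

lemma smooth_word_deriv:
  "set w \<subseteq> {1..D} \<Longrightarrow> smooth_function \<A> g \<Longrightarrow> smooth_function \<A> (word_deriv \<A> E w g)"
  by (induction w) (auto simp: word_deriv_Cons intro!: smooth_dir_deriv[OF atlas] fields)

text \<open>Differentiation in time along the curve is the combination of the fields with
  coefficients \<open>\<alpha> d\<close>. Hence the derivatives of \<open>g (y t)\<close> are sums
  over words weighted by products of the \<open>\<alpha> d\<close>, and the one-variable Taylor
  formula applies.\<close>

lemma flow_taylor:
  fixes \<alpha> :: "nat \<Rightarrow> real"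
  assumes y: "integral_curve \<A> (\<lambda>c x. \<Sum>d=1..D. \<alpha> d *\<^sub>R E d c x) y" and yS: "y ` {0..1} \<subseteq> S"
    and \<alpha>: "\<And>d. d \<in> {1..D} \<Longrightarrow> \<bar>\<alpha> d\<bar> \<le> a"
    and g: "smooth_function \<A> g"
    and B: "\<And>w q. w \<in> words D (Suc N) \<Longrightarrow> q \<in> S \<Longrightarrow> \<bar>word_deriv \<A> E w g q\<bar> \<le> B" and B0: "B \<ge> 0" and a0: "a \<ge> 0"
  shows "\<bar>g (y 1) - (\<Sum>w\<in>words_upto D N. prod_list (map \<alpha> w) / fact (length w) * word_deriv \<A> E w g (y 0))\<bar>
     \<le> B * real D ^ Suc N * a ^ Suc N"
proof -
  define W where "W n q = (\<Sum>w\<in>words D n. prod_list (map \<alpha> w) * word_deriv \<A> E w g q)" for n q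
  have deriv: "((\<lambda>t. W n (y t)) has_field_derivative W (Suc n) (y t)) (at t within {0..1})" if t: "t \<in>
      {0..1}" for n t
  proof -
    have "((\<lambda>t. word_deriv \<A> E w g (y t)) has_field_derivative
        (\<Sum>d=1..D. \<alpha> d * word_deriv \<A> E (d # w) g (y t))) (at t within {0..1})" if w: "w \<in> words D n" for w
    proof -
      have s: "smooth_function \<A> (word_deriv \<A> E w g)"
        using w g by (intro smooth_word_deriv) (auto simp: words_def)
      show ?thesis
        using curve_derivative[OF atlas y t s]
        unfolding dir_deriv_lincomb[OF atlas s] word_deriv_Cons comp_def
        by (simp add: has_real_derivative_iff_has_vector_derivative)
    qed
    then have "((\<lambda>t. W n (y t)) has_field_derivative
        (\<Sum>w\<in>words D n. prod_list (map \<alpha> w) * (\<Sum>d=1..D. \<alpha> d * word_deriv \<A> E (d # w) g (y t)))) (at t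
            within {0..1})"
      unfolding W_def by (intro DERIV_sum DERIV_cmult)
    moreover have "(\<Sum>w\<in>words D n. prod_list (map \<alpha> w) * (\<Sum>d=1..D. \<alpha> d * word_deriv \<A> E (d # w) g (y t))) =
        W (Suc n) (y t)"
      unfolding W_def sum_words_Suc by (subst sum.swap) (simp add: sum_distrib_left mult_ac)
    ultimately show ?thesis by simp
  qed
  have bound: "\<bar>W (Suc N) (y t)\<bar> \<le> B * real D ^ Suc N * a ^ Suc N" if t: "t \<in> {0..1}" for t
  proof -
    have "\<bar>W (Suc N) (y t)\<bar> \<le> (\<Sum>w\<in>words D (Suc N). a ^ Suc N * B)"
      unfolding W_def
    proof (rule sum_abs[THEN order_trans], rule sum_mono)
      fix w assume w: "w \<in> words D (Suc N)"
      have "\<bar>prod_list (map \<alpha> w)\<bar> \<le> a ^ Suc N"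
        using abs_prod_list_le[of w D \<alpha> a] w \<alpha> by (simp add: words_def)
      moreover have "\<bar>word_deriv \<A> E w g (y t)\<bar> \<le> B" using B[OF w, of "y t"] yS t by (simp add:
          image_subset_iff)
      ultimately show "\<bar>prod_list (map \<alpha> w) * word_deriv \<A> E w g (y t)\<bar> \<le> a ^ Suc N * B"
        unfolding abs_mult using a0 by (intro mult_mono) auto
    qed
    then show ?thesis by (simp add: card_words mult_ac)
  qed
  have "norm (W 0 (y 1) - (\<Sum>i\<le>N. W i (y 0) * (1 - 0) ^ i / fact i)) \<le>
      B * real D ^ Suc N * a ^ Suc N * norm (1 - 0 :: real) ^ Suc N / fact N"
    by (rule field_Taylor[where S = "{0..1}" and f = "\<lambda>i t. W i (y t)"]) (auto simp: deriv bound simp del: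
        power_Suc)
  \<comment> \<open>The factorial in the remainder is dropped, which keeps
    \<open>taylor_const\<close> simple.\<close>
  also have "\<dots> \<le> B * real D ^ Suc N * a ^ Suc N"
  proof -
    have "0 \<le> B * real D ^ Suc N * a ^ Suc N" using B0 a0 by simp
    then have "B * real D ^ Suc N * a ^ Suc N / fact N \<le> B * real D ^ Suc N * a ^ Suc N / 1"
      using fact_ge_1[of N, where ?'a = real] by (intro divide_left_mono) auto
    then show ?thesis by simp
  qed
  also have "(\<Sum>i\<le>N. W i (y 0) * (1 - 0) ^ i / fact i) =
      (\<Sum>w\<in>words_upto D N. prod_list (map \<alpha> w) / fact (length w) * word_deriv \<A> E w g (y 0))"
    unfolding sum_words_upto W_def
    by (intro sum.cong refl) (auto simp: sum_divide_distrib words_def intro!: sum.cong)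
  also have "W 0 (y 1) = g (y 1)" by (simp add: W_def words_0)
  finally show ?thesis by simp
qed

text \<open>The last flow is expanded at its starting point, and each derivative of \<open>g\<close>
  that appears there is expanded at \<open>p\<close> through the earlier flows, up to the order that
  is left. The products of coefficients recombine along the cuts of words, which is the recursion of
  \<open>chi\<close>.\<close>

lemma exp_product_taylor:
  fixes \<alpha> :: "nat \<Rightarrow> nat \<Rightarrow> real"
  assumes "exp_product_in \<A> D E S K \<alpha> p q"
    and \<alpha>: "\<And>k d. k \<in> {1..K} \<Longrightarrow> d \<in> {1..D} \<Longrightarrow> \<bar>\<alpha> k d\<bar> \<le> a" and a0: "a \<ge> 0" and B0: "B \<ge> 0"
    and g: "smooth_function \<A> g"
    and B: "\<And>w q. w \<in> words_upto D (Suc N) \<Longrightarrow> q \<in> S \<Longrightarrow> \<bar>word_deriv \<A> E w g q\<bar> \<le> B"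
  shows "\<bar>g q - (\<Sum>w\<in>words_upto D N. chi K (map (\<lambda>d k. \<alpha> k d) w) * word_deriv \<A> E w g p)\<bar>
     \<le> taylor_const B D K N * a ^ Suc N"
proof -
  obtain u where u: "u 0 = p" "u K = q"
    and y: "\<And>k. k \<in> {1..K} \<Longrightarrow> \<exists>y. integral_curve \<A> (\<lambda>c x. \<Sum>d=1..D. \<alpha> k d *\<^sub>R E d c x) y \<and>
       y 0 = u (k - 1) \<and> y 1 = u k \<and> y ` {0..1} \<subseteq> S"
    using assms(1) unfolding exp_product_in_def by blast
  \<comment> \<open>\<open>g\<close> and \<open>N\<close> must vary: the induction hypothesis is
    used for \<open>word_deriv \<A> E w2 g\<close> at order \<open>N - length w2\<close>, with the
    same bound \<open>B\<close>.\<close>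
  have "\<bar>g (u j) - (\<Sum>w\<in>words_upto D N. chi j (map (\<lambda>d k. \<alpha> k d) w) * word_deriv \<A> E w g p)\<bar>
     \<le> taylor_const B D j N * a ^ Suc N"
    if "j \<le> K" "smooth_function \<A> g"
      "\<And>w q. w \<in> words_upto D (Suc N) \<Longrightarrow> q \<in> S \<Longrightarrow> \<bar>word_deriv \<A> E w g q\<bar> \<le> B" for j g N
    using that
  proof (induction j arbitrary: g N)
    case 0
    have "(\<Sum>w\<in>words_upto D N. chi 0 (map (\<lambda>d k. \<alpha> k d) w) * word_deriv \<A> E w g p) = g p"
    proof -
      have "(\<Sum>w\<in>words_upto D N. chi 0 (map (\<lambda>d k. \<alpha> k d) w) * word_deriv \<A> E w g p) =
          (\<Sum>w\<in>{[]}. chi 0 (map (\<lambda>d k. \<alpha> k d) w) * word_deriv \<A> E w g p)"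
        by (rule sum.mono_neutral_right[OF finite_words_upto]) (auto simp: chi_0 words_upto_def)
      then show ?thesis by (simp add: chi_0)
    qed
    then show ?case by (simp add: u)
  next
    case (Suc j)
    let ?c = "\<lambda>w. prod_list (map (\<alpha> (Suc j)) w) / fact (length w)"
    let ?s = "\<lambda>w2. \<Sum>w1\<in>words_upto D (N - length w2). chi j (map (\<lambda>d k. \<alpha> k d) w1) * word_deriv \<A> E w1
        (word_deriv \<A> E w2 g) p"
    obtain y where y: "integral_curve \<A> (\<lambda>c x. \<Sum>d=1..D. \<alpha> (Suc j) d *\<^sub>R E d c x) y"
       "y 0 = u j" "y 1 = u (Suc j)" "y ` {0..1} \<subseteq> S"
      using y[of "Suc j"] Suc.prems(1) by auto
    have 1: "\<bar>g (u (Suc j)) - (\<Sum>w\<in>words_upto D N. ?c w * word_deriv \<A> E w g (u j))\<bar> \<le> B * real D ^ Suc N *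
        a ^ Suc N"
      unfolding y(2,3)[symmetric]
      by (rule flow_taylor[OF y(1,4) _ Suc.prems(2) _ B0 a0])
        (use Suc.prems \<alpha> in \<open>auto simp: words_def words_upto_def\<close>)
    have 2: "\<bar>word_deriv \<A> E w2 g (u j) - ?s w2\<bar> \<le> taylor_const B D j (N - length w2) * a ^ Suc (N - length w2)"
      if w2: "w2 \<in> words_upto D N" for w2
    proof (rule Suc.IH)
      show "smooth_function \<A> (word_deriv \<A> E w2 g)"
        using w2 Suc.prems(2) by (intro smooth_word_deriv) (auto simp: words_upto_def)
      fix w q assume "w \<in> words_upto D (Suc (N - length w2))" "q \<in> S"
      then show "\<bar>word_deriv \<A> E w (word_deriv \<A> E w2 g) q\<bar> \<le> B"
        using Suc.prems(3)[of "w @ w2" q] w2 by (auto simp: words_upto_def word_deriv_append)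
    qed (use Suc.prems in auto)
    have "(\<Sum>w\<in>words_upto D N. chi (Suc j) (map (\<lambda>d k. \<alpha> k d) w) * word_deriv \<A> E w g p) =
       (\<Sum>w\<in>words_upto D N. \<Sum>i\<le>length w. chi j (map (\<lambda>d k. \<alpha> k d) (take i w)) * ?c (drop i w) *
          word_deriv \<A> E (take i w) (word_deriv \<A> E (drop i w) g) p)"
      unfolding chi_Suc word_deriv_append[symmetric] append_take_drop_id
      by (simp add: sum_distrib_right take_map drop_map comp_def)
    also have "\<dots> = (\<Sum>w2\<in>words_upto D N. \<Sum>w1\<in>words_upto D (N - length w2).
         chi j (map (\<lambda>d k. \<alpha> k d) w1) * ?c w2 * word_deriv \<A> E w1 (word_deriv \<A> E w2 g) p)"
      by (rule sum_words_upto_splits[where F = "\<lambda>w1 w2. chi j (map (\<lambda>d k. \<alpha> k d) w1) * ?c w2 * word_deriv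
          \<A> E w1 (word_deriv \<A> E w2 g) p"])
    also have "\<dots> = (\<Sum>w2\<in>words_upto D N. ?c w2 * ?s w2)"
      by (simp add: sum_distrib_left mult_ac)
    finally have eq: "(\<Sum>w\<in>words_upto D N. chi (Suc j) (map (\<lambda>d k. \<alpha> k d) w) * word_deriv \<A> E w g p) =
      (\<Sum>w2\<in>words_upto D N. ?c w2 * ?s w2)" .
    have "\<bar>(\<Sum>w\<in>words_upto D N. ?c w * word_deriv \<A> E w g (u j)) - (\<Sum>w2\<in>words_upto D N. ?c w2 * ?s w2)\<bar>
       \<le> (\<Sum>w\<in>words_upto D N. taylor_const B D j (N - length w) * a ^ Suc N)"
      unfolding sum_subtractf[symmetric]
    proof (rule sum_abs[THEN order_trans], rule sum_mono)
      fix w assume w: "w \<in> words_upto D N"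
      have "\<bar>?c w\<bar> \<le> a ^ length w"
      proof -
        have "\<bar>prod_list (map (\<alpha> (Suc j)) w)\<bar> \<le> a ^ length w"
          using w \<alpha>[of "Suc j"] Suc.prems(1) by (intro abs_prod_list_le[of w D]) (auto simp: words_upto_def)
        moreover have "\<bar>?c w\<bar> \<le> \<bar>prod_list (map (\<alpha> (Suc j)) w)\<bar>"
          using fact_ge_1[of "length w", where ?'a = real]
          by (simp add: divide_le_eq mult_left_mono[of 1 "fact (length w)", simplified])
        ultimately show ?thesis by linarith
      qed
      then have "\<bar>?c w * (word_deriv \<A> E w g (u j) - ?s w)\<bar> \<le> a ^ length w * (taylor_const B D j (N -
          length w) * a ^ Suc (N - length w))"
        unfolding abs_mult using 2[OF w] a0 by (intro mult_mono) auto
      also have "\<dots> = taylor_const B D j (N - length w) * a ^ (length w + Suc (N - length w))"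
        by (simp add: power_add mult_ac)
      \<comment> \<open>The order spent on the word and the order of its remainder always add up to
        \<open>Suc N\<close>.\<close>
      also have "length w + Suc (N - length w) = Suc N" using w by (simp add: words_upto_def)
      finally show "\<bar>?c w * word_deriv \<A> E w g (u j) - ?c w * ?s w\<bar> \<le> taylor_const B D j (N - length w) *
          a ^ Suc N"
        by (simp add: right_diff_distrib)
    qed
    also have "\<dots> = (\<Sum>n\<le>N. real D ^ n * taylor_const B D j (N - n)) * a ^ Suc N"
    proof -
      have "(\<Sum>w\<in>words D n. taylor_const B D j (N - length w)) = real D ^ n * taylor_const B D j (N - n)" for n
      proof -
        have "(\<Sum>w\<in>words D n. taylor_const B D j (N - length w)) = (\<Sum>w\<in>words D n. taylor_const B D j (N - n))"
          by (intro sum.cong) (auto simp: words_def)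
        then show ?thesis by (simp add: card_words)
      qed
      then show ?thesis by (simp add: sum_distrib_right[symmetric] sum_words_upto del: power_Suc)
    qed
    finally show ?case unfolding eq using 1 by (simp add: distrib_right)
  qed
  from this[of K g N] show ?thesis using u g B by simp
qed

end

lemma is_exp_product_in_UNIV:
  "is_exp_product \<A> D E K \<alpha> p q \<Longrightarrow> exp_product_in \<A> D E UNIV K \<alpha> p q"
  unfolding is_exp_product_def exp_product_in_def is_exp_def by simp

section \<open>Confinement of the flows to a chart ball\<close>

context
  fixes \<A> :: "('m::{t2_space,second_countable_topology}, 'e::euclidean_space) chart set"
    and c :: "('m, 'e) chart" and x0 :: 'e and r :: real
  assumes atlas: "smooth_atlas \<A>" and c: "c \<in> \<A>" and r: "cball x0 r \<subseteq> snd c ` fst c"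
begin

lemma chart_inv_image: "X \<subseteq> snd c ` fst c \<Longrightarrow> chart_inv c ` X = {q \<in> fst c. snd c q \<in> X}"
proof (intro equalityI subsetI)
  fix q assume X: "X \<subseteq> snd c ` fst c" and "q \<in> chart_inv c ` X"
  then obtain q' where "snd c q' \<in> X" "q' \<in> fst c" "q = chart_inv c (snd c q')" by blast
  then show "q \<in> {q \<in> fst c. snd c q \<in> X}" by (simp add: chart_inv_eq[OF atlas c])
next
  fix q assume "q \<in> {q \<in> fst c. snd c q \<in> X}"
  then show "q \<in> chart_inv c ` X"
    by (intro image_eqI[of _ _ "snd c q"]) (simp_all add: chart_inv_eq[OF atlas c])
qed

lemma compact_chart_cball: "s \<le> r \<Longrightarrow> compact (chart_inv c ` cball x0 s)"
proof -
  assume "s \<le> r"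
  then have "cball x0 s \<subseteq> snd c ` fst c" using r by (meson cball_subset_cball_iff order_trans subset_cball)
  moreover have "continuous_on (snd c ` fst c) (chart_inv c)"
    using chart_homeo(3)[OF atlas c] by (simp add: homeomorphism_def)
  ultimately have "continuous_on (cball x0 s) (chart_inv c)" by (rule continuous_on_subset[rotated])
  then show ?thesis by (rule compact_continuous_image) simp
qed

lemma smooth_bounded_chart_cball:
  assumes "smooth_function \<A> g"
  shows "\<exists>B. \<forall>q\<in>chart_inv c ` cball x0 r. \<bar>g q\<bar> \<le> B"
proof -
  have "continuous_on (snd c ` fst c) (g \<circ> chart_inv c)"
    using assms c unfolding smooth_function_def by (intro smooth_on_continuous) blast
  then have "compact ((g \<circ> chart_inv c) ` cball x0 r)"
    using r by (intro compact_continuous_image) (auto intro: continuous_on_subset)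
  then show ?thesis by (auto dest!: compact_imp_bounded simp: bounded_iff)
qed

lemma fields_bounded_chart_cball:
  fixes D :: nat and E :: "nat \<Rightarrow> ('m, 'e) vfield"
  assumes fields: "\<And>d. d \<in> {1..D} \<Longrightarrow> smooth_vector_field \<A> (E d)"
  shows "\<exists>B\<ge>0. \<forall>d\<in>{1..D}. \<forall>q\<in>chart_inv c ` cball x0 r. norm (E d c q) \<le> B"
proof -
  have "\<exists>B. \<forall>q\<in>chart_inv c ` cball x0 r. norm (E d c q) \<le> B" if d: "d \<in> {1..D}" for d
  proof -
    have "continuous_on (snd c ` fst c) (E d c \<circ> chart_inv c)"
      using conjunct1[OF fields[OF d, unfolded smooth_vector_field_def]] c by (blast intro:
          smooth_on_continuous)
    then have "compact ((E d c \<circ> chart_inv c) ` cball x0 r)"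
      using r by (intro compact_continuous_image) (auto intro: continuous_on_subset)
    then show ?thesis by (auto dest!: compact_imp_bounded simp: bounded_iff)
  qed
  then obtain B where B: "\<And>d q. d \<in> {1..D} \<Longrightarrow> q \<in> chart_inv c ` cball x0 r \<Longrightarrow> norm (E d c q) \<le> B d" by metis
  have "norm (E d c q) \<le> (\<Sum>d=1..D. \<bar>B d\<bar>)" if "d \<in> {1..D}" "q \<in> chart_inv c ` cball x0 r" for d q
  proof -
    have "\<bar>B d\<bar> \<le> (\<Sum>d=1..D. \<bar>B d\<bar>)" using that by (intro member_le_sum) auto
    then show ?thesis using B[OF that] by linarith
  qed
  then show ?thesis by (intro exI[of _ "\<Sum>d=1..D. \<bar>B d\<bar>"]) (auto simp: sum_nonneg)
qed

text \<open>Up to its first exit from the chart ball the curve moves by at most \<open>V\<close>, hence it never exits.\<close>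

lemma curve_stays:
  assumes y: "integral_curve \<A> v y" and V: "\<And>q. q \<in> chart_inv c ` cball x0 r \<Longrightarrow> norm (v c q) \<le> V"
    and y0: "y 0 \<in> chart_inv c ` cball x0 \<rho>" and V0: "V \<ge> 0" and \<rho>: "\<rho> + V < r"
  shows "y ` {0..1} \<subseteq> chart_inv c ` cball x0 (\<rho> + V)"
proof -
  have im: "chart_inv c ` cball x0 s = {q \<in> fst c. dist x0 (snd c q) \<le> s}" if "s \<le> r" for s
  proof -
    have "cball x0 s \<subseteq> snd c ` fst c" using r that by (meson subset_cball order_trans)
    from chart_inv_image[OF this] show ?thesis by simp
  qed
  define U where "U = {q \<in> fst c. dist x0 (snd c q) < r}"
  have "U = fst c \<inter> snd c -` ball x0 r" by (auto simp: U_def)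
  then have U: "open U"
    using chart_homeo(1,3)[OF atlas c] by (auto simp: homeomorphism_def intro!: continuous_open_preimage)
  have cont: "continuous_on {0..1} y" using y by (simp add: integral_curve_def)
  \<comment> \<open>While the curve remains in the open chart ball \<open>U\<close>, a single chart
    measures its displacement by the mean value inequality.\<close>
  have move: "y t \<in> chart_inv c ` cball x0 (\<rho> + V)" if t: "t \<in> {0..1}" and tU: "\<And>s. s \<in> {0..t} \<Longrightarrow> y s \<in> U" for t
  proof -
    have der: "((snd c \<circ> y) has_derivative (\<lambda>h. h *\<^sub>R v c (y s))) (at s within {0..t})" if s: "s \<in> {0..t}" for s
    proof -
      have "((snd c \<circ> y) has_derivative (\<lambda>h. h *\<^sub>R v c (y s))) (at s within {0..1})"
        using y c s t tU[OF s] by (auto simp: integral_curve_def has_vector_derivative_def U_def)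
      then show ?thesis by (rule has_derivative_subset) (use t in auto)
    qed
    have on: "onorm (\<lambda>h. h *\<^sub>R v c (y s)) \<le> V" if s: "s \<in> {0..t}" for s
    proof (rule onorm_le)
      fix h :: real
      have "y s \<in> chart_inv c ` cball x0 r" using tU[OF s] by (simp add: im U_def)
      then show "norm (h *\<^sub>R v c (y s)) \<le> V * norm h"
        using mult_right_mono[OF V, of "y s" "\<bar>h\<bar>"] by (simp add: mult.commute)
    qed
    have "norm ((snd c \<circ> y) t - (snd c \<circ> y) 0) \<le> V * norm (t - 0)"
      by (rule differentiable_bound[of "{0..t}", OF _ der on]) (use t in auto)
    also have "\<dots> \<le> V * 1" using t V0 by (intro mult_left_mono) auto
    finally have "dist (snd c (y 0)) (snd c (y t)) \<le> V" by (simp add: dist_norm norm_minus_commute)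
    moreover have "dist x0 (snd c (y 0)) \<le> \<rho>" using y0 im[of \<rho>] \<rho> V0 by simp
    ultimately have "dist x0 (snd c (y t)) \<le> \<rho> + V"
      using dist_triangle[of x0 "snd c (y t)" "snd c (y 0)"] by linarith
    then show ?thesis using tU[of t] t \<rho> im[of "\<rho> + V"] by (auto simp: U_def)
  qed
  have "y t \<in> U" if "t \<in> {0..1}" for t
  proof (rule ccontr)
    assume "y t \<notin> U"
    define T where "T = {0..1} \<inter> y -` (- U)"
    have T: "closed T" unfolding T_def by (rule continuous_closed_preimage[OF cont]) (use U in auto)
    have "t \<in> T" using that \<open>y t \<notin> U\<close> by (simp add: T_def)
    have bdd: "bdd_below T" by (rule bdd_belowI[of _ 0]) (auto simp: T_def)
    define t1 where "t1 = Inf T"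
    have t1: "t1 \<in> T" unfolding t1_def using T bdd \<open>t \<in> T\<close> by (intro closed_contains_Inf) auto
    have before: "y s \<in> U" if "0 \<le> s" "s < t1" for s
    proof (rule ccontr)
      assume "y s \<notin> U"
      then have "s \<in> T" using that t1 by (auto simp: T_def)
      then show False using cInf_lower[OF _ bdd, of s] that by (simp add: t1_def)
    qed
    have "y 0 \<in> U" using y0 im[of \<rho>] \<rho> V0 by (auto simp: U_def)
    then have "t1 > 0" using t1 by (cases "t1 = 0") (auto simp: T_def)
    \<comment> \<open>Compactness makes the smaller ball closed in the manifold, so the bound valid
      before the first exit time \<open>t1\<close> holds at \<open>t1\<close> too. As
      \<open>\<rho> + V < r\<close>, this puts \<open>y t1\<close> back into \<open>U\<close>, a
      contradiction.\<close>
    have "closed (chart_inv c ` cball x0 (\<rho> + V))"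
      using compact_chart_cball[of "\<rho> + V"] \<rho> by (intro compact_imp_closed) auto
    then have "closed ({0..1} \<inter> y -` (chart_inv c ` cball x0 (\<rho> + V)))"
      by (intro continuous_closed_preimage[OF cont]) auto
    moreover have "{0..<t1} \<subseteq> {0..1} \<inter> y -` (chart_inv c ` cball x0 (\<rho> + V))"
    proof
      fix s assume s: "s \<in> {0..<t1}"
      then have "s \<in> {0..1}" using t1 by (auto simp: T_def)
      then show "s \<in> {0..1} \<inter> y -` (chart_inv c ` cball x0 (\<rho> + V))"
        using move[of s] before s by auto
    qed
    ultimately have "closure {0..<t1} \<subseteq> {0..1} \<inter> y -` (chart_inv c ` cball x0 (\<rho> + V))"
      by (rule closure_minimal[rotated])
    moreover have "t1 \<in> closure {0..<t1}" using \<open>t1 > 0\<close> by simp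
    ultimately have "y t1 \<in> chart_inv c ` cball x0 (\<rho> + V)" by blast
    then have "y t1 \<in> U" using im[of "\<rho> + V"] \<rho> by (auto simp: U_def)
    then show False using t1 by (simp add: T_def)
  qed
  then show ?thesis using move by auto
qed

text \<open>The displacements of successive flows add up: in the ball a combination of
  \<open>D\<close> fields with coefficients at most \<open>a\<close> has norm at most
  \<open>D * (a * V)\<close>, and after \<open>k\<close> flows the curve lies in the ball of
  \<open>k\<close> times this radius.\<close>

lemma exp_product_stays:
  fixes a V :: real and E :: "nat \<Rightarrow> ('m, 'e) vfield"
  assumes "is_exp_product \<A> D E K \<alpha> p q" and p: "p \<in> fst c" "snd c p = x0" and a0: "a \<ge> 0" and V0: "V \<ge> 0"
    and \<alpha>: "\<And>k d. k \<in> {1..K} \<Longrightarrow> d \<in> {1..D} \<Longrightarrow> \<bar>\<alpha> k d\<bar> \<le> a"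
    and V: "\<And>d q. d \<in> {1..D} \<Longrightarrow> q \<in> chart_inv c ` cball x0 r \<Longrightarrow> norm (E d c q) \<le> V"
    and small: "K * (D * (a * V)) < r"
  shows "exp_product_in \<A> D E (chart_inv c ` cball x0 r) K \<alpha> p q"
proof -
  obtain u where "u 0 = p \<and> u K = q \<and> (\<forall>k\<in>{1..K}. \<exists>y. integral_curve \<A> (\<lambda>c x. \<Sum>d=1..D. \<alpha> k d *\<^sub>R E d c x) y \<and>
       y 0 = u (k - 1) \<and> y 1 = u k)"
    using assms(1) unfolding is_exp_product_def is_exp_def by (rule exE)
  then have u: "u 0 = p" "u K = q"
    and y: "\<And>k. k \<in> {1..K} \<Longrightarrow> \<exists>y. integral_curve \<A> (\<lambda>c x. \<Sum>d=1..D. \<alpha> k d *\<^sub>R E d c x) y \<and>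
       y 0 = u (k - 1) \<and> y 1 = u k"
    by simp_all
  let ?V = "D * (a * V)"
  have V': "?V \<ge> 0" using a0 V0 by simp
  have field: "norm (\<Sum>d=1..D. \<alpha> k d *\<^sub>R E d c q) \<le> ?V" if "k \<in> {1..K}" "q \<in> chart_inv c ` cball x0 r" for k q
  proof -
    have "norm (\<Sum>d=1..D. \<alpha> k d *\<^sub>R E d c q) \<le> (\<Sum>d=1..D. a * V)"
    proof (rule sum_norm_le)
      fix d assume d: "d \<in> {1..D}"
      show "norm (\<alpha> k d *\<^sub>R E d c q) \<le> a * V"
        unfolding norm_scaleR using \<alpha>[OF that(1) d] V[OF d that(2)] a0 by (intro mult_mono) auto
    qed
    then show ?thesis by simp
  qed
  have stay: "y ` {0..1} \<subseteq> chart_inv c ` cball x0 (k * ?V)"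
    if "k \<in> {1..K}" "integral_curve \<A> (\<lambda>c x. \<Sum>d=1..D. \<alpha> k d *\<^sub>R E d c x) y"
      "y 0 \<in> chart_inv c ` cball x0 ((k - 1) * ?V)" for k :: nat and y
  proof -
    have "real k * ?V \<le> real K * ?V" using that(1) V' by (intro mult_right_mono) auto
    moreover have eq: "real (k - 1) * ?V + ?V = real k * ?V" using that(1) by (cases k) (auto simp:
        algebra_simps)
    ultimately have "real (k - 1) * ?V + ?V < r" using small by linarith
    from curve_stays[OF that(2) field[OF that(1)] that(3) V' this] show ?thesis by (simp only: eq)
  qed
  have uk: "u k \<in> chart_inv c ` cball x0 (k * ?V)" if "k \<le> K" for k
    using that
  proof (induction k)
    case 0
    have "chart_inv c x0 = p" using p chart_inv_eq[OF atlas c, of p] by simp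
    then show ?case using u by auto
  next
    case (Suc k)
    then obtain y where y: "integral_curve \<A> (\<lambda>c x. \<Sum>d=1..D. \<alpha> (Suc k) d *\<^sub>R E d c x) y" "y 0 = u k" "y 1
        = u (Suc k)"
      using y[of "Suc k"] by auto
    have "y ` {0..1} \<subseteq> chart_inv c ` cball x0 (Suc k * ?V)"
      by (rule stay) (use y(1,2) Suc in simp_all)
    moreover have "u (Suc k) \<in> y ` {0..1}" by (rule image_eqI[of _ _ 1]) (simp_all add: y)
    ultimately show ?case by (rule subsetD)
  qed
  show ?thesis unfolding exp_product_in_def
  proof (intro exI[of _ u] conjI u ballI)
    fix k assume k: "k \<in> {1..K}"
    obtain y where y: "integral_curve \<A> (\<lambda>c x. \<Sum>d=1..D. \<alpha> k d *\<^sub>R E d c x) y" "y 0 = u (k - 1)" "y 1 = u k"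
      using y[OF k] by (elim exE conjE)
    have "k - 1 \<le> K" using k unfolding atLeastAtMost_iff by arith
    then have "y ` {0..1} \<subseteq> chart_inv c ` cball x0 (k * ?V)"
      by (intro stay[OF k y(1)]) (simp only: y(2) uk)
    also have "\<dots> \<subseteq> chart_inv c ` cball x0 r"
    proof (intro image_mono subset_cball)
      have "real k * ?V \<le> real K * ?V" using k V' by (intro mult_right_mono) auto
      then show "real k * ?V \<le> r" using small by simp
    qed
    finally show "\<exists>y. integral_curve \<A> (\<lambda>c x. \<Sum>d=1..D. \<alpha> k d *\<^sub>R E d c x) y \<and> y 0 = u (k - 1) \<and> y 1 = u k \<and>
        y ` {0..1} \<subseteq> chart_inv c ` cball x0 r"
      using y by blast
  qed
qed

end

section \<open>Sums over decorated forests\<close>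

lemma chi_PiE:
  "chi K bs = (\<Sum>r\<in>{..<length bs} \<rightarrow>\<^sub>E {1..K}. label_weight K (map r [0..<length bs]) * (\<Prod>a<length bs. (bs !
      a) (r a)))"
  unfolding chi_def sum_lists_PiE by (intro sum.cong refl) simp

lemma sum_PiE_Times:
  "(\<Sum>r\<in>PiE I (\<lambda>a. A a \<times> B a). F r) = (\<Sum>r1\<in>PiE I A. \<Sum>r2\<in>PiE I B. F (\<lambda>a\<in>I. (r1 a, r2 a)))"
  unfolding sum.cartesian_product
proof (rule sum.reindex_bij_witness[where i = "\<lambda>(r1, r2). \<lambda>a\<in>I. (r1 a, r2 a)" and
      j = "\<lambda>r. (\<lambda>a\<in>I. fst (r a), \<lambda>a\<in>I. snd (r a))"], goal_cases)
  case (1 r) then show ?case by (auto simp: PiE_def extensional_def)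
next
  case (2 r) then show ?case by (force simp: PiE_def Pi_def)
next
  case (3 r) then show ?case by (auto simp: PiE_def extensional_def fun_eq_iff)
next
  case (4 r) then show ?case by (auto simp: PiE_def Pi_def)
next
  case (5 r)
  then have "(\<lambda>a\<in>I. ((\<lambda>a\<in>I. fst (r a)) a, (\<lambda>a\<in>I. snd (r a)) a)) = r"
    by (auto simp: PiE_def extensional_def fun_eq_iff)
  then show ?case by (simp only: prod.case)
qed

text \<open>Inserting a sum over trees for each letter turns the coefficient of one word into a sum
  over words of trees. This is where planar forests come from.\<close>

lemma chi_multilinear:
  assumes "finite TT"
  shows "chi K (map (\<lambda>d k. \<Sum>t\<in>TT. c t * A t k d) w) =
    (\<Sum>ts | length ts = length w \<and> set ts \<subseteq> TT. prod_list (map c ts) * chi K (map2 (\<lambda>t d k. A t k d) ts w))"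
proof -
  let ?m = "length w"
  have "chi K (map (\<lambda>d k. \<Sum>t\<in>TT. c t * A t k d) w) =
     (\<Sum>r\<in>{..<?m} \<rightarrow>\<^sub>E {1..K}. label_weight K (map r [0..<?m]) * (\<Prod>a<?m. \<Sum>t\<in>TT. c t * A t (r a) (w ! a)))"
    unfolding chi_PiE by simp
  also have "\<dots> = (\<Sum>r\<in>{..<?m} \<rightarrow>\<^sub>E {1..K}. \<Sum>\<tau>\<in>{..<?m} \<rightarrow>\<^sub>E TT.
      label_weight K (map r [0..<?m]) * ((\<Prod>a<?m. c (\<tau> a)) * (\<Prod>a<?m. A (\<tau> a) (r a) (w ! a))))"
    using assms by (simp add: prod_sum_PiE sum_distrib_left prod.distrib)
  also have "\<dots> = (\<Sum>\<tau>\<in>{..<?m} \<rightarrow>\<^sub>E TT. (\<Prod>a<?m. c (\<tau> a)) * (\<Sum>r\<in>{..<?m} \<rightarrow>\<^sub>E {1..K}.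
      label_weight K (map r [0..<?m]) * (\<Prod>a<?m. A (\<tau> a) (r a) (w ! a))))"
    by (subst sum.swap) (simp add: sum_distrib_left mult_ac)
  also have "\<dots> = (\<Sum>\<tau>\<in>{..<?m} \<rightarrow>\<^sub>E TT. prod_list (map c (map \<tau> [0..<?m])) *
      chi K (map2 (\<lambda>t d k. A t k d) (map \<tau> [0..<?m]) w))"
    unfolding chi_PiE
    by (intro sum.cong refl arg_cong2[where f = "(*)"]) (simp_all add: prod.list_conv_set_nth lessThan_atLeast0)
  finally show ?thesis unfolding sum_lists_PiE .
qed

section \<open>Degrees of trees and finiteness of shapes\<close>

text \<open>Exponents of \<open>sqrt h\<close>, that is, twice the order.\<close>

fun tree_degree :: "'n ptree \<Rightarrow> nat" where
  "tree_degree (Black ts) = 2 + sum_list (map tree_degree ts)"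
| "tree_degree (Num n) = 1"

definition forest_degree :: "'n ptree list \<Rightarrow> nat" where
  "forest_degree ts = sum_list (map tree_degree ts)"

lemma tree_degree_pos: "tree_degree t \<ge> 1"
  by (cases t) auto

lemma tree_degree_Black: "tree_degree (Black ts) = 2 + forest_degree ts"
  by (simp add: forest_degree_def)

lemma length_le_forest_degree: "length ts \<le> forest_degree ts"
proof (induction ts)
  case (Cons t ts)
  then show ?case using tree_degree_pos[of t] by (simp add: forest_degree_def)
qed simp

lemma member_le_forest_degree: "t \<in> set ts \<Longrightarrow> tree_degree t \<le> forest_degree ts"
  unfolding forest_degree_def by (intro member_le_sum_list) auto

text \<open>Trees and forests are treated together: a black root costs degree 2, so the forest below
  it has smaller degree, and a forest has at most as many trees as its degree because every tree has
  degree at least 1.\<close>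

lemma finite_shapes: "finite {t :: unit ptree. tree_degree t \<le> N} \<and> finite {ts :: unit ptree list.
    forest_degree ts \<le> N}"
proof (induction N rule: less_induct)
  case (less N)
  have "{t :: unit ptree. tree_degree t \<le> N} \<subseteq> insert (Num ()) (Black ` {ts. N \<ge> 2 \<and> forest_degree ts \<le> N - 2})"
  proof
    fix t :: "unit ptree" assume "t \<in> {t. tree_degree t \<le> N}"
    then show "t \<in> insert (Num ()) (Black ` {ts. N \<ge> 2 \<and> forest_degree ts \<le> N - 2})"
      by (cases t) (auto simp: forest_degree_def)
  qed
  moreover have "finite {ts :: unit ptree list. N \<ge> 2 \<and> forest_degree ts \<le> N - 2}"
    using less.IH[of "N - 2"] by (cases "N \<ge> 2") auto
  ultimately have t: "finite {t :: unit ptree. tree_degree t \<le> N}"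
    using finite_subset by blast
  have "{ts :: unit ptree list. forest_degree ts \<le> N} \<subseteq> {ts. set ts \<subseteq> {t. tree_degree t \<le> N} \<and> length ts \<le> N}"
    using length_le_forest_degree member_le_forest_degree by (auto intro: order_trans)
  then have "finite {ts :: unit ptree list. forest_degree ts \<le> N}"
    using finite_lists_length_le[OF t, of N] finite_subset by blast
  with t show ?case by blast
qed

lemmas finite_trees_degree = finite_shapes[THEN conjunct1]
lemmas finite_forests_degree = finite_shapes[THEN conjunct2]

section \<open>States of nodes and letters of trees\<close>

text \<open>Stage \<open>0\<close> stands for the final update, so that the roots are treated like all other nodes.\<close>

definition tab_coeff :: "ff_tableau \<Rightarrow> nat \<Rightarrow> nat \<Rightarrow> nat \<Rightarrow> real" where
  "tab_coeff T i j k = (if i = 0 then zf T j k else Zi T i j k)"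

definition tab_noise :: "ff_tableau \<Rightarrow> (nat \<Rightarrow> nat \<Rightarrow> real) \<Rightarrow> nat \<Rightarrow> nat \<Rightarrow> nat \<Rightarrow> real" where
  "tab_noise T x d i k = (if i = 0 then noise_final T x d k else noise_stage T x d i k)"

text \<open>The state of a node is its stage (\<open>0\<close> for numbered nodes), its label and its direction. The
  noise \<open>\<nu>\<close> may depend on the number of the node.\<close>

type_synonym node_state = "nat \<times> nat \<times> nat"

definition node_states :: "ff_tableau \<Rightarrow> nat set \<Rightarrow> 'n option \<Rightarrow> node_state set" where
  "node_states T Ds lab = (if lab = None then {1..stg T} else {0}) \<times> {1..nexp T} \<times> Ds"

definition edge_weight :: "ff_tableau \<Rightarrow> ('n \<Rightarrow> nat \<Rightarrow> nat \<Rightarrow> nat \<Rightarrow> real) \<Rightarrow> 'n option \<Rightarrow> node_state \<Rightarrow>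
    node_state \<Rightarrow> real" where
  "edge_weight T \<nu> lab s0 s = (case lab of None \<Rightarrow> tab_coeff T (fst s0) (fst s) (fst (snd s))
     | Some n \<Rightarrow> \<nu> n (snd (snd s)) (fst s0) (fst (snd s)))"

text \<open>Siblings interact twice: their labels must increase, and their directions form one word
  of iterated derivatives.\<close>

definition kids_weight :: "nat \<Rightarrow> (nat list \<Rightarrow> real) \<Rightarrow> node_state list \<Rightarrow> real" where
  "kids_weight K w ss = label_weight K (map (fst \<circ> snd) ss) * w (map (snd \<circ> snd) ss)"

definition node_weight :: "nat \<Rightarrow> (nat \<Rightarrow> nat list \<Rightarrow> real) \<Rightarrow> 'n option \<Rightarrow> node_state \<Rightarrow> node_state list \<Rightarrow>
    real" where
  "node_weight K w lab s ss = (case lab of None \<Rightarrow> kids_weight K (w (snd (snd s))) ss | Some n \<Rightarrow> 1)"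

lemma node_weight_None: "node_weight K w None s = kids_weight K (w (snd (snd s)))"
  by (rule ext) (simp add: node_weight_def)

text \<open>The direction set, the noise and the word weights are parameters because the sum serves
  two purposes: with frame derivatives it is a term of the expansion, with a single direction and
  constant weights it is a value of a character.\<close>

definition forest_sum :: "ff_tableau \<Rightarrow> nat set \<Rightarrow> ('n \<Rightarrow> nat \<Rightarrow> nat \<Rightarrow> nat \<Rightarrow> real) \<Rightarrow> (nat \<Rightarrow> nat list \<Rightarrow> real) \<Rightarrow>
    nat \<Rightarrow> (nat list \<Rightarrow> real) \<Rightarrow> 'n ptree list \<Rightarrow> real" where
  "forest_sum T Ds \<nu> w i w0 = tree_sum (node_states T Ds) (edge_weight T \<nu>) (node_weight (nexp T) w) (i,
      0, 0) (kids_weight (nexp T) w0)"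

text \<open>The letter that a tree becomes one level higher up: its contribution to the coefficient
  of direction \<open>d\<close> in exponent \<open>k\<close> of stage \<open>i\<close>.\<close>

definition branch_sum :: "ff_tableau \<Rightarrow> nat set \<Rightarrow> ('n \<Rightarrow> nat \<Rightarrow> nat \<Rightarrow> nat \<Rightarrow> real) \<Rightarrow> (nat \<Rightarrow> nat list \<Rightarrow> real) \<Rightarrow>
    nat \<Rightarrow> 'n ptree \<Rightarrow> nat \<Rightarrow> nat \<Rightarrow> real" where
  "branch_sum T Ds \<nu> w i t k d = (case t of
       Black us \<Rightarrow> \<Sum>j=1..stg T. tab_coeff T i j k * forest_sum T Ds \<nu> w j (w d) us
     | Num n \<Rightarrow> \<nu> n d i k)"

text \<open>An edge reads only the stage of the parent, so the label and the direction of the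
  virtual root can be normalised to \<open>0\<close>.\<close>

lemma tree_sum_root_state:
  "tree_sum S (edge_weight T \<nu>) lo (i, k, d) lo0 ts = tree_sum S (edge_weight T \<nu>) lo (i, k', d') lo0 ts"
  by (simp add: tree_sum_def tree_weight_def edge_weight_def if_distrib[of fst] cong: option.case_cong if_cong)

text \<open>For fixed directions the only coupling between the trees is the order of the labels of
  their roots. After the sum over the stages of the roots, what remains is the coefficient of a word
  with letters \<open>branch_sum\<close>.\<close>

lemma forest_sum_rec:
  assumes Ds: "finite Ds"
  shows "forest_sum T Ds \<nu> w i w0 ts =
    (\<Sum>ds | length ds = length ts \<and> set ds \<subseteq> Ds. w0 ds * chi (nexp T) (map2 (\<lambda>t d k. branch_sum T Ds \<nu> w i
        t k d) ts ds))"
proof -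
  let ?m = "length ts" and ?K = "nexp T"
  define I where "I a = (if node_label ts [a] = None then {1..stg T} else {0})" for a
  define h where "h a s = edge_weight T \<nu> (node_label ts [a]) (i, 0, 0) s *
     tree_sum (node_states T Ds) (edge_weight T \<nu>) (node_weight ?K w) s (node_weight ?K w (node_label ts
         [a]) s) (children (ts ! a))" for a s
  have S: "node_states T Ds (node_label ts [a]) = I a \<times> {1..?K} \<times> Ds" for a
    by (simp add: node_states_def I_def)
  have h: "(\<Sum>j\<in>I a. h a (j, k, d)) = branch_sum T Ds \<nu> w i (ts ! a) k d" if "a < ?m" for a k d
  proof (cases "ts ! a")
    case (Black us)
    have "tree_sum (node_states T Ds) (edge_weight T \<nu>) (node_weight ?K w) (j, k, d) (kids_weight ?K (w d)) us =
       forest_sum T Ds \<nu> w j (w d) us" for j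
      unfolding forest_sum_def tree_sum_root_state[of _ _ _ _ j k d _ _ 0 0] by simp
    then show ?thesis using Black that
      by (simp add: h_def I_def node_label_root branch_sum_def edge_weight_def node_weight_None)
  next
    case (Num n)
    then show ?thesis using that
      by (simp add: h_def I_def node_label_root branch_sum_def edge_weight_def tree_sum_Nil node_weight_def)
  qed
  have fin: "finite (I a)" for a by (simp add: I_def)
  have term_eq: "kids_weight ?K w0 (map r [0..<?m]) * (\<Prod>a<?m. h a (r a)) =
      label_weight ?K (map k [0..<?m]) * w0 (map d [0..<?m]) * (\<Prod>a<?m. h a (i a, k a, d a))"
    if "\<And>a. a \<in> {..<?m} \<Longrightarrow> r a = (i a, k a, d a)" for r i k d
  proof -
    have "map (fst \<circ> snd) (map r [0..<?m]) = map k [0..<?m]"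
      "map (snd \<circ> snd) (map r [0..<?m]) = map d [0..<?m]" using that by simp_all
    moreover have "(\<Prod>a<?m. h a (r a)) = (\<Prod>a<?m. h a (i a, k a, d a))"
      by (rule prod.cong) (simp_all add: that)
    ultimately show ?thesis by (simp only: kids_weight_def)
  qed
  have branches: "(\<Sum>i\<in>PiE {..<?m} I. \<Prod>a<?m. h a (i a, k a, d a)) =
      (\<Prod>a<?m. branch_sum T Ds \<nu> w i (ts ! a) (k a) (d a))" for k d
    by (subst prod_sum_PiE[symmetric]) (auto simp: fin h intro!: prod.cong)
  have "forest_sum T Ds \<nu> w i w0 ts =
     (\<Sum>r\<in>PiE {..<?m} (\<lambda>a. I a \<times> {1..?K} \<times> Ds). kids_weight ?K w0 (map r [0..<?m]) * (\<Prod>a<?m. h a (r a)))"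
    unfolding forest_sum_def by (subst tree_sum_rec) (auto simp: node_states_def Ds h_def I_def)
  \<comment> \<open>The state of a root is split into stage, label and direction, so that the stages
    can be summed tree by tree.\<close>
  also have "\<dots> = (\<Sum>i\<in>PiE {..<?m} I. \<Sum>k\<in>{..<?m} \<rightarrow>\<^sub>E {1..?K}. \<Sum>d\<in>{..<?m} \<rightarrow>\<^sub>E Ds.
      label_weight ?K (map k [0..<?m]) * w0 (map d [0..<?m]) * (\<Prod>a<?m. h a (i a, k a, d a)))"
    unfolding sum_PiE_Times by (intro sum.cong refl term_eq) simp
  also have "\<dots> = (\<Sum>k\<in>{..<?m} \<rightarrow>\<^sub>E {1..?K}. \<Sum>d\<in>{..<?m} \<rightarrow>\<^sub>E Ds. \<Sum>i\<in>PiE {..<?m} I.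
      label_weight ?K (map k [0..<?m]) * w0 (map d [0..<?m]) * (\<Prod>a<?m. h a (i a, k a, d a)))"
    by (subst sum.swap, rule sum.cong[OF refl], subst sum.swap, rule refl)
  also have "\<dots> = (\<Sum>k\<in>{..<?m} \<rightarrow>\<^sub>E {1..?K}. \<Sum>d\<in>{..<?m} \<rightarrow>\<^sub>E Ds.
      label_weight ?K (map k [0..<?m]) * w0 (map d [0..<?m]) * (\<Prod>a<?m. branch_sum T Ds \<nu> w i (ts ! a) (k
          a) (d a)))"
    unfolding sum_distrib_left[symmetric] branches ..
  also have "\<dots> = (\<Sum>d\<in>{..<?m} \<rightarrow>\<^sub>E Ds. w0 (map d [0..<?m]) * (\<Sum>k\<in>{..<?m} \<rightarrow>\<^sub>E {1..?K}.
      label_weight ?K (map k [0..<?m]) * (\<Prod>a<?m. branch_sum T Ds \<nu> w i (ts ! a) (k a) (d a))))"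
    by (subst sum.swap) (simp add: sum_distrib_left mult_ac)
  also have "\<dots> = (\<Sum>d\<in>{..<?m} \<rightarrow>\<^sub>E Ds. w0 (map d [0..<?m]) *
      chi ?K (map2 (\<lambda>t d k. branch_sum T Ds \<nu> w i t k d) ts (map d [0..<?m])))"
    unfolding chi_PiE by simp
  finally show ?thesis unfolding sum_lists_PiE .
qed

section \<open>Asymptotic expansion of the stages\<close>

context
  fixes F :: "'c filter" and eps W :: "'c \<Rightarrow> real"
  assumes eps: "\<forall>\<^sub>F c in F. 0 < eps c \<and> eps c \<le> 1" and W: "\<forall>\<^sub>F c in F. 1 \<le> W c"
begin

text \<open>The bounds are polynomial in the size \<open>W\<close> of the noise, so that they survive taking expectations.\<close>

definition OW :: "nat \<Rightarrow> ('c \<Rightarrow> real) \<Rightarrow> bool" where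
  "OW n e \<longleftrightarrow> (\<exists>q C. C \<ge> 0 \<and> (\<forall>\<^sub>F c in F. \<bar>e c\<bar> \<le> C * (eps c ^ n * W c ^ q)))"

lemma OW_I: "C \<ge> 0 \<Longrightarrow> \<forall>\<^sub>F c in F. \<bar>e c\<bar> \<le> C * (eps c ^ n * W c ^ q) \<Longrightarrow> OW n e"
  unfolding OW_def by (rule exI[of _ q], rule exI[of _ C], rule conjI)

lemma OW_dominated:
  assumes "OW n e" "\<forall>\<^sub>F c in F. \<bar>e' c\<bar> \<le> \<bar>e c\<bar>" shows "OW n e'"
proof -
  obtain q C where C: "C \<ge> 0" and e: "\<forall>\<^sub>F c in F. \<bar>e c\<bar> \<le> C * (eps c ^ n * W c ^ q)"
    using assms(1) by (auto simp: OW_def)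
  from e assms(2) have "\<forall>\<^sub>F c in F. \<bar>e' c\<bar> \<le> C * (eps c ^ n * W c ^ q)"
    by eventually_elim linarith
  then show ?thesis by (rule OW_I[OF C])
qed

lemma OW_weaken:
  assumes "OW n e" "m \<le> n" shows "OW m e"
proof -
  obtain q C where C: "C \<ge> 0" and e: "\<forall>\<^sub>F c in F. \<bar>e c\<bar> \<le> C * (eps c ^ n * W c ^ q)"
    using assms(1) by (auto simp: OW_def)
  from e eps W have "\<forall>\<^sub>F c in F. \<bar>e c\<bar> \<le> C * (eps c ^ m * W c ^ q)"
  proof eventually_elim
    case (elim c)
    have "eps c ^ n \<le> eps c ^ m" using elim assms(2) by (intro power_decreasing) auto
    then have "C * (eps c ^ n * W c ^ q) \<le> C * (eps c ^ m * W c ^ q)"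
      using elim C by (intro mult_left_mono mult_right_mono) auto
    with elim show ?case by linarith
  qed
  then show ?thesis by (rule OW_I[OF C])
qed

lemma OW_const: "OW 0 (\<lambda>_. r)"
  by (rule OW_I[of "\<bar>r\<bar>" _ 0 0]) auto

lemma OW_zero: "OW n (\<lambda>_. 0)"
  by (rule OW_I[of 0 _ n 0]) auto

lemma OW_eps: "OW n (\<lambda>c. eps c ^ n)"
  by (rule OW_I[of 1 _ n 0], simp, rule eventually_mono[OF eps]) simp

lemma OW_mult:
  assumes "OW n e" "OW m e'" shows "OW (n + m) (\<lambda>c. e c * e' c)"
proof -
  obtain q C where C: "C \<ge> 0" and e: "\<forall>\<^sub>F c in F. \<bar>e c\<bar> \<le> C * (eps c ^ n * W c ^ q)"
    using assms(1) by (auto simp: OW_def)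
  obtain q' C' where C': "C' \<ge> 0" and e': "\<forall>\<^sub>F c in F. \<bar>e' c\<bar> \<le> C' * (eps c ^ m * W c ^ q')"
    using assms(2) by (auto simp: OW_def)
  from e e' have "\<forall>\<^sub>F c in F. \<bar>e c * e' c\<bar> \<le> (C * C') * (eps c ^ (n + m) * W c ^ (q + q'))"
  proof eventually_elim
    case (elim c)
    have "\<bar>e c\<bar> * \<bar>e' c\<bar> \<le> (C * (eps c ^ n * W c ^ q)) * (C' * (eps c ^ m * W c ^ q'))"
      by (rule mult_mono[OF elim]) (use elim abs_ge_zero[of "e c"] in linarith, simp)
    then show ?case by (simp add: abs_mult power_add mult_ac)
  qed
  then show ?thesis using C C' by (intro OW_I[of "C * C'"]) auto
qed

text \<open>Since \<open>1 \<le> W\<close>, both powers of the noise can be raised to the sum of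
  their exponents.\<close>

lemma OW_add:
  assumes "OW n e" "OW n e'" shows "OW n (\<lambda>c. e c + e' c)"
proof -
  obtain q C where C: "C \<ge> 0" and e: "\<forall>\<^sub>F c in F. \<bar>e c\<bar> \<le> C * (eps c ^ n * W c ^ q)"
    using assms(1) by (auto simp: OW_def)
  obtain q' C' where C': "C' \<ge> 0" and e': "\<forall>\<^sub>F c in F. \<bar>e' c\<bar> \<le> C' * (eps c ^ n * W c ^ q')"
    using assms(2) by (auto simp: OW_def)
  from e e' eps W have "\<forall>\<^sub>F c in F. \<bar>e c + e' c\<bar> \<le> (C + C') * (eps c ^ n * W c ^ (q + q'))"
  proof eventually_elim
    case (elim c)
    have "W c ^ q \<le> W c ^ (q + q')" "W c ^ q' \<le> W c ^ (q + q')" using elim by (auto intro!: power_increasing)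
    then have "C * (eps c ^ n * W c ^ q) \<le> C * (eps c ^ n * W c ^ (q + q'))"
      "C' * (eps c ^ n * W c ^ q') \<le> C' * (eps c ^ n * W c ^ (q + q'))"
      using elim C C' by (auto intro!: mult_left_mono)
    then show ?case using elim by (simp add: distrib_right)
  qed
  then show ?thesis using C C' by (intro OW_I[of "C + C'"]) auto
qed

lemma OW_mult0: "OW 0 e \<Longrightarrow> OW n e' \<Longrightarrow> OW n (\<lambda>c. e c * e' c)"
  using OW_mult[of 0 e n e'] by simp

lemma OW_cmult: "OW n e \<Longrightarrow> OW n (\<lambda>c. r * e c)"
  by (rule OW_mult0[OF OW_const])

lemma OW_uminus: "OW n e \<Longrightarrow> OW n (\<lambda>c. - e c)"
  using OW_cmult[of n e "-1"] by simp

lemma OW_diff: "OW n e \<Longrightarrow> OW n e' \<Longrightarrow> OW n (\<lambda>c. e c - e' c)"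
  using OW_add[of n e "\<lambda>c. - e' c"] OW_uminus[of n e'] by simp

lemma OW_sum: "(\<And>i. i \<in> I \<Longrightarrow> OW n (e i)) \<Longrightarrow> OW n (\<lambda>c. \<Sum>i\<in>I. e i c)"
  by (induction I rule: infinite_finite_induct) (auto intro: OW_add OW_zero)

lemma OW_prod: "(\<And>i. i \<in> I \<Longrightarrow> OW 0 (e i)) \<Longrightarrow> OW 0 (\<lambda>c. \<Prod>i\<in>I. e i c)"
  by (induction I rule: infinite_finite_induct) (auto intro: OW_mult0 OW_const)

lemma OW_power: "OW n e \<Longrightarrow> OW (m * n) (\<lambda>c. e c ^ m)"
  by (induction m) (auto intro: OW_mult OW_const)

lemma OW_abs: "OW n e \<Longrightarrow> OW n (\<lambda>c. \<bar>e c\<bar>)"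
  by (erule OW_dominated) auto

text \<open>Telescoping: one factor is replaced at a time, and all other factors are of order
  0.\<close>

lemma OW_prod_diff:
  assumes "finite I" "\<And>i. i \<in> I \<Longrightarrow> OW 0 (e i)" "\<And>i. i \<in> I \<Longrightarrow> OW 0 (e' i)"
    "\<And>i. i \<in> I \<Longrightarrow> OW n (\<lambda>c. e i c - e' i c)"
  shows "OW n (\<lambda>c. (\<Prod>i\<in>I. e i c) - (\<Prod>i\<in>I. e' i c))"
  using assms
proof (induction I rule: finite_induct)
  case (insert i I)
  have "OW n (\<lambda>c. e i c * ((\<Prod>i\<in>I. e i c) - (\<Prod>i\<in>I. e' i c)) + (\<Prod>i\<in>I. e' i c) * (e i c - e' i c))"
    using insert by (intro OW_add OW_mult0 OW_prod) auto
  then show ?case using insert by (simp add: algebra_simps)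
qed (simp add: OW_zero)

text \<open>For fixed labels the summand of \<open>chi\<close> is a product of letters, so closeness
  of the letters is inherited.\<close>

lemma OW_chi_diff:
  assumes "\<And>d k. d \<in> set w \<Longrightarrow> k \<in> {1..K} \<Longrightarrow> OW 0 (\<lambda>c. \<alpha> c k d)"
    "\<And>d k. d \<in> set w \<Longrightarrow> k \<in> {1..K} \<Longrightarrow> OW 0 (\<lambda>c. \<alpha>' c k d)"
    "\<And>d k. d \<in> set w \<Longrightarrow> k \<in> {1..K} \<Longrightarrow> OW n (\<lambda>c. \<alpha> c k d - \<alpha>' c k d)"
  shows "OW n (\<lambda>c. chi K (map (\<lambda>d k. \<alpha> c k d) w) - chi K (map (\<lambda>d k. \<alpha>' c k d) w))"
proof -
  have "OW n (\<lambda>c. \<Sum>r\<in>{..<length w} \<rightarrow>\<^sub>E {1..K}. label_weight K (map r [0..<length w]) *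
      ((\<Prod>a<length w. \<alpha> c (r a) (w ! a)) - (\<Prod>a<length w. \<alpha>' c (r a) (w ! a))))"
  proof (rule OW_sum, rule OW_cmult)
    fix r assume r: "r \<in> {..<length w} \<rightarrow>\<^sub>E {1..K}"
    have k: "r a \<in> {1..K}" if "a \<in> {..<length w}" for a using PiE_mem[OF r that] .
    show "OW n (\<lambda>c. (\<Prod>a<length w. \<alpha> c (r a) (w ! a)) - (\<Prod>a<length w. \<alpha>' c (r a) (w ! a)))"
      by (rule OW_prod_diff[OF finite_lessThan]) (rule assms[OF _ k]; simp)+
  qed
  then show ?thesis
    by (simp add: chi_PiE sum_subtractf right_diff_distrib)
qed

end

text \<open>The leaves carry no numbers yet: pairings appear only when expectations are taken.
  Through \<open>x\<close> the coefficient is random.\<close>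

definition shape_coeff where
  "shape_coeff \<A> D E f T p x i g = forest_sum T {1..D} (\<lambda>_::unit. tab_noise T x)
     (\<lambda>d ds. word_deriv \<A> E ds (f d) p) i (\<lambda>ds. word_deriv \<A> E ds g p)"

definition bounded_words_on where
  "bounded_words_on S \<A> D E g \<longleftrightarrow> (\<forall>w. set w \<subseteq> {1..D} \<longrightarrow> (\<exists>B. \<forall>q\<in>S. \<bar>word_deriv \<A> E w g q\<bar> \<le> B))"

text \<open>The bound may depend on the word; at a given order only finitely many words
  occur.\<close>

lemma bounded_words_uniform:
  assumes "bounded_words_on S \<A> D E g"
  shows "\<exists>B\<ge>0. \<forall>w\<in>words_upto D N. \<forall>q\<in>S. \<bar>word_deriv \<A> E w g q\<bar> \<le> B"
proof -
  have "\<forall>w\<in>words_upto D N. \<exists>B. \<forall>q\<in>S. \<bar>word_deriv \<A> E w g q\<bar> \<le> B"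
    using assms by (auto simp: bounded_words_on_def words_upto_def)
  then obtain B where B: "\<And>w q. w \<in> words_upto D N \<Longrightarrow> q \<in> S \<Longrightarrow> \<bar>word_deriv \<A> E w g q\<bar> \<le> B w" by metis
  have "\<bar>word_deriv \<A> E w g q\<bar> \<le> (\<Sum>w\<in>words_upto D N. \<bar>B w\<bar>)" if "w \<in> words_upto D N" "q \<in> S" for w q
    using B[OF that] member_le_sum[of w "words_upto D N" "\<lambda>w. \<bar>B w\<bar>"] that by force
  then show ?thesis by (intro exI[of _ "\<Sum>w\<in>words_upto D N. \<bar>B w\<bar>"]) (auto simp: sum_nonneg)
qed

section \<open>Expansion of functions at all stages\<close>

context
  fixes F :: "'c filter" and eps W :: "'c \<Rightarrow> real" and x :: "'c \<Rightarrow> nat \<Rightarrow> nat \<Rightarrow> real" and H :: "'c \<Rightarrow> nat \<Rightarrow>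
      'm::{t2_space,second_countable_topology}"
    and \<A> :: "('m, 'e::euclidean_space) chart set"
    and D :: nat and E :: "nat \<Rightarrow> ('m, 'e) vfield" and f :: "nat \<Rightarrow> 'm \<Rightarrow> real" and T :: ff_tableau
    and S :: "'m set" and p :: 'm
  assumes eps: "\<forall>\<^sub>F c in F. 0 < eps c \<and> eps c \<le> 1"
    and W_def: "\<And>c. W c = 1 + (\<Sum>d=1..D. \<Sum>l=1..nrv T. \<bar>x c d l\<bar>)"
    and atlas: "smooth_atlas \<A>"
    and fields: "\<And>d. d \<in> {1..D} \<Longrightarrow> smooth_vector_field \<A> (E d)"
    and smooth_f: "\<And>d. d \<in> {1..D} \<Longrightarrow> smooth_function \<A> (f d)"
    and bounded_f: "\<And>d. d \<in> {1..D} \<Longrightarrow> bounded_words_on S \<A> D E (f d)"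
    and step: "\<forall>\<^sub>F c in F. \<forall>i\<le>stg T. exp_product_in \<A> D E S (nexp T)
       (\<lambda>k d. eps c ^ 2 * (\<Sum>j=1..stg T. tab_coeff T i j k * f d (H c j)) + eps c * tab_noise T (x c) d i
           k) p (H c i)"
    and inS: "\<forall>\<^sub>F c in F. \<forall>j\<in>{1..stg T}. H c j \<in> S"
begin

lemma W: "\<forall>\<^sub>F c in F. 1 \<le> W c"
  by (intro always_eventually allI) (simp add: W_def sum_nonneg)

abbreviation (input) "Ord \<equiv> OW F eps W"

lemmas Ord = OW_add[OF eps W] OW_diff[OF eps W] OW_sum[OF eps W] OW_cmult[OF eps W] OW_mult0[OF eps W]

lemma Ord_noise_var: "d \<in> {1..D} \<Longrightarrow> l \<in> {1..nrv T} \<Longrightarrow> Ord 0 (\<lambda>c. x c d l)"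
proof (rule OW_I[OF eps W, of 1 _ _ 1], simp, intro always_eventually allI)
  fix c assume d: "d \<in> {1..D}" "l \<in> {1..nrv T}"
  have "\<bar>x c d l\<bar> \<le> (\<Sum>l=1..nrv T. \<bar>x c d l\<bar>)" using d by (intro member_le_sum) auto
  also have "\<dots> \<le> (\<Sum>d=1..D. \<Sum>l=1..nrv T. \<bar>x c d l\<bar>)"
    using d by (intro member_le_sum[of d "{1..D}" "\<lambda>d. \<Sum>l=1..nrv T. \<bar>x c d l\<bar>"]) (auto simp: sum_nonneg)
  finally show "\<bar>x c d l\<bar> \<le> 1 * (eps c ^ 0 * W c ^ 1)" by (simp add: W_def)
qed

lemma Ord_noise: "d \<in> {1..D} \<Longrightarrow> Ord 0 (\<lambda>c. tab_noise T (x c) d i k)"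
  unfolding tab_noise_def noise_final_def noise_stage_def
  by (cases "i = 0") (simp, intro OW_sum[OF eps W] OW_cmult[OF eps W] Ord_noise_var, simp_all,
    intro OW_sum[OF eps W] OW_cmult[OF eps W] Ord_noise_var, simp_all)

text \<open>The coefficient is a polynomial in the noise variables, hence bounded by a power of the
  noise size.\<close>

lemma Ord_shape_coeff: "Ord 0 (\<lambda>c. shape_coeff \<A> D E f T p (x c) i g ts)"
  unfolding shape_coeff_def forest_sum_def tree_sum_def tree_weight_def
proof (intro OW_sum[OF eps W] OW_cmult[OF eps W] OW_prod[OF eps W] OW_mult0[OF eps W] OW_const[OF eps W])
  fix \<sigma> v assume \<sigma>: "\<sigma> \<in> (\<Pi>\<^sub>E v\<in>nodes ts. node_states T {1..D} (node_label ts v))" and v: "v \<in> nodes ts"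
  then have "\<sigma> v \<in> node_states T {1..D} (node_label ts v)" by auto
  then have "snd (snd (\<sigma> v)) \<in> {1..D}" by (auto simp: node_states_def)
  then show "Ord 0 (\<lambda>c. edge_weight T (\<lambda>_. tab_noise T (x c)) (node_label ts v) (if is_root v then (i, 0,
      0) else \<sigma> (parent v)) (\<sigma> v))"
    by (cases "node_label ts v") (auto simp: edge_weight_def intro!: OW_const[OF eps W] Ord_noise)
qed

abbreviation (input) "drift_part c i k d \<equiv> (\<Sum>j=1..stg T. tab_coeff T i j k * f d (H c j))"
abbreviation (input) "alpha c i k d \<equiv> eps c ^ 2 * drift_part c i k d + eps c * tab_noise T (x c) d i k"
abbreviation (input) "branch c i t k d \<equiv> branch_sum T {1..D} (\<lambda>_::unit. tab_noise T (x c)) (\<lambda>d ds. word_deriv \<A> E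
    ds (f d) p) i t k d"
abbreviation (input) "light_trees N \<equiv> {t :: unit ptree. tree_degree t \<le> N}"
abbreviation (input) "light_forests N \<equiv> {ts :: unit ptree list. forest_degree ts \<le> N}"
abbreviation (input) "shape_at c i g ts \<equiv> shape_coeff \<A> D E f T p (x c) i g ts"

lemma Ord_f: "d \<in> {1..D} \<Longrightarrow> j \<in> {1..stg T} \<Longrightarrow> Ord 0 (\<lambda>c. f d (H c j))"
proof -
  assume d: "d \<in> {1..D}" and j: "j \<in> {1..stg T}"
  obtain B where B: "\<And>q. q \<in> S \<Longrightarrow> \<bar>f d q\<bar> \<le> B"
    using bounded_f[OF d] unfolding bounded_words_on_def by (metis empty_subsetI list.set(1) word_deriv_Nil)
  have "\<forall>\<^sub>F c in F. \<bar>f d (H c j)\<bar> \<le> \<bar>B\<bar> * (eps c ^ 0 * W c ^ 0)"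
    using inS by eventually_elim (use B j in force)
  then show ?thesis by (rule OW_I[OF eps W abs_ge_zero])
qed

lemma Ord_eps1: "Ord 1 eps" and Ord_eps2: "Ord 2 (\<lambda>c. eps c ^ 2)"
  using OW_eps[OF eps W, of 1] OW_eps[OF eps W, of 2] by auto

lemma Ord_alpha: "d \<in> {1..D} \<Longrightarrow> Ord 1 (\<lambda>c. alpha c i k d)"
proof -
  assume d: "d \<in> {1..D}"
  have "Ord (2 + 0) (\<lambda>c. eps c ^ 2 * drift_part c i k d)"
    by (intro OW_mult[OF eps W] Ord_eps2 Ord(3,4) Ord_f d)
  then have "Ord 1 (\<lambda>c. eps c ^ 2 * drift_part c i k d)" by (rule OW_weaken[OF eps W]) simp
  moreover have "Ord (1 + 0) (\<lambda>c. eps c * tab_noise T (x c) d i k)"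
    by (intro OW_mult[OF eps W] Ord_eps1 Ord_noise d)
  ultimately show ?thesis by (intro Ord(1)) simp_all
qed

text \<open>A tree is a single leaf, the noise term of an exponent, or a black root over a forest
  whose degree is lower by 2, a drift term.\<close>

lemma sum_trees_split:
  "(\<Sum>t\<in>light_trees N. h t) = (if N \<ge> 1 then h (Num ()) else 0) + (\<Sum>us | 2 + forest_degree us \<le> N. h (Black us))"
proof -
  have eq: "light_trees N = (if N \<ge> 1 then {Num ()} else {}) \<union> Black ` {us. 2 + forest_degree us \<le> N}"
  proof (rule set_eqI)
    fix t show "t \<in> light_trees N \<longleftrightarrow> t \<in> (if N \<ge> 1 then {Num ()} else {}) \<union> Black ` {us. 2 + forest_degree
        us \<le> N}"
      by (cases t) (auto simp: forest_degree_def)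
  qed
  have "{us :: unit ptree list. 2 + forest_degree us \<le> N} \<subseteq> light_forests N" by auto
  then have fin: "finite {us :: unit ptree list. 2 + forest_degree us \<le> N}"
    using finite_forests_degree finite_subset by blast
  show ?thesis unfolding eq
    by (subst sum.union_disjoint) (use fin in \<open>auto simp: sum.reindex inj_on_def\<close>)
qed

lemma forest_sum_branch:
  "(\<Sum>w\<in>words D (length ts). word_deriv \<A> E w g p * chi (nexp T) (map2 (\<lambda>t d k. branch c i t k d) ts w)) =
      shape_at c i g ts"
  unfolding shape_coeff_def by (subst forest_sum_rec) (auto simp: words_def)

text \<open>The exponents \<open>alpha\<close> are of order 1 in \<open>eps\<close> and their drift part of order 2. Hence an expansion of
  the drift at the stages up to order \<open>N - 2\<close> yields one of \<open>g\<close> up to order \<open>N\<close>.\<close>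

theorem stage_expansion:
  assumes "smooth_function \<A> g" "bounded_words_on S \<A> D E g" "i \<le> stg T"
  shows "Ord (Suc N) (\<lambda>c. g (H c i) - (\<Sum>ts\<in>light_forests N. eps c ^ forest_degree ts * shape_at c i g ts))"
  using assms
proof (induction N arbitrary: g i rule: less_induct)
  case (less N)
  let ?K = "nexp T"
  \<comment> \<open>The candidate expansion of the exponents: the leaf gives the noise term, the
    black roots give the expansion of the drift at the stages.\<close>
  define \<alpha>' where "\<alpha>' c k d = (\<Sum>t\<in>light_trees N. eps c ^ tree_degree t * branch c i t k d)" for c k d
  \<comment> \<open>A single bound for all exponents, of order 1, so that the Taylor remainder with
    \<open>a c ^ Suc N\<close> has order \<open>Suc N\<close>.\<close>
  define a where "a c = (\<Sum>k=1..?K. \<Sum>d=1..D. \<bar>alpha c i k d\<bar>)" for c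
  have a: "Ord 1 a" unfolding a_def by (intro Ord(3) OW_abs[OF eps W] Ord_alpha)
  have a0: "a c \<ge> 0" for c unfolding a_def by (simp add: sum_nonneg)
  have le_a: "\<bar>alpha c i k d\<bar> \<le> a c" if "k \<in> {1..?K}" "d \<in> {1..D}" for c k d
  proof -
    have "\<bar>alpha c i k d\<bar> \<le> (\<Sum>d=1..D. \<bar>alpha c i k d\<bar>)" using that by (intro member_le_sum) auto
    also have "\<dots> \<le> a c" unfolding a_def
      using that by (intro member_le_sum[of k "{1..?K}" "\<lambda>k. \<Sum>d=1..D. \<bar>alpha c i k d\<bar>"]) (auto simp: sum_nonneg)
    finally show ?thesis .
  qed
  obtain B where B: "B \<ge> 0" "\<And>w q. w \<in> words_upto D (Suc N) \<Longrightarrow> q \<in> S \<Longrightarrow> \<bar>word_deriv \<A> E w g q\<bar> \<le> B"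
    using bounded_words_uniform[OF less.prems(2), of "Suc N"] by blast
  have taylor: "Ord (Suc N) (\<lambda>c. g (H c i) - (\<Sum>w\<in>words_upto D N. chi ?K (map (\<lambda>d k. alpha c i k d) w) *
      word_deriv \<A> E w g p))"
  proof (rule OW_dominated[OF eps W])
    have "Ord (Suc N * 1) (\<lambda>c. a c ^ Suc N)" by (rule OW_power[OF eps W a])
    then show "Ord (Suc N) (\<lambda>c. taylor_const B D ?K N * a c ^ Suc N)" by (intro Ord(4)) simp
    show "\<forall>\<^sub>F c in F. \<bar>g (H c i) - (\<Sum>w\<in>words_upto D N. chi ?K (map (\<lambda>d k. alpha c i k d) w) * word_deriv \<A>
        E w g p)\<bar>
        \<le> \<bar>taylor_const B D ?K N * a c ^ Suc N\<bar>"
      using step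
    proof eventually_elim
      case (elim c)
      then have e: "exp_product_in \<A> D E S ?K (\<lambda>k d. alpha c i k d) p (H c i)" using less.prems(3) by blast
      have "\<bar>g (H c i) - (\<Sum>w\<in>words_upto D N. chi ?K (map (\<lambda>d k. alpha c i k d) w) * word_deriv \<A> E w g p)\<bar>
        \<le> taylor_const B D ?K N * a c ^ Suc N"
        by (rule exp_product_taylor[OF atlas fields e le_a a0 B(1) less.prems(1) B(2)])
      then show ?case by linarith
    qed
  qed
  \<comment> \<open>For \<open>N < 2\<close> the sum over \<open>us\<close> is empty and
    \<open>N - 1\<close> equals 0, so boundedness of \<open>f\<close> is all that is
    claimed.\<close>
  have drift: "Ord (N - 1) (\<lambda>c. f d (H c j) - (\<Sum>us | 2 + forest_degree us \<le> N. eps c ^ forest_degree us *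
      shape_at c j (f d) us))"
    if d: "d \<in> {1..D}" and j: "j \<in> {1..stg T}" for d j
  proof (cases "N \<ge> 2")
    case True
    have "Ord (Suc (N - 2)) (\<lambda>c. f d (H c j) - (\<Sum>us\<in>light_forests (N - 2). eps c ^ forest_degree us *
        shape_at c j (f d) us))"
      using True d j by (intro less.IH smooth_f bounded_f) auto
    moreover have "light_forests (N - 2) = {us. 2 + forest_degree us \<le> N}" using True by auto
    moreover have "Suc (N - 2) = N - 1" using True by simp
    ultimately show ?thesis by simp
  next
    case False
    then show ?thesis using Ord_f[OF d j] by simp
  qed
  \<comment> \<open>For \<open>N = 0\<close> the sum over trees is empty and the exponents
    themselves have order 1. Otherwise the noise terms cancel and the drift error gains two orders
    from \<open>eps c ^ 2\<close>: \<open>2 + (N - 1) = Suc N\<close>.\<close>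
  have alpha_diff: "Ord (Suc N) (\<lambda>c. alpha c i k d - \<alpha>' c k d)" if d: "d \<in> {1..D}" for k d
  proof (cases "N = 0")
    case True
    have "\<alpha>' c k d = 0" for c unfolding \<alpha>'_def sum_trees_split using True by simp
    then show ?thesis using Ord_alpha[OF d] True by simp
  next
    case False
    have eq: "eps c ^ 2 * (\<Sum>j=1..stg T. tab_coeff T i j k * (f d (H c j) - (\<Sum>us | 2 + forest_degree us \<le>
        N. eps c ^ forest_degree us * shape_at c j (f d) us)))
       = alpha c i k d - \<alpha>' c k d" for c
    proof -
      have "(\<Sum>us | 2 + forest_degree us \<le> N. eps c ^ tree_degree (Black us) * branch c i (Black us) k d) =
         (\<Sum>us | 2 + forest_degree us \<le> N. \<Sum>j=1..stg T. eps c ^ 2 * (tab_coeff T i j k * (eps c ^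
             forest_degree us * shape_at c j (f d) us)))"
        unfolding tree_degree_Black power_add branch_sum_def shape_coeff_def
        by (simp add: sum_distrib_left mult_ac)
      also have "\<dots> = eps c ^ 2 * (\<Sum>j=1..stg T. tab_coeff T i j k * (\<Sum>us | 2 + forest_degree us \<le> N. eps c
          ^ forest_degree us * shape_at c j (f d) us))"
        by (subst sum.swap) (simp add: sum_distrib_left)
      finally show ?thesis
        unfolding \<alpha>'_def sum_trees_split using False
        by (simp add: branch_sum_def right_diff_distrib sum_subtractf)
    qed
    have "Ord (2 + (N - 1)) (\<lambda>c. eps c ^ 2 * (\<Sum>j=1..stg T. tab_coeff T i j k * (f d (H c j) - (\<Sum>us | 2 +
        forest_degree us \<le> N. eps c ^ forest_degree us * shape_at c j (f d) us))))"
      by (intro OW_mult[OF eps W] Ord_eps2 Ord(3,4) drift d)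
    then show ?thesis unfolding eq using False by simp
  qed
  have alpha0: "Ord 0 (\<lambda>c. alpha c i k d)" if "d \<in> {1..D}" for k d
    using Ord_alpha[OF that] by (rule OW_weaken[OF eps W]) simp
  have alpha'0: "Ord 0 (\<lambda>c. \<alpha>' c k d)" if "d \<in> {1..D}" for k d
  proof -
    have "Ord 0 (\<lambda>c. alpha c i k d - (alpha c i k d - \<alpha>' c k d))"
      by (intro Ord(2) alpha0 OW_weaken[OF eps W alpha_diff] that) simp
    then show ?thesis by simp
  qed
  have chi_diff: "Ord (Suc N) (\<lambda>c. (\<Sum>w\<in>words_upto D N. word_deriv \<A> E w g p * (chi ?K (map (\<lambda>d k. alpha c
      i k d) w) - chi ?K (map (\<lambda>d k. \<alpha>' c k d) w))))"
    by (intro Ord(3,4) OW_chi_diff[OF eps W] alpha0 alpha'0 alpha_diff) (auto simp: words_upto_def)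
  \<comment> \<open>Multiplying out words of light trees also produces forests of total degree above
    \<open>N\<close>; they are absorbed in the remainder.\<close>
  let ?X = "{ts. length ts \<le> N \<and> set ts \<subseteq> light_trees N}"
  have finX: "finite ?X" using finite_lists_length_le[OF finite_trees_degree, of N N] by (simp add:
      conj_commute)
  have chi': "(\<Sum>w\<in>words_upto D N. word_deriv \<A> E w g p * chi ?K (map (\<lambda>d k. \<alpha>' c k d) w)) =
     (\<Sum>ts\<in>?X. eps c ^ forest_degree ts * shape_at c i g ts)" for c
  proof -
    have pw: "prod_list (map (\<lambda>t. eps c ^ tree_degree t) ts) = eps c ^ forest_degree ts" for ts :: "unit
        ptree list"
      by (induction ts) (auto simp: forest_degree_def power_add)
    have "(\<Sum>w\<in>words_upto D N. word_deriv \<A> E w g p * chi ?K (map (\<lambda>d k. \<alpha>' c k d) w)) =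
      (\<Sum>n\<le>N. \<Sum>w\<in>words D n. \<Sum>ts | length ts = n \<and> set ts \<subseteq> light_trees N.
         eps c ^ forest_degree ts * (word_deriv \<A> E w g p * chi ?K (map2 (\<lambda>t d k. branch c i t k d) ts w)))"
      unfolding sum_words_upto \<alpha>'_def chi_multilinear[OF finite_trees_degree] pw
      by (intro sum.cong refl) (auto simp: words_def sum_distrib_left mult_ac)
    also have "\<dots> = (\<Sum>n\<le>N. \<Sum>ts | length ts = n \<and> set ts \<subseteq> light_trees N. eps c ^ forest_degree ts *
        shape_at c i g ts)"
      by (intro sum.cong refl, subst sum.swap, intro sum.cong refl)
         (auto simp: sum_distrib_left[symmetric] forest_sum_branch[symmetric])
    also have "\<dots> = (\<Sum>ts\<in>?X. eps c ^ forest_degree ts * shape_at c i g ts)"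
    proof -
      have eq: "?X = (\<Union>n\<le>N. {ts. length ts = n \<and> set ts \<subseteq> light_trees N})" by auto
      have fin: "finite {ts. length ts = n \<and> set ts \<subseteq> light_trees N}" for n
        using finite_lists_length_eq[OF finite_trees_degree, of N n] by (simp add: conj_commute)
      show ?thesis unfolding eq by (rule sum.UNION_disjoint[symmetric]) (auto simp: fin)
    qed
    finally show ?thesis .
  qed
  have sub: "light_forests N \<subseteq> ?X"
  proof
    fix ts assume "ts \<in> light_forests N"
    then show "ts \<in> ?X" using length_le_forest_degree[of ts] member_le_forest_degree[of _ ts] by force
  qed
  have rest: "Ord (Suc N) (\<lambda>c. \<Sum>ts\<in>?X - light_forests N. eps c ^ forest_degree ts * shape_at c i g ts)"
  proof (intro Ord(3))
    fix ts assume "ts \<in> ?X - light_forests N"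
    then have le: "Suc N \<le> forest_degree ts" by auto
    have "Ord (forest_degree ts + 0) (\<lambda>c. eps c ^ forest_degree ts * shape_at c i g ts)"
      by (intro OW_mult[OF eps W] OW_eps[OF eps W] Ord_shape_coeff)
    then show "Ord (Suc N) (\<lambda>c. eps c ^ forest_degree ts * shape_at c i g ts)"
      by (rule OW_weaken[OF eps W]) (simp add: le)
  qed
  have eq: "(g (H c i) - (\<Sum>w\<in>words_upto D N. chi ?K (map (\<lambda>d k. alpha c i k d) w) * word_deriv \<A> E w g p)) +
     (\<Sum>w\<in>words_upto D N. word_deriv \<A> E w g p * (chi ?K (map (\<lambda>d k. alpha c i k d) w) - chi ?K (map (\<lambda>d k.
         \<alpha>' c k d) w))) +
     (\<Sum>ts\<in>?X - light_forests N. eps c ^ forest_degree ts * shape_at c i g ts) =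
     g (H c i) - (\<Sum>ts\<in>light_forests N. eps c ^ forest_degree ts * shape_at c i g ts)" for c
    unfolding sum_diff[OF finX sub] chi'[symmetric] by (simp add: right_diff_distrib sum_subtractf mult.commute)
  show ?case
    using Ord(1)[OF Ord(1)[OF taylor chi_diff] rest] unfolding eq .
qed

end

section \<open>Exotic forests as shapes with paired leaves\<close>

definition shape :: "'n ptree list \<Rightarrow> unit ptree list" where
  "shape ts = map (map_ptree (\<lambda>_. ())) ts"

lemma node_at_map: "node_at (map (map_ptree g) ts) v = map_option (map_ptree g) (node_at ts v)"
  by (induction ts v rule: node_at.induct) (auto simp: children_map_ptree)

lemma nodes_map: "nodes (map (map_ptree g) ts) = nodes ts"
  by (simp add: nodes_def node_at_map)

lemma kids_map: "kids (map (map_ptree g) ts) = kids ts"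
  by (simp add: kids_def nodes_map fun_eq_iff)

lemma node_label_map: "node_label (map (map_ptree g) ts) v = map_option g (node_label ts v)"
  by (auto simp: node_label_def node_at_map split: option.split ptree.split)

lemma black_nodes_iff: "v \<in> black_nodes ts \<longleftrightarrow> v \<in> nodes ts \<and> node_label ts v = None"
  by (auto simp: black_nodes_def nodes_def node_label_def split: option.splits ptree.splits)

lemma num_nodes_iff: "v \<in> num_nodes ts \<longleftrightarrow> (\<exists>n. node_label ts v = Some n)"
  by (auto simp: num_nodes_def node_label_def split: option.splits ptree.splits)

lemma node_label_Some: "node_label ts v = Some n \<longleftrightarrow> node_at ts v = Some (Num n)"
  by (auto simp: node_label_def split: option.splits ptree.splits)

lemma num_nodes_subset: "num_nodes ts \<subseteq> nodes ts"
  by (auto simp: num_nodes_def nodes_def)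

lemma black_nodes_subset: "black_nodes ts \<subseteq> nodes ts"
  by (auto simp: black_nodes_def nodes_def)

lemma finite_num_nodes [simp]: "finite (num_nodes ts)" and finite_black_nodes [simp]: "finite (black_nodes ts)"
  using finite_subset[OF num_nodes_subset] finite_subset[OF black_nodes_subset] by auto

lemma nodes_split: "nodes ts = black_nodes ts \<union> num_nodes ts" "black_nodes ts \<inter> num_nodes ts = {}"
proof -
  have "num_nodes ts \<subseteq> nodes ts" by (rule num_nodes_subset)
  then show "nodes ts = black_nodes ts \<union> num_nodes ts"
    by (auto simp: black_nodes_iff num_nodes_iff)
qed (auto simp: black_nodes_iff num_nodes_iff)

lemma black_nodes_shape: "black_nodes (shape ts) = black_nodes ts"
  and num_nodes_shape: "num_nodes (shape ts) = num_nodes ts"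
  and nodes_shape: "nodes (shape ts) = nodes ts"
  and kids_shape: "kids (shape ts) = kids ts"
  by (auto simp: shape_def black_nodes_iff num_nodes_iff nodes_map node_label_map kids_map)

lemma sum_nodes:
  "(\<Sum>v\<in>nodes ts. F v) = (\<Sum>a<length ts. F [a] + (\<Sum>v\<in>nodes (children (ts ! a)). F (a # v)))"
proof -
  have "(\<Sum>v\<in>nodes ts. F v) = (\<Sum>a<length ts. \<Sum>v\<in>insert [a] ((#) a ` nodes (children (ts ! a))). F v)"
    by (subst nodes_eq, rule sum.UNION_disjoint) auto
  also have "\<dots> = (\<Sum>a<length ts. F [a] + (\<Sum>v\<in>nodes (children (ts ! a)). F (a # v)))"
    by (intro sum.cong refl, subst sum.insert) (auto simp: sum.reindex)
  finally show ?thesis .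
qed

fun tree_count :: "('n option \<Rightarrow> nat) \<Rightarrow> 'n ptree \<Rightarrow> nat" where
  "tree_count h (Black ts) = h None + sum_list (map (tree_count h) ts)"
| "tree_count h (Num n) = h (Some n)"

text \<open>The forest step of a nested induction. The tree case is a hypothesis so that the
  induction over trees can supply it for the children.\<close>

lemma sum_nodes_label_aux:
  assumes "\<And>t. t \<in> set ts \<Longrightarrow> tree_count h t = h (case t of Num n \<Rightarrow> Some n | _ \<Rightarrow> None) +
     (\<Sum>v\<in>nodes (children t). h (node_label (children t) v))"
  shows "(\<Sum>v\<in>nodes ts. h (node_label ts v)) = sum_list (map (tree_count h) ts)"
proof -
  have "(\<Sum>v\<in>nodes ts. h (node_label ts v)) = (\<Sum>a<length ts. tree_count h (ts ! a))"
    unfolding sum_nodes[of _ ts]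
  proof (rule sum.cong[OF refl])
    fix a assume a: "a \<in> {..<length ts}"
    have "(\<Sum>v\<in>nodes (children (ts ! a)). h (node_label ts (a # v))) =
        (\<Sum>v\<in>nodes (children (ts ! a)). h (node_label (children (ts ! a)) v))"
      by (rule sum.cong[OF refl]) (use a in \<open>metis Nil_notin_nodes lessThan_iff node_label_Cons\<close>)
    then show "h (node_label ts [a]) + (\<Sum>v\<in>nodes (children (ts ! a)). h (node_label ts (a # v))) =
        tree_count h (ts ! a)"
      using a by (subst assms) (simp_all add: node_label_root)
  qed
  then show ?thesis by (simp add: sum_list_sum_nth lessThan_atLeast0)
qed

lemma sum_nodes_label: "(\<Sum>v\<in>nodes ts. h (node_label ts v)) = sum_list (map (tree_count h) ts)"
proof (rule sum_nodes_label_aux)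
  fix t
  show "tree_count h t = h (case t of Num n \<Rightarrow> Some n | _ \<Rightarrow> None) + (\<Sum>v\<in>nodes (children t). h (node_label
      (children t) v))"
  proof (induction t)
    case (Black ts)
    show ?case using sum_nodes_label_aux[of ts h] Black by simp
  qed simp
qed

lemma forest_degree_card: "forest_degree ts = 2 * card (black_nodes ts) + card (num_nodes ts)"
proof -
  let ?h = "case_option 2 (\<lambda>_. Suc 0)"
  have "tree_degree t = tree_count ?h t" for t :: "'a ptree"
    by (induction t) (simp_all cong: map_cong)
  then have "forest_degree ts = (\<Sum>v\<in>nodes ts. ?h (node_label ts v))"
    by (simp add: forest_degree_def sum_nodes_label cong: map_cong)
  also have "\<dots> = (\<Sum>v\<in>black_nodes ts. ?h (node_label ts v)) + (\<Sum>v\<in>num_nodes ts. ?h (node_label ts v))"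
    unfolding nodes_split(1) by (rule sum.union_disjoint) (simp_all add: nodes_split(2))
  also have "(\<Sum>v\<in>black_nodes ts. ?h (node_label ts v)) = (\<Sum>v\<in>black_nodes ts. 2)"
    by (rule sum.cong) (simp_all add: black_nodes_iff)
  also have "(\<Sum>v\<in>num_nodes ts. ?h (node_label ts v)) = (\<Sum>v\<in>num_nodes ts. 1)"
    by (rule sum.cong) (auto simp: num_nodes_iff)
  finally show ?thesis by simp
qed

text \<open>Connects the list of numbers, on which \<open>is_exotic\<close> is based, with node
  addresses, on which lianas are based.\<close>

lemma count_labels: "count_list (concat (map labels ts)) n = card {v. node_label ts v = Some n}"
proof -
  let ?h = "\<lambda>l. if l = Some n then 1 else 0 :: nat"
  have "count_list (labels t) n = tree_count ?h t" for t
  proof (induction t)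
    case (Black ts)
    have "count_list (concat (map labels ts)) n = sum_list (map (\<lambda>t. count_list (labels t) n) ts)" for ts
        :: "'a ptree list"
      by (induction ts) auto
    then show ?case using Black by (auto intro!: arg_cong[of _ _ sum_list])
  qed auto
  moreover have "count_list (concat (map labels ts)) n = sum_list (map (\<lambda>t. count_list (labels t) n) ts)"
    by (induction ts) auto
  ultimately have "count_list (concat (map labels ts)) n = (\<Sum>v\<in>nodes ts. ?h (node_label ts v))"
    using sum_nodes_label[where h = ?h and ts = ts] by simp
  also have "\<dots> = card {v \<in> nodes ts. node_label ts v = Some n}"
    by (simp add: sum.If_cases Int_def)
  also have "{v \<in> nodes ts. node_label ts v = Some n} = {v. node_label ts v = Some n}"
    using num_nodes_subset[of ts] by (auto simp: num_nodes_iff)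
  finally show ?thesis .
qed

section \<open>Lianas as pairings of the leaves\<close>

definition label_class :: "'n ptree list \<Rightarrow> 'n \<Rightarrow> nat list set" where
  "label_class ts n = {v. node_label ts v = Some n}"

definition label_set :: "'n ptree list \<Rightarrow> 'n set" where
  "label_set ts = {n. \<exists>v. node_label ts v = Some n}"

lemma label_set_eq: "label_set ts = (\<lambda>v. the (node_label ts v)) ` num_nodes ts"
  by (force simp: label_set_def num_nodes_iff)

lemma finite_label_set [simp]: "finite (label_set ts)"
  by (simp add: label_set_eq)

lemma label_set_labels: "label_set ts = (\<Union>t\<in>set ts. set (labels t))"
proof -
  have "n \<in> set (concat (map labels ts)) \<longleftrightarrow> n \<in> label_set ts" for n
  proof -
    have "finite {v. node_label ts v = Some n}"
      by (rule finite_subset[OF _ finite_num_nodes[of ts]]) (auto simp: num_nodes_iff)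
    then have "card {v. node_label ts v = Some n} = 0 \<longleftrightarrow> n \<notin> label_set ts"
      by (auto simp: label_set_def)
    then show ?thesis unfolding count_labels[symmetric] by (metis count_list_0_iff)
  qed
  then show ?thesis by auto
qed

lemma is_exotic_card: "is_exotic ts \<longleftrightarrow> (\<forall>n\<in>label_set ts. n > 0 \<and> card (label_class ts n) = 2)"
proof -
  have "set (concat (map labels ts)) = label_set ts" by (simp add: label_set_labels)
  then show ?thesis unfolding is_exotic_def Let_def count_labels label_class_def by (simp only:)
qed

text \<open>Each number decorates exactly two leaves, so a liana is a full level set of the
  numbering.\<close>

lemma lianas_eq:
  assumes "is_exotic ts" shows "lianas ts = label_class ts ` label_set ts"
proof (intro equalityI subsetI)
  fix e assume "e \<in> lianas ts"
  then obtain v w n where e: "e = {v, w}" "v \<noteq> w" "node_label ts v = Some n" "node_label ts w = Some n"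
    by (auto simp: lianas_def node_label_Some)
  then have n: "n \<in> label_set ts" by (auto simp: label_set_def)
  then have c: "card (label_class ts n) = 2" using assms by (simp add: is_exotic_card)
  have "e \<subseteq> label_class ts n" "card e = 2" using e by (auto simp: label_class_def)
  then have "e = label_class ts n" using c by (intro card_subset_eq) (auto intro: card_ge_0_finite)
  with n show "e \<in> label_class ts ` label_set ts" by blast
next
  fix e assume "e \<in> label_class ts ` label_set ts"
  then obtain n where n: "n \<in> label_set ts" "e = label_class ts n" by blast
  then have "card e = 2" using assms by (simp add: is_exotic_card)
  then obtain v w where "e = {v, w}" "v \<noteq> w" by (auto simp: card_2_iff)
  moreover from this have "node_label ts v = Some n" "node_label ts w = Some n"
    using n(2) by (auto simp: label_class_def)
  ultimately show "e \<in> lianas ts" unfolding lianas_def node_label_Some by blast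
qed

lemma lianas_pairing:
  assumes "is_exotic ts" shows "lianas ts \<in> pairings (num_nodes ts)"
proof -
  have "\<Union>(lianas ts) = num_nodes ts"
    unfolding lianas_eq[OF assms] by (force simp: label_class_def label_set_def num_nodes_iff)
  moreover have "disjoint (lianas ts)"
    unfolding lianas_eq[OF assms] disjoint_def by (auto simp: label_class_def)
  moreover have "\<forall>e\<in>lianas ts. card e = 2"
    using assms unfolding lianas_eq[OF assms] by (simp add: is_exotic_card)
  ultimately show ?thesis by (simp add: pairings_def)
qed

text \<open>Renumberings must be bijections of all natural numbers. The complements of a finite set
  and of its image are both infinite, hence enumerable, and are matched with each other.\<close>

lemma extend_inj_to_bij:
  fixes g :: "nat \<Rightarrow> nat"
  assumes "finite A" "inj_on g A" shows "\<exists>\<sigma>. bij \<sigma> \<and> (\<forall>a\<in>A. \<sigma> a = g a)"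
proof -
  have inf: "infinite (- A)" "infinite (- g ` A)"
    using assms(1) by (auto intro: infinite_UNIV_nat simp: Compl_eq_Diff_UNIV Diff_infinite_finite)
  let ?e1 = "enumerate (- A)" and ?e2 = "enumerate (- g ` A)"
  have "bij_betw ?e1 UNIV (- A)" "bij_betw ?e2 UNIV (- g ` A)" using inf by (auto intro: bij_enumerate)
  then have "bij_betw (?e2 \<circ> the_inv_into UNIV ?e1) (- A) (- g ` A)"
    by (blast intro: bij_betw_trans bij_betw_the_inv_into)
  then obtain h where h: "bij_betw h (- A) (- g ` A)" by blast
  have "bij_betw (\<lambda>x. if x \<in> A then g x else h x) (A \<union> - A) (g ` A \<union> - g ` A)"
    using assms(2) h by (intro bij_betw_disjoint_Un) (auto simp: bij_betw_def)
  then show ?thesis by (intro exI[of _ "\<lambda>x. if x \<in> A then g x else h x"]) simp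
qed

text \<open>The root needs a hypothesis of its own, since the addresses only reach the nodes below
  it.\<close>

lemma tree_eqI:
  "map_ptree (\<lambda>_. ()) t = map_ptree (\<lambda>_. ()) u \<Longrightarrow> (\<And>n. t = Num n \<Longrightarrow> u = Num n) \<Longrightarrow>
    (\<And>v. node_label (children t) v = node_label (children u) v) \<Longrightarrow> t = u"
proof (induction t arbitrary: u)
  case (Black ts)
  then obtain us where u: "u = Black us" by (cases u) auto
  have len: "length ts = length us" using Black.prems(1) u by (auto dest: map_eq_imp_length_eq)
  have "ts ! a = us ! a" if a: "a < length ts" for a
  proof (rule Black.IH)
    show "ts ! a \<in> set ts" using a by simp
    have "map (map_ptree (\<lambda>_. ())) ts = map (map_ptree (\<lambda>_. ())) us" using Black.prems(1) u by simp
    then show "map_ptree (\<lambda>_. ()) (ts ! a) = map_ptree (\<lambda>_. ()) (us ! a)" using a len by (metis nth_map)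
    show "us ! a = Num n" if "ts ! a = Num n" for n
      using Black.prems(3)[of "[a]"] a len that u by (auto simp: node_label_root split: ptree.splits)
    show "node_label (children (ts ! a)) v = node_label (children (us ! a)) v" for v
    proof (cases "v = []")
      case False
      then show ?thesis using Black.prems(3)[of "a # v"] a len u by (simp add: node_label_Cons)
    qed (simp add: node_label_def)
  qed
  then show ?case using u len by (simp add: list_eq_iff_nth_eq)
qed auto

lemma forest_eqI:
  assumes "shape ts = shape us" "\<And>v. node_label ts v = node_label us v" shows "ts = us"
  using tree_eqI[of "Black ts" "Black us"] assms by (simp add: shape_def)

lemma node_label_Nil: "node_label [] v = None"
  by (cases v) (auto simp: node_label_def node_at_Cons)

text \<open>Sharing a number is expressed through lianas alone, which makes two numberings
  comparable.\<close>

lemma label_eq_iff: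
  assumes "node_label ts v = Some n" "node_label ts w = Some m"
  shows "n = m \<longleftrightarrow> v = w \<or> {v, w} \<in> lianas ts"
proof
  assume "n = m"
  then show "v = w \<or> {v, w} \<in> lianas ts" using assms unfolding lianas_def node_label_Some by blast
next
  assume "v = w \<or> {v, w} \<in> lianas ts"
  then show "n = m"
  proof
    assume "{v, w} \<in> lianas ts"
    then obtain v' w' k where "{v, w} = {v', w'}" "node_label ts v' = Some k" "node_label ts w' = Some k"
      unfolding lianas_def node_label_Some by blast
    then show ?thesis using assms by (auto simp: doubleton_eq_iff)
  qed (use assms in simp)
qed

lemma node_label_renumber: "node_label (renumber \<sigma> ts) v = map_option \<sigma> (node_label ts v)"
  by (simp add: renumber_def node_label_map)

lemma shape_renumber: "shape (renumber \<sigma> ts) = shape ts"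
  by (simp add: shape_def renumber_def ptree.map_comp comp_def)

text \<open>Equal lianas mean that the two numberings have the same level sets on the same leaves.
  Hence one is obtained from the other by an injective map on the finitely many numbers used, which
  extends to a bijection.\<close>

lemma exotic_inj:
  assumes ex: "is_exotic ts" "is_exotic us" and sh: "shape ts = shape us" and li: "lianas ts = lianas us"
  shows "same_exotic ts us"
proof -
  have N: "num_nodes us = num_nodes ts" using sh num_nodes_shape by metis
  \<comment> \<open>The number in \<open>us\<close> of any leaf numbered \<open>n\<close> in
    \<open>ts\<close>; equality of the lianas makes the choice of the leaf irrelevant.\<close>
  define g where "g n = the (node_label us (SOME v. node_label ts v = Some n))" for n
  have g: "node_label us v = Some (g n)" if n: "node_label ts v = Some n" for v n
  proof -
    define v' where "v' = (SOME v. node_label ts v = Some n)"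
    have v': "node_label ts v' = Some n" unfolding v'_def using n by (rule someI)
    obtain k where k: "node_label us v = Some k" using n N num_nodes_iff[of v ts] num_nodes_iff[of v us] by auto
    obtain k' where k': "node_label us v' = Some k'" using v' N num_nodes_iff[of v' ts] num_nodes_iff[of
        v' us] by auto
    have "k = k'" using label_eq_iff[OF k k'] label_eq_iff[OF n v'] li by simp
    then show ?thesis using k k' by (simp add: g_def v'_def[symmetric])
  qed
  have "inj_on g (label_set ts)"
  proof (rule inj_onI)
    fix n m assume "n \<in> label_set ts" "m \<in> label_set ts" and eq: "g n = g m"
    then obtain v w where v: "node_label ts v = Some n" and w: "node_label ts w = Some m"
      by (auto simp: label_set_def)
    show "n = m" using label_eq_iff[OF v w] label_eq_iff[OF g[OF v] g[OF w]] eq li by simp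
  qed
  then obtain \<sigma> where \<sigma>: "bij \<sigma>" "\<And>n. n \<in> label_set ts \<Longrightarrow> \<sigma> n = g n"
    using extend_inj_to_bij[OF finite_label_set] by blast
  have "us = renumber \<sigma> ts"
  proof (rule forest_eqI)
    show "shape us = shape (renumber \<sigma> ts)" by (simp add: shape_renumber sh)
    fix v show "node_label us v = node_label (renumber \<sigma> ts) v"
    proof (cases "node_label ts v")
      case None
      then show ?thesis using N num_nodes_iff[of v us] num_nodes_iff[of v ts]
        by (cases "node_label us v") (auto simp: node_label_renumber)
    next
      case (Some n)
      then have "n \<in> label_set ts" by (auto simp: label_set_def)
      then show ?thesis using g[OF Some] Some by (simp add: node_label_renumber \<sigma>)
    qed
  qed
  then show ?thesis using ex \<sigma>(1) unfolding same_exotic_def by blast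
qed

text \<open>Every leaf receives the value of \<open>g\<close> at its address. \<open>g\<close>
  varies in the induction because addresses are shifted below each root.\<close>

lemma relabel_tree:
  fixes s :: "unit ptree" and g :: "nat list \<Rightarrow> 'n"
  shows "\<exists>t. map_ptree (\<lambda>_. ()) t = s \<and> (\<forall>n. t = Num n \<longrightarrow> n = g []) \<and>
    (\<forall>v n. node_label (children t) v = Some n \<longrightarrow> n = g v)"
proof (induction s arbitrary: g)
  case (Black ss)
  have "\<forall>a\<in>{..<length ss}. \<exists>t. map_ptree (\<lambda>_. ()) t = ss ! a \<and> (\<forall>n. t = Num n \<longrightarrow> n = g [a]) \<and>
    (\<forall>v n. node_label (children t) v = Some n \<longrightarrow> n = g (a # v))"
  proof
    fix a assume "a \<in> {..<length ss}"
    then show "\<exists>t. map_ptree (\<lambda>_. ()) t = ss ! a \<and> (\<forall>n. t = Num n \<longrightarrow> n = g [a]) \<and>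
      (\<forall>v n. node_label (children t) v = Some n \<longrightarrow> n = g (a # v))"
      using Black[of "ss ! a" "\<lambda>v. g (a # v)"] by simp
  qed
  from bchoice[OF this] obtain tt where tt: "\<forall>a\<in>{..<length ss}. map_ptree (\<lambda>_. ()) (tt a) = ss ! a \<and>
    (\<forall>n. tt a = Num n \<longrightarrow> n = g [a]) \<and> (\<forall>v n. node_label (children (tt a)) v = Some n \<longrightarrow> n = g (a # v))"
    by (rule exE)
  let ?ts = "map tt [0..<length ss]"
  have "map_ptree (\<lambda>_. ()) (Black ?ts) = Black ss"
    using tt by (auto intro!: nth_equalityI)
  moreover have "n = g v" if v: "node_label ?ts v = Some n" for v n
  proof -
    obtain a w where aw: "v = a # w" "a < length ss"
      using v by (cases v) (auto simp: node_label_def node_at_Cons split: if_splits)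
    show ?thesis
    proof (cases "w = []")
      case True
      then have "tt a = Num n" using v aw by (auto simp: node_label_root split: ptree.splits)
      then show ?thesis using tt aw True by auto
    next
      case False
      then have "node_label (children (tt a)) w = Some n" using v aw by (simp add: node_label_Cons)
      then show ?thesis using tt aw by auto
    qed
  qed
  ultimately show ?case by (intro exI[of _ "Black ?ts"]) simp
next
  case (Num u)
  show ?case by (intro exI[of _ "Num (g [])"]) (simp add: node_label_Nil)
qed

text \<open>The pairs are numbered injectively and each leaf receives the number of its pair; the
  successor keeps the numbers positive.\<close>

lemma exotic_surj:
  assumes P: "P \<in> pairings (num_nodes sh)"
  shows "\<exists>ts. is_exotic ts \<and> shape ts = sh \<and> lianas ts = P"
proof -
  let ?N = "num_nodes sh"
  have U: "\<Union>P = ?N" and D: "\<forall>a\<in>P. \<forall>b\<in>P. a \<noteq> b \<longrightarrow> a \<inter> b = {}" and C: "\<forall>e\<in>P. card e = 2"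
    using P by (simp_all add: pairings_def disjoint_def)
  obtain idx :: "nat list set \<Rightarrow> nat" where idx: "inj_on idx P"
    using finite_imp_inj_to_nat_seg[OF finite_pairing[OF finite_num_nodes P]] by blast
  define e where "e v = (SOME a. a \<in> P \<and> v \<in> a)" for v
  have e: "e v \<in> P" "v \<in> e v" if "v \<in> ?N" for v
  proof -
    have "\<exists>a. a \<in> P \<and> v \<in> a" using that U by blast
    from someI_ex[OF this] show "e v \<in> P" "v \<in> e v" by (simp_all add: e_def)
  qed
  have e_unique: "e v = a" if "a \<in> P" "v \<in> a" for a v
  proof -
    have "v \<in> ?N" using that U by blast
    from e[OF this] have "e v \<in> P" "e v \<inter> a \<noteq> {}" using that by auto
    with D that(1) show ?thesis by metis
  qed
  obtain t where t: "map_ptree (\<lambda>_. ()) t = Black sh" "\<And>v n. node_label (children t) v = Some n \<Longrightarrow> n = Suc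
      (idx (e v))"
    using relabel_tree[of "Black sh" "\<lambda>v. Suc (idx (e v))"] by blast
  define ts where "ts = children t"
  have "t = Black ts" using t(1) by (cases t) (auto simp: ts_def)
  then have sh: "shape ts = sh" using t(1) by (simp add: shape_def)
  have lab: "node_label ts v = Some n \<longleftrightarrow> v \<in> ?N \<and> n = Suc (idx (e v))" for v n
    using t(2)[of v n] t(2)[of v] num_nodes_iff[of v ts] num_nodes_shape[of ts] sh by (auto simp: ts_def)
  have cls: "label_class ts (Suc (idx a)) = a" if "a \<in> P" for a
  proof (intro equalityI subsetI)
    fix v assume "v \<in> label_class ts (Suc (idx a))"
    then have "v \<in> ?N" "idx a = idx (e v)" by (simp_all add: label_class_def lab)
    then show "v \<in> a" using e[of v] idx that by (auto dest: inj_onD)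
  next
    fix v assume "v \<in> a"
    then show "v \<in> label_class ts (Suc (idx a))"
      using e_unique[OF that] that U by (auto simp: label_class_def lab)
  qed
  have ls: "label_set ts = (\<lambda>a. Suc (idx a)) ` P"
  proof (intro equalityI subsetI)
    fix n assume "n \<in> label_set ts"
    then show "n \<in> (\<lambda>a. Suc (idx a)) ` P" using e(1) by (auto simp: label_set_def lab)
  next
    fix n assume "n \<in> (\<lambda>a. Suc (idx a)) ` P"
    then obtain a where a: "a \<in> P" "n = Suc (idx a)" by blast
    then have "card a = 2" using C by blast
    then obtain v where "v \<in> a" by fastforce
    then show "n \<in> label_set ts" using cls[OF a(1)] a(2) by (auto simp: label_set_def label_class_def)
  qed
  have ex: "is_exotic ts" unfolding is_exotic_card ls using cls C by auto
  moreover have "lianas ts = P" unfolding lianas_eq[OF ex] ls using cls by (force simp: image_image)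
  ultimately show ?thesis using sh by blast
qed

lemma same_exotic_refl: "same_exotic ts ts \<longleftrightarrow> is_exotic ts"
  by (auto simp: same_exotic_def renumber_id intro!: exI[of _ id])

lemma exotic_rep: "is_exotic (rep_exotic_forest \<pi>)" and exotic_abs_rep: "abs_exotic_forest
    (rep_exotic_forest \<pi>) = \<pi>"
  using Quotient_rep_reflp[OF Quotient_exotic_forest, of \<pi>] Quotient_abs_rep[OF Quotient_exotic_forest, of \<pi>]
  by (simp_all add: same_exotic_refl)

lemma exotic_abs_eq: "same_exotic ts us \<Longrightarrow> abs_exotic_forest ts = abs_exotic_forest us"
  using Quotient_rel[OF Quotient_exotic_forest, of ts us] by (simp add: same_exotic_refl same_exotic_def)

lemma same_exotic_rep_abs: "is_exotic ts \<Longrightarrow> same_exotic (rep_exotic_forest (abs_exotic_forest ts)) ts"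
  using rep_abs_rsp_left[OF Quotient3_exotic_forest, of ts ts] by (simp add: same_exotic_refl)

text \<open>The division by two in \<open>forest_order\<close> is exact, since the numbered leaves
  are paired.\<close>

lemma forest_order_abs:
  assumes "is_exotic ts" shows "forest_degree ts = 2 * forest_order (abs_exotic_forest ts)"
proof -
  have "forest_order (abs_exotic_forest ts) = card (black_nodes ts) + card (num_nodes ts) div 2"
    using assms by (intro forest_order.abs_eq) (simp add: same_exotic_refl)
  moreover have "card (num_nodes ts) = 2 * card (lianas ts)"
    by (rule pairings_even[OF finite_num_nodes lianas_pairing[OF assms]])
  ultimately show ?thesis by (simp add: forest_degree_card)
qed

lemma forest_degree_shape: "forest_degree (shape ts) = forest_degree ts"
  by (simp add: forest_degree_card black_nodes_shape num_nodes_shape)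

text \<open>Uniqueness and existence of a numbering for a given shape and pairing identify exotic
  forests with such pairs. The hypothesis asks that a class is evaluated through its shape and its
  lianas only.\<close>

lemma sum_exotic_forests:
  fixes Q :: "unit ptree list \<Rightarrow> nat list set set \<Rightarrow> real"
  assumes "\<And>ts. is_exotic ts \<Longrightarrow> Y (abs_exotic_forest ts) = Q (shape ts) (lianas ts)"
  shows "(\<Sum>\<pi> | forest_order \<pi> = m. Y \<pi>) =
    (\<Sum>sh | forest_degree sh = 2 * m. \<Sum>P\<in>pairings (num_nodes sh). Q sh P)"
proof -
  let ?j = "\<lambda>\<pi>. (shape (rep_exotic_forest \<pi>), lianas (rep_exotic_forest \<pi>))"
  \<comment> \<open>An arbitrary exotic numbering of the shape with the given lianas; only its class
    matters.\<close>
  let ?C = "\<lambda>(sh, P). SOME ts. is_exotic ts \<and> shape ts = sh \<and> lianas ts = P"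
  let ?X = "Sigma {sh. forest_degree sh = 2 * m} (\<lambda>sh. pairings (num_nodes sh))"
  have C: "is_exotic (?C q) \<and> shape (?C q) = fst q \<and> lianas (?C q) = snd q" if "q \<in> ?X" for q
    using that someI_ex[OF exotic_surj[of "snd q" "fst q"]] by (cases q) simp
  have fin: "finite {sh :: unit ptree list. forest_degree sh = 2 * m}"
    by (rule finite_subset[OF _ finite_forests_degree[of "2 * m"]]) auto
  have "(\<Sum>\<pi> | forest_order \<pi> = m. Y \<pi>) = (\<Sum>(sh, P)\<in>?X. Q sh P)"
  proof (rule sum.reindex_bij_witness[where j = ?j and i = "\<lambda>q. abs_exotic_forest (?C q)"], goal_cases)
    case (1 \<pi>)
    let ?ts = "rep_exotic_forest \<pi>"
    have "?j \<pi> \<in> ?X"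
      using 1 forest_order_abs[OF exotic_rep[of \<pi>]] lianas_pairing[OF exotic_rep[of \<pi>]]
      by (simp add: exotic_abs_rep forest_degree_shape num_nodes_shape)
    from C[OF this] have "same_exotic (?C (?j \<pi>)) ?ts"
      by (intro exotic_inj) (simp_all add: exotic_rep)
    from exotic_abs_eq[OF this] show ?case by (simp only: exotic_abs_rep)
  next
    case (2 \<pi>)
    then show ?case using forest_order_abs[OF exotic_rep[of \<pi>]] lianas_pairing[OF exotic_rep[of \<pi>]]
      by (simp add: exotic_abs_rep forest_degree_shape num_nodes_shape)
  next
    case (3 q)
    note Cq = C[OF 3]
    obtain \<sigma> where \<sigma>: "bij \<sigma>" "?C q = renumber \<sigma> (rep_exotic_forest (abs_exotic_forest (?C q)))"
      using same_exotic_rep_abs[OF conjunct1[OF Cq]] unfolding same_exotic_def by (elim conjE exE)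
    have "shape (?C q) = shape (rep_exotic_forest (abs_exotic_forest (?C q)))"
      by (subst \<sigma>(2)) (rule shape_renumber)
    moreover have "lianas (?C q) = lianas (rep_exotic_forest (abs_exotic_forest (?C q)))"
      by (subst \<sigma>(2)) (rule lianas_renumber[OF \<sigma>(1)])
    ultimately show ?case using Cq by (metis prod.collapse)
  next
    case (4 q)
    note Cq = C[OF 4]
    have "2 * forest_order (abs_exotic_forest (?C q)) = forest_degree (fst q)"
      using forest_order_abs[of "?C q"] forest_degree_shape[of "?C q"] Cq by simp
    then show ?case using 4 by auto
  next
    case (5 \<pi>)
    show ?case using assms[OF exotic_rep[of \<pi>]] by (simp add: exotic_abs_rep)
  qed
  also have "\<dots> = (\<Sum>sh | forest_degree sh = 2 * m. \<Sum>P\<in>pairings (num_nodes sh). Q sh P)"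
    by (subst sum.Sigma) (auto simp: fin finite_pairings)
  finally show ?thesis .
qed

section \<open>Coefficients and the shuffle product\<close>

definition noise_coeff :: "ff_tableau \<Rightarrow> nat \<Rightarrow> nat \<Rightarrow> nat \<Rightarrow> real" where
  "noise_coeff T i k l = (if i = 0 then zh T k l else Zh T i k l)"

lemma tab_noise_eq: "tab_noise T x d i k = (\<Sum>l=1..nrv T. noise_coeff T i k l * x d l)"
  by (simp add: tab_noise_def noise_coeff_def noise_final_def noise_stage_def)

text \<open>The roots get the virtual stage \<open>0\<close> of the final update, in accordance with
  \<open>tab_coeff\<close> and \<open>tab_noise\<close>.\<close>

definition parent_stage :: "(nat list \<Rightarrow> nat) \<Rightarrow> nat list \<Rightarrow> nat" where
  "parent_stage i v = (if is_root v then 0 else i (parent v))"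

lemma parent_black:
  assumes "v \<in> nodes ts" "\<not> is_root v" shows "parent v \<in> black_nodes ts"
proof -
  have "v \<noteq> []" using assms by auto
  then have v: "v = parent v @ [last v]" by (simp add: parent_def)
  have "parent v \<noteq> []" using assms(2) by (simp add: is_root_def)
  then have "node_at ts (parent v @ [last v]) \<noteq> None \<Longrightarrow> \<exists>t. node_at ts (parent v) = Some t \<and> children t \<noteq> []"
    by (auto simp: node_at_snoc split: option.splits if_splits)
  moreover have "node_at ts (parent v @ [last v]) \<noteq> None" using assms(1) v by (simp add: nodes_def)
  ultimately obtain t where "node_at ts (parent v) = Some t" "children t \<noteq> []" by blast
  then show ?thesis by (cases t) (auto simp: black_nodes_def)
qed

definition kids_labels :: "nat \<Rightarrow> 'n ptree list \<Rightarrow> (nat list \<Rightarrow> nat) \<Rightarrow> real" where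
  "kids_labels K ts k = label_weight K (map k (kids ts [])) * (\<Prod>v\<in>black_nodes ts. label_weight K (map k
      (kids ts v)))"

lemma distinct_kids: "distinct (kids ts v)"
  by (simp add: kids_def distinct_map inj_on_def)

lemma count_kids:
  assumes "w = [] \<or> w \<in> nodes ts"
  shows "count_list (map k (kids ts w)) c = card {v \<in> nodes ts. parent v = w \<and> k v = c}"
proof -
  have "count_list (map k (kids ts w)) c = length (filter (\<lambda>v. k v = c) (kids ts w))"
    by (induction "kids ts w" arbitrary: w) (auto simp: count_list_eq_length_filter filter_map comp_def
        eq_commute)
  also have "\<dots> = card (set (filter (\<lambda>v. k v = c) (kids ts w)))"
    by (rule distinct_card[symmetric]) (simp add: distinct_kids)
  also have "set (filter (\<lambda>v. k v = c) (kids ts w)) = {v \<in> nodes ts. parent v = w \<and> k v = c}"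
    using set_kids[OF assms] by auto
  finally show ?thesis .
qed

lemma sorted_kids:
  assumes "w = [] \<or> w \<in> nodes ts"
  shows "sorted (map k (kids ts w)) \<longleftrightarrow>
    (\<forall>v\<in>nodes ts. \<forall>v'\<in>nodes ts. parent v = w \<and> parent v' = w \<and> last v' < last v \<longrightarrow> k v' \<le> k v)"
proof -
  obtain n where n: "kids ts w = map (\<lambda>j. w @ [j]) [0..<n]" by (auto simp: kids_def)
  have "sorted (map k (kids ts w)) \<longleftrightarrow> (\<forall>i j. i < j \<longrightarrow> j < n \<longrightarrow> k (w @ [i]) \<le> k (w @ [j]))"
    by (auto simp: n sorted_iff_nth_mono_less)
  also have "\<dots> \<longleftrightarrow> (\<forall>v\<in>set (kids ts w). \<forall>v'\<in>set (kids ts w). last v' < last v \<longrightarrow> k v' \<le> k v)"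
    by (auto simp: n)
  also have "\<dots> \<longleftrightarrow> (\<forall>v\<in>nodes ts. \<forall>v'\<in>nodes ts. parent v = w \<and> parent v' = w \<and> last v' < last v \<longrightarrow> k v' \<le> k v)"
    unfolding set_kids[OF assms] by auto
  finally show ?thesis .
qed

lemma kids_num: "v \<in> num_nodes ts \<Longrightarrow> kids ts v = []"
  by (auto simp: num_nodes_def kids_node)

lemma label_weight_Nil: "label_weight K [] = 1"
  by (simp add: label_weight_def)

text \<open>The monotonicity condition of \<open>Lab\<close> and the factorials in
  \<open>lab_fact\<close> both factor over groups of siblings. Numbered nodes have no children and
  contribute the factor 1, which leaves the black nodes and the virtual root.\<close>

lemma Lab_weight:
  assumes k: "k \<in> nodes ts \<rightarrow>\<^sub>E {1..K}"
  shows "(if k \<in> Lab K ts then 1 / lab_fact K ts k else 0) = kids_labels K ts k"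
proof -
  let ?W = "insert [] (nodes ts)"
  have W: "w = [] \<or> w \<in> nodes ts" if "w \<in> ?W" for w using that by simp
  have lw: "label_weight K (map k (kids ts w)) = (if sorted (map k (kids ts w)) then
      \<Prod>c=1..K. 1 / fact (card {v \<in> nodes ts. parent v = w \<and> k v = c}) else 0)" if "w \<in> ?W" for w
    unfolding label_weight_def by (simp only: count_kids[OF W[OF that]])
  have par: "parent v \<in> ?W" if "v \<in> nodes ts" for v
    using parent_in_nodes[OF that] by (auto simp: is_root_def)
  have Lab: "k \<in> Lab K ts \<longleftrightarrow> (\<forall>w\<in>?W. sorted (map k (kids ts w)))"
  proof -
    have "(\<forall>w\<in>?W. sorted (map k (kids ts w))) \<longleftrightarrow> (\<forall>w\<in>?W. \<forall>v\<in>nodes ts. \<forall>v'\<in>nodes ts.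
        parent v = w \<and> parent v' = w \<and> last v' < last v \<longrightarrow> k v' \<le> k v)"
      by (intro ball_cong refl sorted_kids W)
    also have "\<dots> \<longleftrightarrow> k \<in> Lab K ts"
    proof
      assume A: "\<forall>w\<in>?W. \<forall>v\<in>nodes ts. \<forall>v'\<in>nodes ts. parent v = w \<and> parent v' = w \<and> last v' < last v \<longrightarrow> k v' \<le> k v"
      have "k w \<le> k v" if "v \<in> nodes ts" "w \<in> nodes ts" "parent v = parent w" "last w < last v" for v w
        using bspec[OF A par[OF that(1)]] that by simp
      then show "k \<in> Lab K ts" using k by (simp add: Lab_def)
    qed (simp add: Lab_def)
    finally show ?thesis ..
  qed
  have "(if k \<in> Lab K ts then 1 / lab_fact K ts k else 0) = (\<Prod>w\<in>?W. label_weight K (map k (kids ts w)))"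
  proof (cases "k \<in> Lab K ts")
    case True
    then have "(\<Prod>w\<in>?W. label_weight K (map k (kids ts w))) =
        (\<Prod>w\<in>?W. \<Prod>c=1..K. 1 / fact (card {v \<in> nodes ts. parent v = w \<and> k v = c}))"
      unfolding Lab by (intro prod.cong refl) (subst lw, simp_all, auto)
    then show ?thesis using True by (simp add: lab_fact_def prod_dividef)
  next
    case False
    then obtain w where "w \<in> ?W" "\<not> sorted (map k (kids ts w))" unfolding Lab by blast
    then have "(\<Prod>w\<in>?W. label_weight K (map k (kids ts w))) = 0"
      by (intro prod_zero) (auto simp: label_weight_def)
    then show ?thesis using False by simp
  qed
  also have "\<dots> = label_weight K (map k (kids ts [])) * (\<Prod>w\<in>nodes ts. label_weight K (map k (kids ts w)))"
    by (rule prod.insert) simp_all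
  also have "(\<Prod>w\<in>nodes ts. label_weight K (map k (kids ts w))) = (\<Prod>v\<in>black_nodes ts. label_weight K (map k
      (kids ts v)))"
    by (rule prod.mono_neutral_right) (auto simp: nodes_split(1) kids_num label_weight_Nil)
  finally show ?thesis by (simp add: kids_labels_def)
qed

lemma sum_Lab:
  "(\<Sum>k\<in>Lab K ts. 1 / lab_fact K ts k * h k) = (\<Sum>k\<in>nodes ts \<rightarrow>\<^sub>E {1..K}. kids_labels K ts k * h k)"
proof -
  have "(\<Sum>k\<in>Lab K ts. 1 / lab_fact K ts k * h k) =
      (\<Sum>k\<in>nodes ts \<rightarrow>\<^sub>E {1..K}. (if k \<in> Lab K ts then 1 / lab_fact K ts k else 0) * h k)"
    by (rule sum.mono_neutral_cong_left) (auto simp: Lab_def intro: finite_PiE)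
  then show ?thesis by (simp only: Lab_weight cong: sum.cong)
qed

text \<open>Decorations of all nodes give numbered nodes the dummy stage \<open>0\<close>, whereas
  \<open>ff_coeff\<close> sums over stages of black nodes only; restriction is a bijection between
  the two.\<close>

lemma sum_PiE_extend:
  fixes F :: "('a \<Rightarrow> nat) \<Rightarrow> real"
  assumes "B \<subseteq> A"
  shows "(\<Sum>i\<in>PiE A (\<lambda>v. if v \<in> B then S else {0}). F i) = (\<Sum>i\<in>B \<rightarrow>\<^sub>E S. F (\<lambda>v\<in>A. if v \<in> B then i v else 0))"
proof (rule sum.reindex_bij_witness[where i = "\<lambda>i. \<lambda>v\<in>A. if v \<in> B then i v else 0" and j = "\<lambda>i. restrict i
    B"], goal_cases)
  case (1 i)
  show ?case
  proof
    fix v show "(\<lambda>v\<in>A. if v \<in> B then (restrict i B) v else 0) v = i v"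
      using 1 by (cases "v \<in> A"; cases "v \<in> B") (auto simp: PiE_def extensional_def Pi_def)
  qed
next
  case (2 i) then show ?case using assms by (force simp: PiE_def Pi_def)
next
  case (3 i)
  show ?case
  proof
    fix v show "restrict (\<lambda>v\<in>A. if v \<in> B then i v else 0) B v = i v"
      using 3 assms by (cases "v \<in> B") (auto simp: PiE_def extensional_def)
  qed
next
  case (4 i) then show ?case by (auto simp: PiE_def Pi_def)
next
  case (5 i)
  have "(\<lambda>v\<in>A. if v \<in> B then (restrict i B) v else 0) = i"
  proof
    fix v show "(\<lambda>v\<in>A. if v \<in> B then (restrict i B) v else 0) v = i v"
      using 5 by (cases "v \<in> A"; cases "v \<in> B") (auto simp: PiE_def extensional_def Pi_def)
  qed
  then show ?case by simp
qed

section \<open>Factors from the tableau, the frame and the noise\<close>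

definition stage_weight :: "ff_tableau \<Rightarrow> 'n ptree list \<Rightarrow> (nat list \<Rightarrow> nat) \<Rightarrow> (nat list \<Rightarrow> nat) \<Rightarrow> real" where
  "stage_weight T ts i k = kids_labels (nexp T) ts k * (\<Prod>v\<in>black_nodes ts. tab_coeff T (parent_stage i v)
      (i v) (k v))"

definition word_weight :: "(nat \<Rightarrow> nat list \<Rightarrow> real) \<Rightarrow> (nat list \<Rightarrow> real) \<Rightarrow> 'n ptree list \<Rightarrow> (nat list \<Rightarrow> nat)
    \<Rightarrow> real" where
  "word_weight w w0 ts d = (\<Prod>v\<in>black_nodes ts. w (d v) (map d (kids ts v))) * w0 (map d (kids ts []))"

lemma tree_weight_stages:
  assumes i: "i \<in> black_nodes ts \<rightarrow>\<^sub>E {1..stg T}"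
    and \<sigma>: "\<And>v. v \<in> nodes ts \<Longrightarrow> \<sigma> v = (if v \<in> black_nodes ts then i v else 0, k v, d v)"
  shows "tree_weight (edge_weight T \<nu>) (node_weight (nexp T) w) (0, 0, 0) (kids_weight (nexp T) w0) ts \<sigma> =
    stage_weight T ts i k * word_weight w w0 ts d *
    (\<Prod>v\<in>num_nodes ts. \<nu> (the (node_label ts v)) (d v) (parent_stage i v) (k v))"
proof -
  let ?K = "nexp T"
  have kids: "kids_weight ?K h (map \<sigma> (kids ts v)) = label_weight ?K (map k (kids ts v)) * h (map d (kids
      ts v))"
    if "v = [] \<or> v \<in> nodes ts" for v and h :: "nat list \<Rightarrow> real"
  proof -
    have "map (fst \<circ> snd) (map \<sigma> (kids ts v)) = map k (kids ts v)" "map (snd \<circ> snd) (map \<sigma> (kids ts v)) =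
        map d (kids ts v)"
      using set_kids[OF that] \<sigma> by auto
    then show ?thesis by (simp only: kids_weight_def)
  qed
  have par: "fst (if is_root v then (0, 0, 0) else \<sigma> (parent v)) = parent_stage i v" if "v \<in> nodes ts" for v
    using parent_black[OF that] parent_in_nodes[OF that] \<sigma>[of "parent v"] by (simp add: parent_stage_def)
  have black: "edge_weight T \<nu> (node_label ts v) (if is_root v then (0, 0, 0) else \<sigma> (parent v)) (\<sigma> v) *
      node_weight ?K w (node_label ts v) (\<sigma> v) (map \<sigma> (kids ts v)) =
      tab_coeff T (parent_stage i v) (i v) (k v) * (label_weight ?K (map k (kids ts v)) * w (d v) (map d
          (kids ts v)))"
    if v: "v \<in> black_nodes ts" for v
  proof -
    have n: "v \<in> nodes ts" "node_label ts v = None" using v by (auto simp: black_nodes_iff)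
    show ?thesis using \<sigma>[OF n(1)] v n
      by (simp add: edge_weight_def par node_weight_None kids)
  qed
  have num: "edge_weight T \<nu> (node_label ts v) (if is_root v then (0, 0, 0) else \<sigma> (parent v)) (\<sigma> v) *
      node_weight ?K w (node_label ts v) (\<sigma> v) (map \<sigma> (kids ts v)) =
      \<nu> (the (node_label ts v)) (d v) (parent_stage i v) (k v)"
    if v: "v \<in> num_nodes ts" for v
  proof -
    have n: "v \<in> nodes ts" using v num_nodes_subset by blast
    obtain m where "node_label ts v = Some m" using v by (auto simp: num_nodes_iff)
    then show ?thesis using \<sigma>[OF n] n
      by (simp add: edge_weight_def par node_weight_def)
  qed
  have split: "(\<Prod>v\<in>nodes ts. X v) = (\<Prod>v\<in>black_nodes ts. X v) * (\<Prod>v\<in>num_nodes ts. X v)" for X :: "nat list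
      \<Rightarrow> real"
    unfolding nodes_split(1) by (rule prod.union_disjoint) (simp_all add: nodes_split(2))
  have "(\<Prod>v\<in>nodes ts. edge_weight T \<nu> (node_label ts v) (if is_root v then (0, 0, 0) else \<sigma> (parent v)) (\<sigma> v) *
      node_weight ?K w (node_label ts v) (\<sigma> v) (map \<sigma> (kids ts v))) =
    (\<Prod>v\<in>black_nodes ts. tab_coeff T (parent_stage i v) (i v) (k v) *
      (label_weight ?K (map k (kids ts v)) * w (d v) (map d (kids ts v)))) *
    (\<Prod>v\<in>num_nodes ts. \<nu> (the (node_label ts v)) (d v) (parent_stage i v) (k v))"
    unfolding split by (simp only: black num cong: prod.cong)
  then show ?thesis
    unfolding tree_weight_def kids[OF disjI1[OF refl]]
    by (simp add: prod.distrib stage_weight_def word_weight_def kids_labels_def mult_ac)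
qed

text \<open>The global form of the recursive sum: all randomness sits in one product over the
  leaves, to which Isserlis' formula applies.\<close>

lemma forest_sum_stages:
  "forest_sum T Ds \<nu> w 0 w0 ts =
    (\<Sum>i\<in>black_nodes ts \<rightarrow>\<^sub>E {1..stg T}. \<Sum>k\<in>nodes ts \<rightarrow>\<^sub>E {1..nexp T}. \<Sum>d\<in>nodes ts \<rightarrow>\<^sub>E Ds.
      stage_weight T ts i k * word_weight w w0 ts d *
      (\<Prod>v\<in>num_nodes ts. \<nu> (the (node_label ts v)) (d v) (parent_stage i v) (k v)))"
proof -
  have S: "PiE (nodes ts) (\<lambda>v. node_states T Ds (node_label ts v)) =
     PiE (nodes ts) (\<lambda>v. (if v \<in> black_nodes ts then {1..stg T} else {0}) \<times> {1..nexp T} \<times> Ds)"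
    by (rule PiE_cong) (simp add: node_states_def black_nodes_iff)
  show ?thesis
    unfolding forest_sum_def tree_sum_def S sum_PiE_Times sum_PiE_extend[OF black_nodes_subset]
    by (intro sum.cong refl tree_weight_stages) auto
qed

text \<open>The contribution of one pairing to the mean of a forest term; the sum over
  \<open>l\<close> is the covariance of two paired noise forms of equal direction.\<close>

definition paired_sum :: "ff_tableau \<Rightarrow> nat \<Rightarrow> (nat \<Rightarrow> nat list \<Rightarrow> real) \<Rightarrow> (nat list \<Rightarrow> real) \<Rightarrow>
    unit ptree list \<Rightarrow> nat list set set \<Rightarrow> real" where
  "paired_sum T D w w0 ts P =
    (\<Sum>i\<in>black_nodes ts \<rightarrow>\<^sub>E {1..stg T}. \<Sum>k\<in>nodes ts \<rightarrow>\<^sub>E {1..nexp T}. \<Sum>d\<in>nodes ts \<rightarrow>\<^sub>E {1..D}.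
      stage_weight T ts i k * word_weight w w0 ts d *
      ((if \<exists>v v'. {v, v'} \<in> P \<and> d v \<noteq> d v' then 0 else 1) *
       (\<Prod>e\<in>P. \<Sum>l=1..nrv T. \<Prod>v\<in>e. noise_coeff T (parent_stage i v) (k v) l)))"

section \<open>The coefficient for fixed noise indices\<close>

text \<open>One index \<open>c n\<close> of a random variable is fixed for each liana \<open>n\<close>, which decouples the trees.\<close>

definition unit_forest_sum :: "ff_tableau \<Rightarrow> ('n \<Rightarrow> nat) \<Rightarrow> 'n ptree list \<Rightarrow> real" where
  "unit_forest_sum T c ts = forest_sum T {0} (\<lambda>n d i k. noise_coeff T i k (c n)) (\<lambda>_ _. 1) 0 (\<lambda>_. 1) ts"

lemma unit_forest_sum_stages:
  "unit_forest_sum T c ts = (\<Sum>i\<in>black_nodes ts \<rightarrow>\<^sub>E {1..stg T}. \<Sum>k\<in>nodes ts \<rightarrow>\<^sub>E {1..nexp T}.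
     stage_weight T ts i k * (\<Prod>v\<in>num_nodes ts. noise_coeff T (parent_stage i v) (k v) (c (the (node_label
         ts v)))))"
proof -
  have "card (nodes ts \<rightarrow>\<^sub>E {0 :: nat}) = 1" by (simp add: card_PiE)
  then show ?thesis unfolding unit_forest_sum_def forest_sum_stages by (simp add: word_weight_def)
qed

lemma unit_forest_sum_cong:
  assumes "\<And>n. n \<in> label_set ts \<Longrightarrow> c n = c' n"
  shows "unit_forest_sum T c ts = unit_forest_sum T c' ts"
proof -
  have "(\<Prod>v\<in>num_nodes ts. noise_coeff T (parent_stage i v) (k v) (c (the (node_label ts v)))) =
    (\<Prod>v\<in>num_nodes ts. noise_coeff T (parent_stage i v) (k v) (c' (the (node_label ts v))))" for i k
    by (rule prod.cong[OF refl]) (simp add: assms label_set_eq)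
  then show ?thesis unfolding unit_forest_sum_stages by simp
qed

text \<open>With the noise indices fixed, the letter of a tree depends on this tree alone, and the
  coefficient of the forest is that of a word.\<close>

lemma unit_forest_sum_chi:
  "unit_forest_sum T c ts =
    chi (nexp T) (map (\<lambda>t k. branch_sum T {0} (\<lambda>n d i k. noise_coeff T i k (c n)) (\<lambda>_ _. 1) 0 t k 0) ts)"
proof -
  have "{ds. length ds = length ts \<and> set ds \<subseteq> {0 :: nat}} = {replicate (length ts) 0}"
    by (auto intro: replicate_eqI simp: subset_iff)
  moreover have "map2 (\<lambda>t d k. branch_sum T {0} (\<lambda>n d i k. noise_coeff T i k (c n)) (\<lambda>_ _. 1) 0 t k d) ts
      (replicate (length ts) 0) =
     map (\<lambda>t k. branch_sum T {0} (\<lambda>n d i k. noise_coeff T i k (c n)) (\<lambda>_ _. 1) 0 t k 0) ts"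
    by (rule nth_equalityI) simp_all
  ultimately show ?thesis unfolding unit_forest_sum_def by (subst forest_sum_rec) simp_all
qed

lemma unit_forest_sum_shuffle:
  "(\<Sum>zs\<leftarrow>interleavings ts us. unit_forest_sum T c zs) = unit_forest_sum T c ts * unit_forest_sum T c us"
  unfolding unit_forest_sum_chi chi_shuffle[symmetric] interleavings_map by (simp add: comp_def)

lemma sum_PiE_Un:
  fixes F G :: "('a \<Rightarrow> 'b) \<Rightarrow> real"
  assumes "A \<inter> B = {}"
  shows "(\<Sum>c\<in>(A \<union> B) \<rightarrow>\<^sub>E R. F (restrict c A) * G (restrict c B)) = (\<Sum>c\<in>A \<rightarrow>\<^sub>E R. F c) * (\<Sum>c\<in>B \<rightarrow>\<^sub>E R. G c)"
proof -
  let ?j = "\<lambda>c. (restrict c A, restrict c B)" and ?i = "\<lambda>(c, c'). \<lambda>x\<in>A \<union> B. if x \<in> A then c x else c' x"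
  have "(\<Sum>c\<in>(A \<union> B) \<rightarrow>\<^sub>E R. F (restrict c A) * G (restrict c B)) = (\<Sum>(c, c')\<in>(A \<rightarrow>\<^sub>E R) \<times> (B \<rightarrow>\<^sub>E R). F c * G c')"
  proof (rule sum.reindex_bij_witness[where i = ?i and j = ?j], goal_cases)
    case (1 c) then show ?case by (auto simp: PiE_def extensional_def fun_eq_iff)
  next
    case (2 c) then show ?case by (auto simp: PiE_def Pi_def)
  next
    case (3 c) then show ?case using assms by (auto simp: PiE_def extensional_def fun_eq_iff)
  next
    case (4 c) then show ?case by (auto simp: PiE_def Pi_def)
  qed simp
  then show ?thesis by (simp add: sum_product sum.cartesian_product)
qed

lemma sum_list_sum_swap:
  fixes g :: "'a \<Rightarrow> 'b \<Rightarrow> real"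
  shows "(\<Sum>x\<leftarrow>xs. \<Sum>c\<in>A. g c x) = (\<Sum>c\<in>A. \<Sum>x\<leftarrow>xs. g c x)"
  by (induction xs) (simp_all add: sum.distrib)

text \<open>The maps \<open>\<lambda>n. 2 * n\<close> and \<open>\<lambda>n. 2 * n + 1\<close> that
  make the numbers of two forests disjoint are injective but not bijective, so invariance is
  required for injections.\<close>

lemma lianas_renumber_inj: "inj \<sigma> \<Longrightarrow> lianas (renumber \<sigma> ts) = lianas ts"
proof -
  assume "inj \<sigma>"
  then have "(\<exists>n. node_label (renumber \<sigma> ts) v = Some n \<and> node_label (renumber \<sigma> ts) w = Some n) \<longleftrightarrow>
     (\<exists>n. node_label ts v = Some n \<and> node_label ts w = Some n)" for v w
    by (auto simp: node_label_renumber dest: injD)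
  then show ?thesis unfolding lianas_def node_label_Some[symmetric] by auto
qed

lemma node_at_Nil: "node_at [] v = None"
  by (cases v) (auto simp: node_at_Cons)

lemma lin_ext_superset:
  "finite A \<Longrightarrow> Poly_Mapping.keys x \<subseteq> A \<Longrightarrow> lin_ext a x = (\<Sum>\<pi>\<in>A. Poly_Mapping.lookup x \<pi> * a \<pi>)"
  unfolding lin_ext_def by (rule sum.mono_neutral_left) (auto simp: in_keys_iff)

lemma lin_ext_add: "lin_ext a (x + y) = lin_ext a x + lin_ext a y"
proof -
  let ?A = "Poly_Mapping.keys x \<union> Poly_Mapping.keys y"
  have "Poly_Mapping.keys (x + y) \<subseteq> ?A" by (rule keys_add)
  then show ?thesis
    by (subst (1 2 3) lin_ext_superset[of ?A]) (auto simp: lookup_add distrib_right sum.distrib)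
qed

lemma lin_ext_zero: "lin_ext a 0 = 0"
  by (simp add: lin_ext_def)

lemma lin_ext_sum: "lin_ext a (\<Sum>i\<in>I. g i) = (\<Sum>i\<in>I. lin_ext a (g i))"
  by (induction I rule: infinite_finite_induct) (simp_all add: lin_ext_zero lin_ext_add)

lemma lin_ext_sum_list: "lin_ext a (\<Sum>i\<leftarrow>xs. g i) = (\<Sum>i\<leftarrow>xs. lin_ext a (g i))"
  by (induction xs) (simp_all add: lin_ext_zero lin_ext_add)

lemma lin_ext_single: "lin_ext a (Poly_Mapping.single \<pi> r) = r * a \<pi>"
  by (subst lin_ext_superset[of "{\<pi>}"]) auto

lemma pairings_doubleton:
  assumes "card e = 2" shows "pairings e = {{e}}"
proof (intro equalityI subsetI)
  have fin: "finite e" using assms by (simp add: card_ge_0_finite)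
  fix P assume P: "P \<in> pairings e"
  have "a = e" if "a \<in> P" for a
    using P that assms by (intro card_subset_eq[OF fin]) (auto simp: pairings_def)
  moreover have "P \<noteq> {}" using P assms by (auto simp: pairings_def)
  ultimately show "P \<in> {{e}}" by blast
qed (use assms in \<open>auto simp: pairings_def disjoint_def\<close>)

section \<open>Means of forest terms\<close>

context
  fixes M :: "'w measure" and \<xi> :: "nat \<Rightarrow> nat \<Rightarrow> 'w \<Rightarrow> real" and T :: ff_tableau and D :: nat
  assumes prob: "prob_space M" and D: "D \<ge> 1"
    and gaussian: "\<And>d l. d \<in> {1..D} \<Longrightarrow> l \<in> {1..nrv T} \<Longrightarrow> distributed M lborel (\<xi> d l) std_normal_density"
    and indep: "prob_space.indep_vars M (\<lambda>_. borel) (\<lambda>(d, l). \<xi> d l) ({1..D} \<times> {1..nrv T})"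
begin

abbreviation (input) "noise_indices \<equiv> {1..D} \<times> {1..nrv T}"

lemma gaussian': "b \<in> noise_indices \<Longrightarrow> distributed M lborel ((\<lambda>(d, l). \<xi> d l) b) std_normal_density"
  using gaussian by auto

lemma finite_noise_indices: "finite noise_indices" by simp

text \<open>A coefficient vector over all noise variables at once, supported on one direction; this
  brings the noise into the form of Isserlis' formula.\<close>

definition noise_form :: "nat \<Rightarrow> nat \<Rightarrow> nat \<Rightarrow> nat \<times> nat \<Rightarrow> real" where
  "noise_form d i k b = (if fst b = d then noise_coeff T i k (snd b) else 0)"

lemma tab_noise_form:
  assumes "d \<in> {1..D}"
  shows "tab_noise T (\<lambda>d l. \<xi> d l \<omega>) d i k = (\<Sum>b\<in>noise_indices. noise_form d i k b * (\<lambda>(d, l). \<xi> d l) b \<omega>)"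
proof -
  have "(\<Sum>b\<in>noise_indices. noise_form d i k b * (\<lambda>(d, l). \<xi> d l) b \<omega>) =
     (\<Sum>d'=1..D. \<Sum>l=1..nrv T. if d' = d then noise_coeff T i k l * \<xi> d' l \<omega> else 0)"
    unfolding sum.cartesian_product by (intro sum.cong refl) (auto simp: noise_form_def)
  also have "\<dots> = (\<Sum>d'=1..D. if d' = d then (\<Sum>l=1..nrv T. noise_coeff T i k l * \<xi> d l \<omega>) else 0)"
    by (intro sum.cong refl) auto
  also have "\<dots> = (\<Sum>l=1..nrv T. noise_coeff T i k l * \<xi> d l \<omega>)"
    using assms by (simp add: sum.delta)
  finally show ?thesis by (simp add: tab_noise_eq)
qed

text \<open>Noise forms of different directions have disjoint supports, so their scalar product
  vanishes. This is the origin of the delta in the elementary differential.\<close>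

lemma noise_pair:
  assumes "card e = 2" "\<And>v. v \<in> e \<Longrightarrow> d v \<in> {1..D}"
  shows "(\<Sum>b\<in>noise_indices. \<Prod>v\<in>e. noise_form (d v) (i v) (k v) b) =
    (if \<exists>v v'. e = {v, v'} \<and> d v \<noteq> d v' then 0 else \<Sum>l=1..nrv T. \<Prod>v\<in>e. noise_coeff T (i v) (k v) l)"
proof -
  obtain v v' where e: "e = {v, v'}" "v \<noteq> v'" using assms(1) by (auto simp: card_2_iff)
  have "(\<Sum>b\<in>noise_indices. \<Prod>v\<in>e. noise_form (d v) (i v) (k v) b) =
     (\<Sum>d'=1..D. \<Sum>l=1..nrv T. if d' = d v then if d v = d v' then noise_coeff T (i v) (k v) l * noise_coeff
         T (i v') (k v') l else 0 else 0)"
    unfolding sum.cartesian_product using e by (intro sum.cong refl) (auto simp: noise_form_def)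
  also have "\<dots> = (\<Sum>d'=1..D. if d' = d v then if d v = d v' then \<Sum>l=1..nrv T. noise_coeff T (i v) (k v) l *
      noise_coeff T (i v') (k v') l else 0 else 0)"
    by (intro sum.cong refl) auto
  also have "\<dots> = (if d v = d v' then \<Sum>l=1..nrv T. noise_coeff T (i v) (k v) l * noise_coeff T (i v') (k
      v') l else 0)"
    using assms(2)[of v] e by (subst sum.delta) auto
  also have "\<dots> = (if \<exists>v v'. e = {v, v'} \<and> d v \<noteq> d v' then 0 else \<Sum>l=1..nrv T. \<Prod>v\<in>e. noise_coeff T (i v) (k
      v) l)"
    using e by (auto simp: doubleton_eq_iff)
  finally show ?thesis .
qed

lemma integrable_noise_prod:
  assumes "finite V" "\<And>v. v \<in> V \<Longrightarrow> d v \<in> {1..D}"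
  shows "integrable M (\<lambda>\<omega>. \<Prod>v\<in>V. tab_noise T (\<lambda>d l. \<xi> d l \<omega>) (d v) (i v) (k v))"
proof -
  have "(\<lambda>\<omega>. \<Prod>v\<in>V. tab_noise T (\<lambda>d l. \<xi> d l \<omega>) (d v) (i v) (k v)) =
     (\<lambda>\<omega>. \<Prod>v\<in>V. \<Sum>b\<in>noise_indices. noise_form (d v) (i v) (k v) b * (\<lambda>(d, l). \<xi> d l) b \<omega>)"
    by (intro ext prod.cong refl tab_noise_form assms(2))
  then show ?thesis
    using gaussian_linear_forms(1)[OF prob finite_noise_indices gaussian' indep assms(1)] by simp
qed

text \<open>Isserlis' formula with these covariances. The deltas of the single pairs combine into
  one condition on the whole pairing.\<close>

lemma integral_noise_prod:
  assumes V: "finite V" and d: "\<And>v. v \<in> V \<Longrightarrow> d v \<in> {1..D}"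
  shows "(\<integral>\<omega>. (\<Prod>v\<in>V. tab_noise T (\<lambda>d l. \<xi> d l \<omega>) (d v) (i v) (k v)) \<partial>M) =
    (\<Sum>P\<in>pairings V. (if \<exists>v v'. {v, v'} \<in> P \<and> d v \<noteq> d v' then 0 else 1) *
       (\<Prod>e\<in>P. \<Sum>l=1..nrv T. \<Prod>v\<in>e. noise_coeff T (i v) (k v) l))"
proof -
  have "(\<lambda>\<omega>. \<Prod>v\<in>V. tab_noise T (\<lambda>d l. \<xi> d l \<omega>) (d v) (i v) (k v)) =
     (\<lambda>\<omega>. \<Prod>v\<in>V. \<Sum>b\<in>noise_indices. noise_form (d v) (i v) (k v) b * (\<lambda>(d, l). \<xi> d l) b \<omega>)"
    by (intro ext prod.cong refl tab_noise_form d)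
  then have "(\<integral>\<omega>. (\<Prod>v\<in>V. tab_noise T (\<lambda>d l. \<xi> d l \<omega>) (d v) (i v) (k v)) \<partial>M) =
     (\<Sum>P\<in>pairings V. \<Prod>e\<in>P. \<Sum>b\<in>noise_indices. \<Prod>v\<in>e. noise_form (d v) (i v) (k v) b)"
    using isserlis[OF prob finite_noise_indices gaussian' indep V] by simp
  also have "\<dots> = (\<Sum>P\<in>pairings V. (if \<exists>v v'. {v, v'} \<in> P \<and> d v \<noteq> d v' then 0 else 1) *
       (\<Prod>e\<in>P. \<Sum>l=1..nrv T. \<Prod>v\<in>e. noise_coeff T (i v) (k v) l))"
  proof (rule sum.cong[OF refl])
    fix P assume P: "P \<in> pairings V"
    have e: "card e = 2" "\<And>v. v \<in> e \<Longrightarrow> d v \<in> {1..D}" if "e \<in> P" for e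
      using P that d by (auto simp: pairings_def)
    have "(\<Prod>e\<in>P. \<Sum>b\<in>noise_indices. \<Prod>v\<in>e. noise_form (d v) (i v) (k v) b) =
      (\<Prod>e\<in>P. if \<exists>v v'. e = {v, v'} \<and> d v \<noteq> d v' then 0 else \<Sum>l=1..nrv T. \<Prod>v\<in>e. noise_coeff T (i v) (k v) l)"
      by (rule prod.cong[OF refl]) (rule noise_pair[OF e])
    also have "\<dots> = (if \<exists>v v'. {v, v'} \<in> P \<and> d v \<noteq> d v' then 0 else 1) *
       (\<Prod>e\<in>P. \<Sum>l=1..nrv T. \<Prod>v\<in>e. noise_coeff T (i v) (k v) l)"
    proof (cases "\<exists>v v'. {v, v'} \<in> P \<and> d v \<noteq> d v'")
      case True
      then show ?thesis using finite_pairing[OF V P] by (auto intro!: prod_zero)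
    next
      case False
      then show ?thesis by (auto intro!: prod.cong)
    qed
    finally show "(\<Prod>e\<in>P. \<Sum>b\<in>noise_indices. \<Prod>v\<in>e. noise_form (d v) (i v) (k v) b) = \<dots>" .
  qed
  finally show ?thesis .
qed

lemma integrable_forest_sum:
  "integrable M (\<lambda>\<omega>. forest_sum T {1..D} (\<lambda>_::unit. tab_noise T (\<lambda>d l. \<xi> d l \<omega>)) w 0 w0 ts)"
  unfolding forest_sum_stages
proof (intro Bochner_Integration.integrable_sum integrable_mult_right integrable_noise_prod finite_num_nodes)
  fix d v assume "d \<in> nodes ts \<rightarrow>\<^sub>E {1..D}" "v \<in> num_nodes ts"
  then show "d v \<in> {1..D}" using num_nodes_subset by (blast intro: PiE_mem)
qed

lemma integral_forest_sum:
  "(\<integral>\<omega>. forest_sum T {1..D} (\<lambda>_::unit. tab_noise T (\<lambda>d l. \<xi> d l \<omega>)) w 0 w0 ts \<partial>M) =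
    (\<Sum>P\<in>pairings (num_nodes ts). paired_sum T D w w0 ts P)"
proof -
  have d: "d v \<in> {1..D}" if "d \<in> nodes ts \<rightarrow>\<^sub>E {1..D}" "v \<in> num_nodes ts" for d v
    using PiE_mem[OF that(1)] num_nodes_subset that(2) by blast
  have int: "integrable M (\<lambda>\<omega>. \<Prod>v\<in>num_nodes ts. tab_noise T (\<lambda>d l. \<xi> d l \<omega>) (d v) (parent_stage i v) (k v))"
    if "d \<in> nodes ts \<rightarrow>\<^sub>E {1..D}" for d i k
    by (intro integrable_noise_prod d that) simp_all
  have "(\<integral>\<omega>. forest_sum T {1..D} (\<lambda>_::unit. tab_noise T (\<lambda>d l. \<xi> d l \<omega>)) w 0 w0 ts \<partial>M) =
    (\<Sum>i\<in>black_nodes ts \<rightarrow>\<^sub>E {1..stg T}. \<Sum>k\<in>nodes ts \<rightarrow>\<^sub>E {1..nexp T}. \<Sum>d\<in>nodes ts \<rightarrow>\<^sub>E {1..D}.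
      stage_weight T ts i k * word_weight w w0 ts d *
      (\<integral>\<omega>. (\<Prod>v\<in>num_nodes ts. tab_noise T (\<lambda>d l. \<xi> d l \<omega>) (d v) (parent_stage i v) (k v)) \<partial>M))"
    unfolding forest_sum_stages
    by (subst Bochner_Integration.integral_sum, (intro Bochner_Integration.integrable_sum
        integrable_mult_right int, assumption),
        rule sum.cong[OF refl])+ simp
  also have "\<dots> = (\<Sum>i\<in>black_nodes ts \<rightarrow>\<^sub>E {1..stg T}. \<Sum>k\<in>nodes ts \<rightarrow>\<^sub>E {1..nexp T}. \<Sum>d\<in>nodes ts \<rightarrow>\<^sub>E {1..D}.
      \<Sum>P\<in>pairings (num_nodes ts). stage_weight T ts i k * word_weight w w0 ts d *
      ((if \<exists>v v'. {v, v'} \<in> P \<and> d v \<noteq> d v' then 0 else 1) *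
       (\<Prod>e\<in>P. \<Sum>l=1..nrv T. \<Prod>v\<in>e. noise_coeff T (parent_stage i v) (k v) l)))"
    unfolding sum_distrib_left[symmetric]
    by (intro sum.cong refl, subst integral_noise_prod) (auto intro: d simp del: One_nat_def atLeastAtMost_iff)
  also have "\<dots> = (\<Sum>P\<in>pairings (num_nodes ts). paired_sum T D w w0 ts P)"
    unfolding paired_sum_def
    by (simp only: sum.swap[of _ "pairings (num_nodes ts)"])
  finally show ?thesis .
qed

text \<open>A set of two leaves has a single pairing, so Isserlis' formula gives the covariance.
  Direction \<open>1\<close> is among those of the noise because \<open>D \<ge> 1\<close>.\<close>

lemma liana_integral:
  assumes e: "e \<in> lianas ts" and ex: "is_exotic ts" and i: "i \<in> black_nodes ts \<rightarrow>\<^sub>E {1..stg T}"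
  shows "(\<integral>\<omega>. (\<Prod>v \<in> {v \<in> e. \<not> is_root v}. noise_stage T (\<lambda>d l. \<xi> d l \<omega>) 1 (i (parent v)) (k v)) *
           (\<Prod>r \<in> {r \<in> e. is_root r}. noise_final T (\<lambda>d l. \<xi> d l \<omega>) 1 (k r)) \<partial>M) =
    (\<Sum>l=1..nrv T. \<Prod>v\<in>e. noise_coeff T (parent_stage i v) (k v) l)"
proof -
  have e2: "card e = 2" "e \<subseteq> num_nodes ts"
    using lianas_pairing[OF ex] e by (auto simp: pairings_def)
  then have fin: "finite e" by (simp add: card_ge_0_finite)
  \<comment> \<open>Stage \<open>0\<close> is reserved for the final update. A parent inside the
    forest is black and has a positive stage, so \<open>tab_noise\<close> selects the stage
    noise.\<close>
  have nz: "i (parent v) \<noteq> 0" if "v \<in> e" "\<not> is_root v" for v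
  proof -
    have "parent v \<in> black_nodes ts" using that e2 num_nodes_subset by (intro parent_black) auto
    from PiE_mem[OF i this] show ?thesis by simp
  qed
  have "(\<Prod>v \<in> {v \<in> e. \<not> is_root v}. noise_stage T (\<lambda>d l. \<xi> d l \<omega>) 1 (i (parent v)) (k v)) *
           (\<Prod>r \<in> {r \<in> e. is_root r}. noise_final T (\<lambda>d l. \<xi> d l \<omega>) 1 (k r)) =
     (\<Prod>v\<in>e. tab_noise T (\<lambda>d l. \<xi> d l \<omega>) 1 (parent_stage i v) (k v))" for \<omega>
  proof -
    have "(\<Prod>v\<in>e. tab_noise T (\<lambda>d l. \<xi> d l \<omega>) 1 (parent_stage i v) (k v)) =
      (\<Prod>v\<in>{v \<in> e. \<not> is_root v} \<union> {r \<in> e. is_root r}. tab_noise T (\<lambda>d l. \<xi> d l \<omega>) 1 (parent_stage i v) (k v))"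
      by (rule prod.cong) auto
    also have "\<dots> = (\<Prod>v \<in> {v \<in> e. \<not> is_root v}. noise_stage T (\<lambda>d l. \<xi> d l \<omega>) 1 (i (parent v)) (k v)) *
           (\<Prod>r \<in> {r \<in> e. is_root r}. noise_final T (\<lambda>d l. \<xi> d l \<omega>) 1 (k r))"
    proof -
      have "(\<Prod>v\<in>{v \<in> e. \<not> is_root v}. tab_noise T (\<lambda>d l. \<xi> d l \<omega>) 1 (parent_stage i v) (k v)) =
         (\<Prod>v \<in> {v \<in> e. \<not> is_root v}. noise_stage T (\<lambda>d l. \<xi> d l \<omega>) 1 (i (parent v)) (k v))"
        by (rule prod.cong[OF refl]) (simp add: tab_noise_def parent_stage_def nz)
      moreover have "(\<Prod>v\<in>{r \<in> e. is_root r}. tab_noise T (\<lambda>d l. \<xi> d l \<omega>) 1 (parent_stage i v) (k v)) =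
         (\<Prod>r \<in> {r \<in> e. is_root r}. noise_final T (\<lambda>d l. \<xi> d l \<omega>) 1 (k r))"
        by (rule prod.cong[OF refl]) (simp add: tab_noise_def parent_stage_def)
      ultimately show ?thesis using fin by (subst prod.union_disjoint) auto
    qed
    finally show ?thesis ..
  qed
  then show ?thesis
    using integral_noise_prod[OF fin, of "\<lambda>_. 1" "parent_stage i" k] D by (simp add: pairings_doubleton[OF
        e2(1)])
qed

text \<open>Translates the coefficient, defined with separate factors for roots and other nodes,
  into the form with virtual stage \<open>0\<close> and explicit covariances.\<close>

lemma ff_coeff_stages:
  assumes ex: "is_exotic ts"
  shows "ff_coeff M \<xi> T (abs_exotic_forest ts) =
    (\<Sum>i\<in>black_nodes ts \<rightarrow>\<^sub>E {1..stg T}. \<Sum>k\<in>nodes ts \<rightarrow>\<^sub>E {1..nexp T}. stage_weight T ts i k *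
       (\<Prod>e\<in>lianas ts. \<Sum>l=1..nrv T. \<Prod>v\<in>e. noise_coeff T (parent_stage i v) (k v) l))"
proof -
  have coeff: "(\<Prod>v \<in> {v \<in> black_nodes ts. \<not> is_root v}. Zi T (i (parent v)) (i v) (k v)) *
        (\<Prod>r \<in> {r \<in> black_nodes ts. is_root r}. zf T (i r) (k r)) =
     (\<Prod>v\<in>black_nodes ts. tab_coeff T (parent_stage i v) (i v) (k v))"
    if i: "i \<in> black_nodes ts \<rightarrow>\<^sub>E {1..stg T}" for i k
  proof -
    have nz: "i (parent v) \<noteq> 0" if "v \<in> black_nodes ts" "\<not> is_root v" for v
    proof -
      have "parent v \<in> black_nodes ts" using that black_nodes_subset by (intro parent_black) auto
      from PiE_mem[OF i this] show ?thesis by simp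
    qed
    have "(\<Prod>v\<in>black_nodes ts. tab_coeff T (parent_stage i v) (i v) (k v)) =
      (\<Prod>v\<in>{v \<in> black_nodes ts. \<not> is_root v} \<union> {r \<in> black_nodes ts. is_root r}. tab_coeff T (parent_stage i
          v) (i v) (k v))"
      by (rule prod.cong) auto
    also have "\<dots> = (\<Prod>v \<in> {v \<in> black_nodes ts. \<not> is_root v}. Zi T (i (parent v)) (i v) (k v)) *
        (\<Prod>r \<in> {r \<in> black_nodes ts. is_root r}. zf T (i r) (k r))"
    proof -
      have "(\<Prod>v\<in>{v \<in> black_nodes ts. \<not> is_root v}. tab_coeff T (parent_stage i v) (i v) (k v)) =
         (\<Prod>v \<in> {v \<in> black_nodes ts. \<not> is_root v}. Zi T (i (parent v)) (i v) (k v))"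
        by (rule prod.cong[OF refl]) (simp add: tab_coeff_def parent_stage_def nz)
      moreover have "(\<Prod>v\<in>{r \<in> black_nodes ts. is_root r}. tab_coeff T (parent_stage i v) (i v) (k v)) =
         (\<Prod>r \<in> {r \<in> black_nodes ts. is_root r}. zf T (i r) (k r))"
        by (rule prod.cong[OF refl]) (simp add: tab_coeff_def parent_stage_def)
      ultimately show ?thesis by (subst prod.union_disjoint) auto
    qed
    finally show ?thesis ..
  qed
  have "ff_coeff M \<xi> T (abs_exotic_forest ts) =
    (\<Sum>i \<in> black_nodes ts \<rightarrow>\<^sub>E {1..stg T}. \<Sum>k \<in> Lab (nexp T) ts. 1 / lab_fact (nexp T) ts k *
       ((\<Prod>v \<in> {v \<in> black_nodes ts. \<not> is_root v}. Zi T (i (parent v)) (i v) (k v)) *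
        (\<Prod>r \<in> {r \<in> black_nodes ts. is_root r}. zf T (i r) (k r)) *
        (\<Prod>e \<in> lianas ts. \<integral>\<omega>.
           (\<Prod>v \<in> {v \<in> e. \<not> is_root v}. noise_stage T (\<lambda>d l. \<xi> d l \<omega>) 1 (i (parent v)) (k v)) *
           (\<Prod>r \<in> {r \<in> e. is_root r}. noise_final T (\<lambda>d l. \<xi> d l \<omega>) 1 (k r)) \<partial>M)))"
    using ex by (intro ff_coeff.abs_eq) (simp add: same_exotic_refl)
  also have "\<dots> = (\<Sum>i\<in>black_nodes ts \<rightarrow>\<^sub>E {1..stg T}. \<Sum>k \<in> Lab (nexp T) ts. 1 / lab_fact (nexp T) ts k *
       ((\<Prod>v\<in>black_nodes ts. tab_coeff T (parent_stage i v) (i v) (k v)) *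
        (\<Prod>e\<in>lianas ts. \<Sum>l=1..nrv T. \<Prod>v\<in>e. noise_coeff T (parent_stage i v) (k v) l)))"
  proof (intro sum.cong refl)
    fix i k assume i: "i \<in> black_nodes ts \<rightarrow>\<^sub>E {1..stg T}"
    show "1 / lab_fact (nexp T) ts k *
       ((\<Prod>v \<in> {v \<in> black_nodes ts. \<not> is_root v}. Zi T (i (parent v)) (i v) (k v)) *
        (\<Prod>r \<in> {r \<in> black_nodes ts. is_root r}. zf T (i r) (k r)) *
        (\<Prod>e \<in> lianas ts. \<integral>\<omega>.
           (\<Prod>v \<in> {v \<in> e. \<not> is_root v}. noise_stage T (\<lambda>d l. \<xi> d l \<omega>) 1 (i (parent v)) (k v)) *
           (\<Prod>r \<in> {r \<in> e. is_root r}. noise_final T (\<lambda>d l. \<xi> d l \<omega>) 1 (k r)) \<partial>M)) =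
      1 / lab_fact (nexp T) ts k *
       ((\<Prod>v\<in>black_nodes ts. tab_coeff T (parent_stage i v) (i v) (k v)) *
        (\<Prod>e\<in>lianas ts. \<Sum>l=1..nrv T. \<Prod>v\<in>e. noise_coeff T (parent_stage i v) (k v) l))"
      unfolding coeff[OF i] by (simp only: liana_integral[OF _ ex i] cong: prod.cong)
  qed
  finally show ?thesis unfolding sum_Lab by (simp add: stage_weight_def mult_ac)
qed

text \<open>The product over lianas of sums over \<open>l\<close> is multiplied out: one index is
  chosen per liana. Each summand is then a product over single leaves, hence a local weight.\<close>

lemma ff_coeff_labels:
  assumes ex: "is_exotic ts"
  shows "ff_coeff M \<xi> T (abs_exotic_forest ts) =
    (\<Sum>c\<in>label_set ts \<rightarrow>\<^sub>E {1..nrv T}. unit_forest_sum T c ts)"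
proof -
  have inj: "inj_on (label_class ts) (label_set ts)"
    by (force simp: inj_on_def label_class_def label_set_def)
  have num: "num_nodes ts = (\<Union>n\<in>label_set ts. label_class ts n)"
    by (force simp: label_class_def label_set_def num_nodes_iff)
  have fin: "finite (label_class ts n)" for n
    by (rule finite_subset[OF _ finite_num_nodes[of ts]]) (auto simp: label_class_def num_nodes_iff)
  have lianas: "(\<Prod>e\<in>lianas ts. \<Sum>l=1..nrv T. \<Prod>v\<in>e. noise_coeff T (parent_stage i v) (k v) l) =
    (\<Sum>c\<in>label_set ts \<rightarrow>\<^sub>E {1..nrv T}. \<Prod>v\<in>num_nodes ts. noise_coeff T (parent_stage i v) (k v) (c (the
        (node_label ts v))))" for i k
  proof -
    have "(\<Prod>e\<in>lianas ts. \<Sum>l=1..nrv T. \<Prod>v\<in>e. noise_coeff T (parent_stage i v) (k v) l) =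
      (\<Prod>n\<in>label_set ts. \<Sum>l=1..nrv T. \<Prod>v\<in>label_class ts n. noise_coeff T (parent_stage i v) (k v) l)"
      unfolding lianas_eq[OF ex] by (subst prod.reindex[OF inj]) simp
    also have "\<dots> = (\<Sum>c\<in>label_set ts \<rightarrow>\<^sub>E {1..nrv T}. \<Prod>n\<in>label_set ts. \<Prod>v\<in>label_class ts n. noise_coeff T
        (parent_stage i v) (k v) (c n))"
      by (rule prod_sum_PiE) simp_all
    also have "\<dots> = (\<Sum>c\<in>label_set ts \<rightarrow>\<^sub>E {1..nrv T}. \<Prod>n\<in>label_set ts. \<Prod>v\<in>label_class ts n.
        noise_coeff T (parent_stage i v) (k v) (c (the (node_label ts v))))"
      by (intro sum.cong prod.cong refl) (simp add: label_class_def)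
    also have "\<dots> = (\<Sum>c\<in>label_set ts \<rightarrow>\<^sub>E {1..nrv T}. \<Prod>v\<in>num_nodes ts. noise_coeff T (parent_stage i v) (k
        v) (c (the (node_label ts v))))"
      unfolding num by (intro sum.cong refl prod.UNION_disjoint[symmetric]) (auto simp: fin, auto simp:
          label_class_def)
    finally show ?thesis .
  qed
  have "ff_coeff M \<xi> T (abs_exotic_forest ts) =
    (\<Sum>i\<in>black_nodes ts \<rightarrow>\<^sub>E {1..stg T}. \<Sum>k\<in>nodes ts \<rightarrow>\<^sub>E {1..nexp T}. \<Sum>c\<in>label_set ts \<rightarrow>\<^sub>E {1..nrv T}.
       stage_weight T ts i k * (\<Prod>v\<in>num_nodes ts. noise_coeff T (parent_stage i v) (k v) (c (the
           (node_label ts v)))))"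
    unfolding ff_coeff_stages[OF ex] lianas sum_distrib_left ..
  also have "\<dots> = (\<Sum>c\<in>label_set ts \<rightarrow>\<^sub>E {1..nrv T}. \<Sum>i\<in>black_nodes ts \<rightarrow>\<^sub>E {1..stg T}. \<Sum>k\<in>nodes ts \<rightarrow>\<^sub>E {1..nexp T}.
       stage_weight T ts i k * (\<Prod>v\<in>num_nodes ts. noise_coeff T (parent_stage i v) (k v) (c (the
           (node_label ts v)))))"
    by (simp only: sum.swap[of _ "label_set ts \<rightarrow>\<^sub>E {1..nrv T}"])
  also have "\<dots> = (\<Sum>c\<in>label_set ts \<rightarrow>\<^sub>E {1..nrv T}. unit_forest_sum T c ts)"
    unfolding unit_forest_sum_stages ..
  finally show ?thesis .
qed

text \<open>The renumbered forests have disjoint numbers, so a choice of noise indices for an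
  interleaving is a pair of independent choices. Under each choice the shuffle identity of words
  applies, and the sum over all choices factors.\<close>

lemma ff_coeff_shuffle:
  "(\<Sum>\<zeta>\<leftarrow>forest_interleavings \<pi> \<eta>. ff_coeff M \<xi> T \<zeta>) = ff_coeff M \<xi> T \<pi> * ff_coeff M \<xi> T \<eta>"
proof -
  let ?a = "ff_coeff M \<xi> T" and ?R = "{1..nrv T}"
  define ts us where "ts = rep_exotic_forest \<pi>" and "us = rep_exotic_forest \<eta>"
  have ex: "is_exotic ts" "is_exotic us" and abs: "abs_exotic_forest ts = \<pi>" "abs_exotic_forest us = \<eta>"
    by (simp_all add: ts_def us_def exotic_rep exotic_abs_rep)
  let ?ts = "renumber (\<lambda>n. 2 * n) ts" and ?us = "renumber (\<lambda>n. 2 * n + 1) us"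
  let ?I = "interleavings ?ts ?us"
  have ex_nil: "is_exotic []" by (simp add: is_exotic_def)
  \<comment> \<open>Interleaving with the empty forest yields just the renumbered forest
    itself.\<close>
  have ex': "is_exotic ?ts" "is_exotic ?us"
    using is_exotic_interleaving[OF ex(1) ex_nil, of ?ts] is_exotic_interleaving[OF ex_nil ex(2), of ?us]
    by (simp_all add: renumber_def)
  have abs': "abs_exotic_forest ?ts = \<pi>" "abs_exotic_forest ?us = \<eta>"
    using exotic_abs_eq[OF exotic_inj[OF ex'(1) ex(1)]] exotic_abs_eq[OF exotic_inj[OF ex'(2) ex(2)]]
    by (simp_all add: shape_renumber lianas_renumber_inj inj_def abs)
  have fi: "forest_interleavings \<pi> \<eta> = map abs_exotic_forest ?I"
    using forest_interleavings.abs_eq[of ts us] ex by (simp add: same_exotic_refl abs)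
  have disj: "label_set ?ts \<inter> label_set ?us = {}"
    by (auto simp: label_set_def node_label_renumber, presburger)
  have lab: "label_set zs = label_set ?ts \<union> label_set ?us" if "zs \<in> set ?I" for zs
  proof -
    have "set zs = set ?ts \<union> set ?us" using mset_interleavings[OF that] by (metis set_mset_mset set_mset_union)
    then show ?thesis by (simp only: label_set_labels) blast
  qed
  have exz: "is_exotic zs" if "zs \<in> set ?I" for zs by (rule is_exotic_interleaving[OF ex that])
  have "(\<Sum>\<zeta>\<leftarrow>forest_interleavings \<pi> \<eta>. ?a \<zeta>) = (\<Sum>zs\<leftarrow>?I. ?a (abs_exotic_forest zs))"
    by (simp add: fi comp_def)
  also have "\<dots> = (\<Sum>zs\<leftarrow>?I. \<Sum>c\<in>(label_set ?ts \<union> label_set ?us) \<rightarrow>\<^sub>E ?R. unit_forest_sum T c zs)"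
    by (intro arg_cong[where f = sum_list] map_cong refl) (simp only: ff_coeff_labels[OF exz] lab)
  also have "\<dots> = (\<Sum>c\<in>(label_set ?ts \<union> label_set ?us) \<rightarrow>\<^sub>E ?R. \<Sum>zs\<leftarrow>?I. unit_forest_sum T c zs)"
    by (rule sum_list_sum_swap)
  also have "\<dots> = (\<Sum>c\<in>(label_set ?ts \<union> label_set ?us) \<rightarrow>\<^sub>E ?R. unit_forest_sum T c ?ts * unit_forest_sum T c ?us)"
    by (intro sum.cong refl) (rule unit_forest_sum_shuffle)
  also have "\<dots> = (\<Sum>c\<in>(label_set ?ts \<union> label_set ?us) \<rightarrow>\<^sub>E ?R.
      unit_forest_sum T (restrict c (label_set ?ts)) ?ts * unit_forest_sum T (restrict c (label_set ?us)) ?us)"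
    by (intro sum.cong refl arg_cong2[where f = "(*)"] unit_forest_sum_cong) simp_all
  also have "\<dots> = (\<Sum>c\<in>label_set ?ts \<rightarrow>\<^sub>E ?R. unit_forest_sum T c ?ts) * (\<Sum>c\<in>label_set ?us \<rightarrow>\<^sub>E ?R.
      unit_forest_sum T c ?us)"
    by (rule sum_PiE_Un[OF disj])
  also have "\<dots> = ?a \<pi> * ?a \<eta>"
    using ff_coeff_labels[OF ex'(1)] ff_coeff_labels[OF ex'(2)] by (simp only: abs')
  finally show ?thesis .
qed

lemma ff_coeff_empty: "ff_coeff M \<xi> T empty_forest = 1"
proof -
  have "is_exotic []" by (simp add: is_exotic_def)
  then have "ff_coeff M \<xi> T (abs_exotic_forest []) = 1"
    by (subst ff_coeff_stages)
      (simp_all add: stage_weight_def kids_labels_def kids_Nil label_weight_Nil lianas_def black_nodes_def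
          node_at_Nil)
  then show ?thesis by (simp only: empty_forest.abs_eq)
qed

lemma ff_coeff_character: "shuffle_character (ff_coeff M \<xi> T)"
  unfolding shuffle_character_def
proof (intro conjI allI ff_coeff_empty)
  fix x y
  let ?a = "ff_coeff M \<xi> T"
  have "lin_ext ?a (shuffle_prod x y) = (\<Sum>\<pi> \<in> Poly_Mapping.keys x. \<Sum>\<eta> \<in> Poly_Mapping.keys y.
      \<Sum>\<zeta> \<leftarrow> forest_interleavings \<pi> \<eta>. Poly_Mapping.lookup x \<pi> * Poly_Mapping.lookup y \<eta> * ?a \<zeta>)"
    unfolding shuffle_prod_def by (simp add: lin_ext_sum lin_ext_sum_list lin_ext_single)
  also have "\<dots> = (\<Sum>\<pi> \<in> Poly_Mapping.keys x. \<Sum>\<eta> \<in> Poly_Mapping.keys y.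
      Poly_Mapping.lookup x \<pi> * Poly_Mapping.lookup y \<eta> * (?a \<pi> * ?a \<eta>))"
    by (simp add: sum_list_const_mult ff_coeff_shuffle)
  also have "\<dots> = lin_ext ?a x * lin_ext ?a y"
    by (simp add: lin_ext_def sum_product mult_ac)
  finally show "lin_ext ?a (shuffle_prod x y) = lin_ext ?a x * lin_ext ?a y" .
qed

end

lemma elementary_differential_words:
  assumes ex: "is_exotic ts"
  shows "elementary_differential \<A> D E f (abs_exotic_forest ts) \<phi> p =
    (\<Sum>d\<in>nodes ts \<rightarrow>\<^sub>E {1..D}. word_weight (\<lambda>d ds. word_deriv \<A> E ds (f d) p) (\<lambda>ds. word_deriv \<A> E ds \<phi> p) ts d *
       (if \<exists>v v'. {v, v'} \<in> lianas ts \<and> d v \<noteq> d v' then 0 else 1))"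
proof -
  have "elementary_differential \<A> D E f (abs_exotic_forest ts) =
   (\<lambda>\<phi> q. \<Sum>i \<in> nodes ts \<rightarrow>\<^sub>E {1..D}.
       (if \<exists>v w. {v, w} \<in> lianas ts \<and> i v \<noteq> i w then 0 else 1) *
       (\<Prod>v \<in> black_nodes ts. word_deriv \<A> E (map i (kids ts v)) (f (i v)) q) *
       word_deriv \<A> E (map i (kids ts [])) \<phi> q)"
    using ex by (intro elementary_differential.abs_eq) (simp add: same_exotic_refl)
  then show ?thesis by (simp add: word_weight_def mult_ac)
qed

lemma stage_weight_shape: "stage_weight T (shape ts) i k = stage_weight T ts i k"
  by (simp add: stage_weight_def kids_labels_def black_nodes_shape kids_shape)

lemma word_weight_shape: "word_weight w w0 (shape ts) d = word_weight w w0 ts d"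
  by (simp add: word_weight_def black_nodes_shape kids_shape)

section \<open>Talay--Tubaro expansions\<close>

lemma fps_compose_X2_nth:
  fixes S :: "real fps"
  shows "fps_nth (fps_compose S (fps_X ^ 2)) n = (if even n then fps_nth S (n div 2) else 0)"
proof -
  have "fps_nth (fps_compose S (fps_X ^ 2)) n = (\<Sum>i=0..n. if n = 2 * i then fps_nth S i else 0)"
    unfolding fps_compose_nth by (intro sum.cong refl) (simp flip: power_mult)
  also have "\<dots> = (if even n then fps_nth S (n div 2) else 0)"
  proof (cases "even n")
    case True
    then obtain m where m: "n = 2 * m" by (rule evenE)
    have "(\<Sum>i=0..n. if n = 2 * i then fps_nth S i else 0) = (\<Sum>i=0..n. if i = m then fps_nth S i else 0)"
      by (intro sum.cong refl) (simp add: m)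
    then show ?thesis using m by (simp add: sum.delta)
  next
    case False
    then show ?thesis by (auto intro!: sum.neutral)
  qed
  finally show ?thesis .
qed

text \<open>With \<open>m\<close> the maximum of 1 and all \<open>a i\<close>, the left side is at
  most \<open>((1 + card I) * m) ^ q\<close>, and \<open>m ^ q\<close> is 1 or one of the summands
  on the right. This reduces moments of the noise size to moments of single variables.\<close>

lemma power_sum_le:
  fixes a :: "'a \<Rightarrow> real"
  assumes "finite I" "\<And>i. i \<in> I \<Longrightarrow> a i \<ge> 0"
  shows "(1 + (\<Sum>i\<in>I. a i)) ^ q \<le> (1 + card I) ^ q * (1 + (\<Sum>i\<in>I. a i ^ q))"
proof -
  define m where "m = Max (insert 1 (a ` I))"
  have m: "m \<in> insert 1 (a ` I)" unfolding m_def by (rule Max_in) (use assms in auto)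
  have m1: "1 \<le> m" and ma: "\<And>i. i \<in> I \<Longrightarrow> a i \<le> m"
    unfolding m_def using assms(1) by (auto intro: Max_ge)
  have "1 + (\<Sum>i\<in>I. a i) \<le> m + (\<Sum>i\<in>I. m)"
    by (intro add_mono m1 sum_mono ma)
  then have "(1 + (\<Sum>i\<in>I. a i)) ^ q \<le> ((1 + card I) * m) ^ q"
    using assms by (intro power_mono) (auto simp: algebra_simps sum_nonneg)
  also have "m ^ q \<le> 1 + (\<Sum>i\<in>I. a i ^ q)"
  proof (cases "m = 1")
    case False
    then obtain j where "j \<in> I" "m = a j" using m by auto
    moreover from this have "a j ^ q \<le> (\<Sum>i\<in>I. a i ^ q)"
      using assms by (intro member_le_sum) auto
    ultimately show ?thesis by simp
  qed (use assms in \<open>simp add: sum_nonneg\<close>)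
  then have "((1 + card I) * m) ^ q \<le> (1 + card I) ^ q * (1 + (\<Sum>i\<in>I. a i ^ q))"
    by (simp add: power_mult_distrib)
  finally show ?thesis by simp
qed

lemma smooth_function_tendsto:
  fixes \<A> :: "('m::{t2_space,second_countable_topology}, 'e::euclidean_space) chart set"
  assumes "smooth_atlas \<A>" "smooth_function \<A> g" "(y \<longlongrightarrow> q) F"
  shows "((\<lambda>c. g (y c)) \<longlongrightarrow> g q) F"
proof -
  obtain c where c: "c \<in> \<A>" "q \<in> fst c" using chart_exists[OF assms(1)] by blast
  note h = chart_homeo[OF assms(1) c(1)]
  have "continuous_on (snd c ` fst c) (g \<circ> chart_inv c)"
    using assms(2) c(1) unfolding smooth_function_def by (intro smooth_on_continuous) blast
  moreover have "continuous_on (fst c) (snd c)" using h(3) by (simp add: homeomorphism_def)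
  ultimately have "continuous_on (fst c) ((g \<circ> chart_inv c) \<circ> snd c)"
    by (rule continuous_on_compose[rotated])
  then have "continuous_on (fst c) g"
    by (rule continuous_on_eq) (simp add: chart_inv_eq[OF assms(1) c(1)])
  then have "isCont g q" using h(1) c(2) by (simp add: continuous_on_eq_continuous_at)
  then show ?thesis using assms(3) by (rule isCont_tendsto_compose)
qed

section \<open>Random coefficients of powers of \<open>sqrt h\<close>\<close>

context
  fixes \<A> :: "('m::{t2_space,second_countable_topology}, 'e::euclidean_space) chart set"
    and D :: nat and E :: "nat \<Rightarrow> ('m, 'e) vfield" and f :: "nat \<Rightarrow> 'm \<Rightarrow> real" and T :: ff_tableau
    and M :: "'w measure" and \<xi> :: "nat \<Rightarrow> nat \<Rightarrow> 'w \<Rightarrow> real" and p :: 'm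
  assumes atlas: "smooth_atlas \<A>"
    and fields: "\<And>d. d \<in> {1..D} \<Longrightarrow> smooth_vector_field \<A> (E d)"
    and drift: "\<And>d. d \<in> {1..D} \<Longrightarrow> smooth_function \<A> (f d)"
    and prob: "prob_space M" and D: "D \<ge> 1"
    and gaussian: "\<And>d l. d \<in> {1..D} \<Longrightarrow> l \<in> {1..nrv T} \<Longrightarrow> distributed M lborel (\<xi> d l) std_normal_density"
    and indep: "prob_space.indep_vars M (\<lambda>_. borel) (\<lambda>(d, l). \<xi> d l) ({1..D} \<times> {1..nrv T})"
begin

definition expansion_coeff :: "('m \<Rightarrow> real) \<Rightarrow> 'w \<Rightarrow> nat \<Rightarrow> real" where
  "expansion_coeff \<phi> \<omega> n = (\<Sum>ts | forest_degree ts = n. shape_coeff \<A> D E f T p (\<lambda>d l. \<xi> d l \<omega>) 0 \<phi> ts)"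

abbreviation (input) "series \<phi> \<equiv> exotic_Lie_series \<A> D E f (ff_coeff M \<xi> T) \<phi> p"

lemma finite_degree_eq: "finite {ts :: unit ptree list. forest_degree ts = n}"
  by (rule finite_subset[OF _ finite_forests_degree[of n]]) auto

text \<open>The covariances in \<open>ff_coeff\<close> do not involve the directions, and the
  elementary differential involves neither stages nor labels. Their product is therefore the joint
  sum, with the deltas coming from the elementary differential.\<close>

lemma exotic_term:
  assumes ex: "is_exotic ts"
  shows "ff_coeff M \<xi> T (abs_exotic_forest ts) * elementary_differential \<A> D E f (abs_exotic_forest ts) \<phi> p =
    paired_sum T D (\<lambda>d ds. word_deriv \<A> E ds (f d) p) (\<lambda>ds. word_deriv \<A> E ds \<phi> p) (shape ts) (lianas ts)"
proof -
  have "ff_coeff M \<xi> T (abs_exotic_forest ts) =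
    (\<Sum>i\<in>black_nodes ts \<rightarrow>\<^sub>E {1..stg T}. \<Sum>k\<in>nodes ts \<rightarrow>\<^sub>E {1..nexp T}. stage_weight T ts i k *
       (\<Prod>e\<in>lianas ts. \<Sum>l=1..nrv T. \<Prod>v\<in>e. noise_coeff T (parent_stage i v) (k v) l))"
    by (rule ff_coeff_stages[OF prob D gaussian indep ex])
  then show ?thesis
    unfolding paired_sum_def elementary_differential_words[OF ex]
      black_nodes_shape nodes_shape stage_weight_shape word_weight_shape
    by (simp only: sum_distrib_right) (simp add: sum_distrib_left mult_ac)
qed

lemma integrable_coeff: "integrable M (\<lambda>\<omega>. expansion_coeff \<phi> \<omega> n)"
  unfolding expansion_coeff_def shape_coeff_def
  by (intro Bochner_Integration.integrable_sum integrable_forest_sum[OF prob D gaussian indep])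

text \<open>In odd degree the number of leaves is odd and there is no pairing, so half-integer
  powers of \<open>h\<close> have mean zero. In even degree the sum over shapes and pairings is the
  sum over exotic forests.\<close>

lemma integral_coeff:
  "(\<integral>\<omega>. expansion_coeff \<phi> \<omega> n \<partial>M) = (if even n then fps_nth (series \<phi>) (n div 2) else 0)"
proof -
  let ?Q = "paired_sum T D (\<lambda>d ds. word_deriv \<A> E ds (f d) p) (\<lambda>ds. word_deriv \<A> E ds \<phi> p)"
  have eq: "(\<integral>\<omega>. expansion_coeff \<phi> \<omega> n \<partial>M) = (\<Sum>ts | forest_degree ts = n. \<Sum>P\<in>pairings (num_nodes ts). ?Q ts P)"
  proof -
    have "(\<integral>\<omega>. forest_sum T {1..D} (\<lambda>_::unit. tab_noise T (\<lambda>d l. \<xi> d l \<omega>)) (\<lambda>d ds. word_deriv \<A> E ds (f d) p) 0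
        (\<lambda>ds. word_deriv \<A> E ds \<phi> p) ts \<partial>M) = (\<Sum>P\<in>pairings (num_nodes ts). ?Q ts P)" for ts
      by (rule integral_forest_sum[OF prob D gaussian indep])
    moreover have "(\<integral>\<omega>. expansion_coeff \<phi> \<omega> n \<partial>M) = (\<Sum>ts | forest_degree ts = n.
        \<integral>\<omega>. forest_sum T {1..D} (\<lambda>_::unit. tab_noise T (\<lambda>d l. \<xi> d l \<omega>)) (\<lambda>d ds. word_deriv \<A> E ds (f d) p) 0
        (\<lambda>ds. word_deriv \<A> E ds \<phi> p) ts \<partial>M)"
      unfolding expansion_coeff_def shape_coeff_def
      by (rule Bochner_Integration.integral_sum) (rule integrable_forest_sum[OF prob D gaussian indep])
    ultimately show ?thesis by simp
  qed
  show ?thesis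
  proof (cases "even n")
    case True
    then obtain m where n: "n = 2 * m" by (rule evenE)
    have "(\<Sum>\<pi> | forest_order \<pi> = m. ff_coeff M \<xi> T \<pi> * elementary_differential \<A> D E f \<pi> \<phi> p) =
        (\<Sum>ts | forest_degree ts = 2 * m. \<Sum>P\<in>pairings (num_nodes ts). ?Q ts P)"
      by (rule sum_exotic_forests) (rule exotic_term)
    then show ?thesis using eq n by (simp add: exotic_Lie_series_def)
  next
    case False
    have "pairings (num_nodes ts) = {}" if "forest_degree ts = n" for ts :: "unit ptree list"
    proof (rule ccontr)
      assume "pairings (num_nodes ts) \<noteq> {}"
      then obtain P where "P \<in> pairings (num_nodes ts)" by blast
      then have "card (num_nodes ts) = 2 * card P" by (rule pairings_even[OF finite_num_nodes])
      then show False using that False forest_degree_card[of ts] by auto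
    qed
    then show ?thesis using False by (auto simp: eq intro!: sum.neutral)
  qed
qed

lemma sum_by_degree:
  "(\<Sum>ts | forest_degree ts \<le> N. e ^ forest_degree ts * shape_coeff \<A> D E f T p (\<lambda>d l. \<xi> d l \<omega>) 0 \<phi> ts) =
    (\<Sum>n\<le>N. expansion_coeff \<phi> \<omega> n * e ^ n)"
proof -
  have "{ts :: unit ptree list. forest_degree ts \<le> N} = (\<Union>n\<le>N. {ts. forest_degree ts = n})" by auto
  then have "(\<Sum>ts | forest_degree ts \<le> N. e ^ forest_degree ts * shape_coeff \<A> D E f T p (\<lambda>d l. \<xi> d l \<omega>) 0
      \<phi> ts) =
     (\<Sum>n\<le>N. \<Sum>ts | forest_degree ts = n. e ^ forest_degree ts * shape_coeff \<A> D E f T p (\<lambda>d l. \<xi> d l \<omega>) 0 \<phi> ts)"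
    by (simp only:) (rule sum.UNION_disjoint, simp, simp add: finite_degree_eq, auto)
  then show ?thesis by (simp add: expansion_coeff_def sum_distrib_left mult.commute[of _ "e ^ _"])
qed

lemma ff_step_stages:
  assumes "ff_step \<A> D E f T x h p H q" "i \<le> stg T"
  shows "is_exp_product \<A> D E (nexp T) (\<lambda>k d. h * (\<Sum>j=1..stg T. tab_coeff T i j k * f d (H j)) + sqrt h *
      tab_noise T x d i k)
    p (if i = 0 then q else H i)"
  using assms by (cases "i = 0") (auto simp: ff_step_def tab_coeff_def tab_noise_def)

text \<open>For a fixed realisation the noise is constant, and since the stages tend to
  \<open>p\<close> all exponents tend to 0. For small \<open>h\<close> all flows then stay in one
  chart ball around \<open>p\<close>, where compactness bounds every iterated derivative.\<close>

theorem pathwise_expansion: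
  assumes \<phi>: "smooth_function \<A> \<phi>"
    and step: "\<forall>\<^sub>F h in at_right 0. ff_step \<A> D E f T (\<lambda>d l. \<xi> d l \<omega>) h p (H h) (X h)"
    and H: "\<forall>i\<in>{1..stg T}. ((\<lambda>h. H h i) \<longlongrightarrow> p) (at_right 0)"
  shows "sqrt_expansion (\<lambda>h. \<phi> (X h)) (Abs_fps (expansion_coeff \<phi> \<omega>))"
proof -
  let ?K = "nexp T" and ?x = "\<lambda>d l. \<xi> d l \<omega>"
  \<comment> \<open>The result of the step is added as stage \<open>0\<close>.\<close>
  define Hf where "Hf h i = (if i = 0 then X h else H h i)" for h i
  define \<alpha> where "\<alpha> h i k d = sqrt h ^ 2 * (\<Sum>j=1..stg T. tab_coeff T i j k * f d (Hf h j)) + sqrt h *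
      tab_noise T ?x d i k" for h i k d
  define W where "W = 1 + (\<Sum>d=1..D. \<Sum>l=1..nrv T. \<bar>\<xi> d l \<omega>\<bar>)"
  obtain c where c: "c \<in> \<A>" "p \<in> fst c" using chart_exists[OF atlas] by blast
  note homeo = chart_homeo[OF atlas c(1)]
  obtain r where r: "r > 0" "cball (snd c p) r \<subseteq> snd c ` fst c"
    using homeo(2) c(2) open_contains_cball by blast
  define S where "S = chart_inv c ` cball (snd c p) r"
  have "\<exists>V\<ge>0. \<forall>d\<in>{1..D}. \<forall>q\<in>S. norm (E d c q) \<le> V"
    unfolding S_def by (rule fields_bounded_chart_cball[OF atlas c(1) r(2)]) (rule fields)
  then obtain V where V: "V \<ge> 0" "\<And>d q. d \<in> {1..D} \<Longrightarrow> q \<in> S \<Longrightarrow> norm (E d c q) \<le> V"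
    by (elim exE conjE) simp
  have bounded: "bounded_words_on S \<A> D E g" if g: "smooth_function \<A> g" for g
    unfolding bounded_words_on_def S_def
  proof (intro allI impI)
    fix w assume w: "set w \<subseteq> {1..D}"
    have "smooth_function \<A> (word_deriv \<A> E w g)" by (rule smooth_word_deriv[OF atlas _ w g]) (rule fields)
    then show "\<exists>B. \<forall>q\<in>chart_inv c ` cball (snd c p) r. \<bar>word_deriv \<A> E w g q\<bar> \<le> B"
      by (rule smooth_bounded_chart_cball[OF atlas c(1) r(2)])
  qed
  have pos: "\<forall>\<^sub>F h in at_right (0::real). 0 < h" by (rule eventually_at_right_less)
  have eps: "\<forall>\<^sub>F h in at_right (0::real). 0 < sqrt h \<and> sqrt h \<le> 1"
  proof -
    have "\<forall>\<^sub>F h in at_right (0::real). h < 1" by (rule order_tendstoD(2)[OF tendsto_ident_at]) simp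
    with pos show ?thesis by eventually_elim simp
  qed
  have sqrt0: "((\<lambda>h. sqrt h) \<longlongrightarrow> 0) (at_right 0)"
    using tendsto_real_sqrt[OF tendsto_ident_at, of 0 "{0<..}"] by simp
  have Hf: "((\<lambda>h. Hf h j) \<longlongrightarrow> p) (at_right 0)" if "j \<in> {1..stg T}" for j
    using H that by (simp add: Hf_def)
  have W1: "\<forall>\<^sub>F h in at_right (0::real). 1 \<le> W"
    by (intro always_eventually allI) (simp add: W_def sum_nonneg)
  have inS: "\<forall>\<^sub>F h in at_right 0. \<forall>j\<in>{1..stg T}. Hf h j \<in> S"
  proof (intro eventually_ball_finite ballI finite_atLeastAtMost)
    fix j assume j: "j \<in> {1..stg T}"
    let ?U = "fst c \<inter> snd c -` ball (snd c p) r"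
    have "open ?U"
      using homeo(1,3) by (auto simp: homeomorphism_def intro!: continuous_open_preimage)
    then have "\<forall>\<^sub>F h in at_right 0. Hf h j \<in> ?U"
      using Hf[OF j] c(2) r(1) by (auto dest: topological_tendstoD)
    then show "\<forall>\<^sub>F h in at_right 0. Hf h j \<in> S"
      by eventually_elim (simp add: S_def chart_inv_image[OF atlas c(1) r(2) r(2)])
  qed
  have \<alpha>0: "((\<lambda>h. \<bar>\<alpha> h i k d\<bar>) \<longlongrightarrow> 0) (at_right 0)" if d: "d \<in> {1..D}" for i k d
  proof -
    have "((\<lambda>h. \<alpha> h i k d) \<longlongrightarrow> 0 ^ 2 * (\<Sum>j=1..stg T. tab_coeff T i j k * f d p) + 0 * tab_noise T ?x d i k)
        (at_right 0)"
      unfolding \<alpha>_def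
      by (intro tendsto_intros sqrt0 smooth_function_tendsto[OF atlas drift[OF d]] Hf)
    then show ?thesis by (intro tendsto_rabs_zero) simp
  qed
  \<comment> \<open>The total size of all exponents; it tends to 0 and bounds the displacement under
    every product of flows.\<close>
  define a where "a h = (\<Sum>i\<le>stg T. \<Sum>k=1..?K. \<Sum>d=1..D. \<bar>\<alpha> h i k d\<bar>)" for h
  have "((\<lambda>h. real ?K * (real D * (a h * V))) \<longlongrightarrow> real ?K * (real D * ((\<Sum>i\<le>stg T. \<Sum>k=1..?K. \<Sum>d=1..D. 0) *
      V))) (at_right 0)"
    unfolding a_def by (intro tendsto_intros \<alpha>0)
  then have small: "\<forall>\<^sub>F h in at_right 0. real ?K * (real D * (a h * V)) < r"
    by (rule order_tendstoD(2)) (use r in simp)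
  have le_a: "\<bar>\<alpha> h i k d\<bar> \<le> a h" if "i \<le> stg T" "k \<in> {1..?K}" "d \<in> {1..D}" for h i k d
  proof -
    have "\<bar>\<alpha> h i k d\<bar> \<le> (\<Sum>d=1..D. \<bar>\<alpha> h i k d\<bar>)" using that by (intro member_le_sum) auto
    also have "\<dots> \<le> (\<Sum>k=1..?K. \<Sum>d=1..D. \<bar>\<alpha> h i k d\<bar>)"
      using that by (intro member_le_sum[of k "{1..?K}" "\<lambda>k. \<Sum>d=1..D. \<bar>\<alpha> h i k d\<bar>"]) (auto simp: sum_nonneg)
    also have "\<dots> \<le> a h" unfolding a_def
      using that by (intro member_le_sum[of i "{..stg T}" "\<lambda>i. \<Sum>k=1..?K. \<Sum>d=1..D. \<bar>\<alpha> h i k d\<bar>"]) (auto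
          simp: sum_nonneg)
    finally show ?thesis .
  qed
  have a0: "a h \<ge> 0" for h unfolding a_def by (simp add: sum_nonneg)
  have steps: "\<forall>\<^sub>F h in at_right 0. \<forall>i\<le>stg T. exp_product_in \<A> D E S ?K (\<lambda>k d. \<alpha> h i k d) p (Hf h i)"
    using step small pos
  proof (eventually_elim, intro allI impI)
    fix h i assume h: "ff_step \<A> D E f T ?x h p (H h) (X h)" "real ?K * (real D * (a h * V)) < r" "0 < h"
        and i: "i \<le> stg T"
    have "(\<lambda>k d. \<alpha> h i k d) = (\<lambda>k d. h * (\<Sum>j=1..stg T. tab_coeff T i j k * f d (H h j)) + sqrt h *
        tab_noise T ?x d i k)"
      using h(3) by (simp add: \<alpha>_def Hf_def fun_eq_iff)
    then have "is_exp_product \<A> D E ?K (\<lambda>k d. \<alpha> h i k d) p (Hf h i)"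
      using ff_step_stages[OF h(1) i] by (simp add: Hf_def)
    then show "exp_product_in \<A> D E S ?K (\<lambda>k d. \<alpha> h i k d) p (Hf h i)"
      unfolding S_def
      by (rule exp_product_stays[where a = "a h" and D = D and E = E, OF atlas c(1) r(2) _ c(2) refl a0
          V(1) le_a[OF i] V(2)[unfolded S_def] h(2)])
  qed
  show ?thesis unfolding sqrt_expansion_def
  proof
    fix N
    have "OW (at_right 0) sqrt (\<lambda>_. W) (Suc N) (\<lambda>h. \<phi> (Hf h 0) - (\<Sum>ts | forest_degree ts \<le> N. sqrt h ^
        forest_degree ts * shape_coeff \<A> D E f T p ?x 0 \<phi> ts))"
      by (rule stage_expansion[where x = "\<lambda>_. ?x", OF eps W_def atlas fields drift bounded[OF drift]
          steps[unfolded \<alpha>_def] inS \<phi> bounded[OF \<phi>] le0])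
    then obtain q C where "\<forall>\<^sub>F h in at_right 0. \<bar>\<phi> (X h) - (\<Sum>n\<le>N. expansion_coeff \<phi> \<omega> n * sqrt h ^ n)\<bar> \<le> C
        * (sqrt h ^ Suc N * W ^ q)"
      unfolding OW_def[OF eps W1] sum_by_degree Hf_def by auto
    then have "\<forall>\<^sub>F h in at_right 0. norm (\<phi> (X h) - (\<Sum>n\<le>N. expansion_coeff \<phi> \<omega> n * sqrt h ^ n)) \<le> (C * W ^
        q) * norm (sqrt h ^ Suc N)"
      using pos
    proof eventually_elim
      case (elim h)
      have "norm (sqrt h ^ Suc N) = sqrt h ^ Suc N" using elim(2) by (intro real_norm_def[THEN trans]
          abs_of_nonneg) simp
      then show ?case using elim(1) by (simp only: real_norm_def mult_ac)
    qed
    then have "(\<lambda>h. \<phi> (X h) - (\<Sum>n\<le>N. expansion_coeff \<phi> \<omega> n * sqrt h ^ n)) \<in> O[at_right 0](\<lambda>h. sqrt h ^ Suc N)"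
      by (rule bigoI)
    moreover have "(\<lambda>h. sqrt h ^ Suc N) \<in> o[at_right 0](\<lambda>h. sqrt h ^ N)"
    proof (rule smalloI_tendsto)
      have "\<forall>\<^sub>F h in at_right 0. sqrt h = sqrt h ^ Suc N / sqrt h ^ N"
        using pos by eventually_elim simp
      then show "((\<lambda>h. sqrt h ^ Suc N / sqrt h ^ N) \<longlongrightarrow> 0) (at_right 0)"
        by (rule Lim_transform_eventually[OF sqrt0])
      show "\<forall>\<^sub>F h in at_right (0::real). sqrt h ^ N \<noteq> 0" using pos by eventually_elim simp
    qed
    ultimately show "(\<lambda>h. \<phi> (X h) - (\<Sum>n\<le>N. fps_nth (Abs_fps (expansion_coeff \<phi> \<omega>)) n * sqrt h ^ n)) \<in>
        o[at_right 0](\<lambda>h. sqrt h ^ N)"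
      using landau_o.big_small_trans by simp
  qed
qed

theorem formal_expectation_expansion:
  assumes \<phi>: "smooth_function \<A> \<phi>"
    and step: "AE \<omega> in M.
       (\<forall>\<^sub>F h in at_right 0. ff_step \<A> D E f T (\<lambda>d l. \<xi> d l \<omega>) h p (H h \<omega>) (X h \<omega>)) \<and>
       (\<forall>i\<in>{1..stg T}. ((\<lambda>h. H h \<omega> i) \<longlongrightarrow> p) (at_right 0))"
  shows "formal_expectation M (\<lambda>h \<omega>. \<phi> (X h \<omega>)) (series \<phi>)"
  unfolding formal_expectation_def
proof (intro exI[of _ "\<lambda>\<omega>. Abs_fps (expansion_coeff \<phi> \<omega>)"] conjI allI)
  show "AE \<omega> in M. sqrt_expansion (\<lambda>h. \<phi> (X h \<omega>)) (Abs_fps (expansion_coeff \<phi> \<omega>))"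
    using step by (rule AE_mp) (intro AE_I2 impI, elim conjE, rule pathwise_expansion[OF \<phi>])
  show "integrable M (\<lambda>\<omega>. fps_nth (Abs_fps (expansion_coeff \<phi> \<omega>)) n)" for n
    by (simp add: integrable_coeff)
  show "Abs_fps (\<lambda>n. \<integral>\<omega>. fps_nth (Abs_fps (expansion_coeff \<phi> \<omega>)) n \<partial>M) = fps_compose (series \<phi>) (fps_X ^ 2)"
    by (rule fps_ext) (simp add: integral_coeff fps_compose_X2_nth)
qed

section \<open>Uniform remainders and the weak expansion\<close>

definition noise_size :: "'w \<Rightarrow> real" where
  "noise_size \<omega> = 1 + (\<Sum>d=1..D. \<Sum>l=1..nrv T. \<bar>\<xi> d l \<omega>\<bar>)"

lemma noise_size_sum: "noise_size \<omega> = 1 + (\<Sum>b\<in>{1..D} \<times> {1..nrv T}. \<bar>\<xi> (fst b) (snd b) \<omega>\<bar>)"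
  unfolding noise_size_def sum.cartesian_product by (simp add: case_prod_beta)

text \<open>A power of the noise size is dominated by a sum of powers of single Gaussian variables,
  all of which are integrable.\<close>

lemma integrable_noise_size: "integrable M (\<lambda>\<omega>. noise_size \<omega> ^ q)"
proof -
  interpret prob_space M by (rule prob)
  let ?B = "{1..D} \<times> {1..nrv T}"
  have meas: "\<xi> (fst b) (snd b) \<in> borel_measurable M" if "b \<in> ?B" for b
    using gaussian[of "fst b" "snd b"] that by (auto simp: distributed_def)
  have int: "integrable M (\<lambda>\<omega>. \<bar>\<xi> (fst b) (snd b) \<omega>\<bar> ^ q)" if "b \<in> ?B" for b
    using distributed_integrable[OF gaussian[of "fst b" "snd b"], of "\<lambda>x. \<bar>x\<bar> ^ q"] that
      integrable_std_normal_moment_abs[of q] by auto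
  have "integrable M (\<lambda>\<omega>. (1 + card ?B) ^ q * (1 + (\<Sum>b\<in>?B. \<bar>\<xi> (fst b) (snd b) \<omega>\<bar> ^ q)))"
    by (intro integrable_mult_right Bochner_Integration.integrable_add Bochner_Integration.integrable_sum
        int) simp_all
  then show ?thesis
  proof (rule Bochner_Integration.integrable_bound)
    show "(\<lambda>\<omega>. noise_size \<omega> ^ q) \<in> borel_measurable M"
      unfolding noise_size_sum
      by (intro borel_measurable_power borel_measurable_add borel_measurable_const borel_measurable_sum
          borel_measurable_abs meas)
    show "AE \<omega> in M. norm (noise_size \<omega> ^ q) \<le> norm ((1 + card ?B) ^ q * (1 + (\<Sum>b\<in>?B. \<bar>\<xi> (fst b) (snd b)
        \<omega>\<bar> ^ q)))"
    proof (rule AE_I2)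
      fix \<omega>
      have "noise_size \<omega> ^ q \<le> (1 + card ?B) ^ q * (1 + (\<Sum>b\<in>?B. \<bar>\<xi> (fst b) (snd b) \<omega>\<bar> ^ q))"
        unfolding noise_size_sum by (rule power_sum_le) simp_all
      moreover have "noise_size \<omega> \<ge> 0" unfolding noise_size_def by (simp add: sum_nonneg)
      ultimately show "norm (noise_size \<omega> ^ q) \<le> norm ((1 + card ?B) ^ q * (1 + (\<Sum>b\<in>?B. \<bar>\<xi> (fst b) (snd b)
          \<omega>\<bar> ^ q)))"
        by simp
    qed
  qed
qed

lemma bounded_derivs_words: "bounded_derivs \<A> D E g \<Longrightarrow> bounded_words_on UNIV \<A> D E g"
  unfolding bounded_derivs_def bounded_words_on_def by (auto simp: bounded_iff)

text \<open>Along the principal filter of all admissible pairs, "eventually" means "for every pair",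
  so the constants of the order symbol are uniform in the step size and the realisation. Global
  bounds on the derivatives replace the chart ball.\<close>

theorem uniform_expansion:
  assumes \<phi>: "smooth_function \<A> \<phi>" "bounded_derivs \<A> D E \<phi>" and bf: "\<forall>d\<in>{1..D}. bounded_derivs \<A> D E (f d)"
  shows "\<exists>q C. C \<ge> 0 \<and> (\<forall>h \<omega>. 0 < h \<and> h \<le> 1 \<and> ff_step \<A> D E f T (\<lambda>d l. \<xi> d l \<omega>) h p (H h \<omega>) (X h \<omega>) \<longrightarrow>
     \<bar>\<phi> (X h \<omega>) - (\<Sum>n\<le>N. expansion_coeff \<phi> \<omega> n * sqrt h ^ n)\<bar> \<le> C * (sqrt h ^ Suc N * noise_size \<omega> ^ q))"
proof -
  define Good where "Good = {(h, \<omega>). 0 < h \<and> h \<le> 1 \<and> ff_step \<A> D E f T (\<lambda>d l. \<xi> d l \<omega>) h p (H h \<omega>) (X h \<omega>)}"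
  define Hf where "Hf c i = (if i = 0 then X (fst c) (snd c) else H (fst c) (snd c) i)" for c :: "real \<times>
      'w" and i :: nat
  let ?x = "\<lambda>c d l. \<xi> d l (snd c)" and ?eps = "\<lambda>c. sqrt (fst c)"
  have eps: "\<forall>\<^sub>F c in principal Good. 0 < ?eps c \<and> ?eps c \<le> 1"
    by (auto simp: eventually_principal Good_def)
  have steps: "\<forall>\<^sub>F c in principal Good. \<forall>i\<le>stg T. exp_product_in \<A> D E UNIV (nexp T)
       (\<lambda>k d. ?eps c ^ 2 * (\<Sum>j=1..stg T. tab_coeff T i j k * f d (Hf c j)) + ?eps c * tab_noise T (?x c) d
           i k) p (Hf c i)"
    unfolding eventually_principal
  proof (intro ballI allI impI)
    fix c i assume c: "c \<in> Good" and i: "i \<le> stg T"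
    obtain h \<omega> where h: "c = (h, \<omega>)" "0 < h" "ff_step \<A> D E f T (\<lambda>d l. \<xi> d l \<omega>) h p (H h \<omega>) (X h \<omega>)"
      using c by (auto simp: Good_def)
    have "(\<lambda>k d. ?eps c ^ 2 * (\<Sum>j=1..stg T. tab_coeff T i j k * f d (Hf c j)) + ?eps c * tab_noise T (?x
        c) d i k) =
       (\<lambda>k d. h * (\<Sum>j=1..stg T. tab_coeff T i j k * f d (H h \<omega> j)) + sqrt h * tab_noise T (\<lambda>d l. \<xi> d l \<omega>)
           d i k)"
      using h(1,2) by (simp add: Hf_def fun_eq_iff)
    then show "exp_product_in \<A> D E UNIV (nexp T)
       (\<lambda>k d. ?eps c ^ 2 * (\<Sum>j=1..stg T. tab_coeff T i j k * f d (Hf c j)) + ?eps c * tab_noise T (?x c) d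
           i k) p (Hf c i)"
      using is_exp_product_in_UNIV[OF ff_step_stages[OF h(3) i]] h(1)
      by (cases "i = 0") (simp_all add: Hf_def)
  qed
  have W: "noise_size (snd c) = 1 + (\<Sum>d=1..D. \<Sum>l=1..nrv T. \<bar>?x c d l\<bar>)" for c :: "real \<times> 'w"
    by (simp add: noise_size_def)
  have W1: "\<forall>\<^sub>F c in principal Good. 1 \<le> noise_size (snd c)"
    by (intro always_eventually allI) (simp add: noise_size_def sum_nonneg)
  have "OW (principal Good) ?eps (\<lambda>c. noise_size (snd c)) (Suc N) (\<lambda>c. \<phi> (Hf c 0) - (\<Sum>ts | forest_degree
      ts \<le> N. ?eps c ^ forest_degree ts * shape_coeff \<A> D E f T p (?x c) 0 \<phi> ts))"
    by (rule stage_expansion[where x = ?x and S = UNIV, OF eps W atlas fields drift _ steps _ \<phi>(1) _ le0])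
      (use bf \<phi>(2) in \<open>simp_all add: bounded_derivs_words\<close>)
  then obtain q C where C: "C \<ge> 0" "\<forall>c\<in>Good. \<bar>\<phi> (X (fst c) (snd c)) - (\<Sum>n\<le>N. expansion_coeff \<phi> (snd c) n *
      ?eps c ^ n)\<bar> \<le> C * (?eps c ^ Suc N * noise_size (snd c) ^ q)"
    unfolding OW_def[OF eps W1] sum_by_degree Hf_def eventually_principal by auto
  then show ?thesis by (intro exI[of _ q] exI[of _ C]) (auto simp: Good_def)
qed

text \<open>The uniform remainder is integrated, the polynomial in the noise being absorbed by
  Gaussian moments. An expansion up to \<open>sqrt h ^ Suc (2 * N)\<close> leaves a remainder of
  order \<open>h ^ Suc N\<close>.\<close>

theorem weak_expansion_series:
  assumes \<phi>: "smooth_function \<A> \<phi>" "bounded_derivs \<A> D E \<phi>" and bf: "\<forall>d\<in>{1..D}. bounded_derivs \<A> D E (f d)"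
    and step: "\<forall>\<^sub>F h in at_right 0. (\<lambda>\<omega>. \<phi> (X h \<omega>)) \<in> borel_measurable M \<and>
           (AE \<omega> in M. ff_step \<A> D E f T (\<lambda>d l. \<xi> d l \<omega>) h p (H h \<omega>) (X h \<omega>))"
  shows "weak_expansion M (\<lambda>h \<omega>. \<phi> (X h \<omega>)) (series \<phi>)"
proof -
  let ?P = "\<lambda>N h \<omega>. \<Sum>n\<le>N. expansion_coeff \<phi> \<omega> n * sqrt h ^ n"
  have intP: "integrable M (?P N h)" for N h
    by (intro Bochner_Integration.integrable_sum integrable_mult_left integrable_coeff)
  have range: "\<forall>\<^sub>F h in at_right (0::real). 0 < h \<and> h \<le> 1"
  proof -
    have "\<forall>\<^sub>F h in at_right (0::real). h < 1" by (rule order_tendstoD(2)[OF tendsto_ident_at]) simp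
    moreover have "\<forall>\<^sub>F h in at_right (0::real). 0 < h" by (rule eventually_at_right_less)
    ultimately show ?thesis by eventually_elim simp
  qed
  have bound: "\<exists>q C. \<forall>\<^sub>F h in at_right 0. integrable M (\<lambda>\<omega>. \<phi> (X h \<omega>)) \<and>
      \<bar>(\<integral>\<omega>. \<phi> (X h \<omega>) \<partial>M) - (\<integral>\<omega>. ?P N h \<omega> \<partial>M)\<bar> \<le> C * (\<integral>\<omega>. noise_size \<omega> ^ q \<partial>M) * sqrt h ^ Suc N" for N
  proof -
    obtain q C where C: "C \<ge> 0" and *: "\<And>h \<omega>. 0 < h \<Longrightarrow> h \<le> 1 \<Longrightarrow> ff_step \<A> D E f T (\<lambda>d l. \<xi> d l \<omega>) h p (H h
        \<omega>) (X h \<omega>) \<Longrightarrow>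
       \<bar>\<phi> (X h \<omega>) - ?P N h \<omega>\<bar> \<le> C * (sqrt h ^ Suc N * noise_size \<omega> ^ q)"
      using uniform_expansion[OF \<phi> bf] by blast
    have "\<forall>\<^sub>F h in at_right 0. integrable M (\<lambda>\<omega>. \<phi> (X h \<omega>)) \<and>
      \<bar>(\<integral>\<omega>. \<phi> (X h \<omega>) \<partial>M) - (\<integral>\<omega>. ?P N h \<omega> \<partial>M)\<bar> \<le> C * (\<integral>\<omega>. noise_size \<omega> ^ q \<partial>M) * sqrt h ^ Suc N"
      using step range
    proof eventually_elim
      case (elim h)
      have intW: "integrable M (\<lambda>\<omega>. C * (sqrt h ^ Suc N * noise_size \<omega> ^ q))"
        by (intro integrable_mult_right integrable_noise_size)
      have meas: "(\<lambda>\<omega>. \<phi> (X h \<omega>) - ?P N h \<omega>) \<in> borel_measurable M"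
        using elim intP by (intro borel_measurable_diff) auto
      have ae: "AE \<omega> in M. norm (\<phi> (X h \<omega>) - ?P N h \<omega>) \<le> C * (sqrt h ^ Suc N * noise_size \<omega> ^ q)"
        using conjunct2[OF elim(1)] by (rule AE_mp) (intro AE_I2 impI, use * elim(2) in simp)
      have intR: "integrable M (\<lambda>\<omega>. \<phi> (X h \<omega>) - ?P N h \<omega>)"
        by (rule Bochner_Integration.integrable_bound[OF intW meas]) (use ae in \<open>auto elim: AE_mp\<close>)
      have int\<phi>: "integrable M (\<lambda>\<omega>. \<phi> (X h \<omega>))"
        using Bochner_Integration.integrable_add[OF intR intP[where N = N and h = h]] by simp
      have "\<bar>(\<integral>\<omega>. \<phi> (X h \<omega>) \<partial>M) - (\<integral>\<omega>. ?P N h \<omega> \<partial>M)\<bar> = norm (\<integral>\<omega>. \<phi> (X h \<omega>) - ?P N h \<omega> \<partial>M)"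
        by (simp add: Bochner_Integration.integral_diff[OF int\<phi> intP])
      also have "\<dots> \<le> (\<integral>\<omega>. norm (\<phi> (X h \<omega>) - ?P N h \<omega>) \<partial>M)"
        by (rule integral_norm_bound)
      also have "\<dots> \<le> (\<integral>\<omega>. C * (sqrt h ^ Suc N * noise_size \<omega> ^ q) \<partial>M)"
        by (rule integral_mono_AE[OF integrable_norm[OF intR] intW ae])
      also have "\<dots> = C * (\<integral>\<omega>. noise_size \<omega> ^ q \<partial>M) * sqrt h ^ Suc N" by simp
      finally show ?case using int\<phi> by simp
    qed
    then show ?thesis by blast
  qed
  \<comment> \<open>Odd orders have mean zero, so the top order \<open>Suc (2 * N)\<close> adds
    nothing to the series, and the order \<open>2 * m\<close> becomes the power
    \<open>h ^ m\<close>.\<close>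
  have even_sum: "(\<integral>\<omega>. ?P (Suc (2 * N)) h \<omega> \<partial>M) = (\<Sum>m\<le>N. fps_nth (series \<phi>) m * h ^ m)" if "0 < h" for N h
  proof -
    have "(\<integral>\<omega>. ?P (Suc (2 * N)) h \<omega> \<partial>M) = (\<Sum>n\<le>Suc (2 * N). (if even n then fps_nth (series \<phi>) (n div 2)
        else 0) * sqrt h ^ n)"
      by (subst Bochner_Integration.integral_sum) (auto intro!: integrable_mult_left integrable_coeff
          simp: integral_coeff)
    also have "\<dots> = (\<Sum>m\<le>N. fps_nth (series \<phi>) m * h ^ m)"
    proof (induction N)
      case (Suc N)
      have "sqrt h ^ (2 * Suc N) = h ^ Suc N" using that by (simp only: power_mult) simp
      then show ?case using Suc by simp
    qed simp
    finally show ?thesis .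
  qed
  show ?thesis unfolding weak_expansion_def
  proof (intro conjI allI)
    show "\<forall>\<^sub>F h in at_right 0. integrable M (\<lambda>\<omega>. \<phi> (X h \<omega>))"
      using bound[of 0] by (auto elim: eventually_mono)
    fix N
    obtain q C where "\<forall>\<^sub>F h in at_right 0. integrable M (\<lambda>\<omega>. \<phi> (X h \<omega>)) \<and>
      \<bar>(\<integral>\<omega>. \<phi> (X h \<omega>) \<partial>M) - (\<integral>\<omega>. ?P (Suc (2 * N)) h \<omega> \<partial>M)\<bar> \<le> C * (\<integral>\<omega>. noise_size \<omega> ^ q \<partial>M) * sqrt h ^ Suc
          (Suc (2 * N))"
      using bound[of "Suc (2 * N)"] by blast
    then have "\<forall>\<^sub>F h in at_right 0. norm ((\<integral>\<omega>. \<phi> (X h \<omega>) \<partial>M) - (\<Sum>m\<le>N. fps_nth (series \<phi>) m * h ^ m)) \<le>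
        (C * (\<integral>\<omega>. noise_size \<omega> ^ q \<partial>M)) * norm (h ^ Suc N)"
      using range
    proof eventually_elim
      case (elim h)
      have "sqrt h ^ Suc (Suc (2 * N)) = (sqrt h ^ 2) ^ Suc N"
        unfolding power_mult[symmetric] by simp
      then have "sqrt h ^ Suc (Suc (2 * N)) = h ^ Suc N" using elim(2) by simp
      then show ?case using elim even_sum[of h N] by simp
    qed
    then show "(\<lambda>h. (\<integral>\<omega>. \<phi> (X h \<omega>) \<partial>M) - (\<Sum>m\<le>N. fps_nth (series \<phi>) m * h ^ m)) \<in> O[at_right 0](\<lambda>h. h ^ Suc N)"
      by (rule bigoI)
  qed
qed

end

theorem theorem3p16:
  fixes \<A> :: "('m::{t2_space,second_countable_topology}, 'e::euclidean_space) chart set"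
    and D :: nat
    and E :: "nat \<Rightarrow> ('m, 'e) vfield"
    and f :: "nat \<Rightarrow> 'm \<Rightarrow> real"
    and T :: ff_tableau
    and M :: "'w measure"
    and \<xi> :: "nat \<Rightarrow> nat \<Rightarrow> 'w \<Rightarrow> real"
    and p :: 'm
  assumes manifold: "smooth_atlas \<A>"
    and fields: "\<And>d. d \<in> {1..D} \<Longrightarrow> smooth_vector_field \<A> (E d)"
    and frame: "spanning_fields \<A> D E"
    and drift: "\<And>d. d \<in> {1..D} \<Longrightarrow> smooth_function \<A> (f d)"
    and sizes: "stg T \<ge> 1" "nexp T \<ge> 1" "nrv T \<ge> 1"
    and prob: "prob_space M"
    and gaussian: "\<And>d l. d \<in> {1..D} \<Longrightarrow> l \<in> {1..nrv T} \<Longrightarrow>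
      distributed M lborel (\<xi> d l) std_normal_density"
    and indep: "prob_space.indep_vars M (\<lambda>_. borel) (\<lambda>(d, l). \<xi> d l) ({1..D} \<times> {1..nrv T})"
  shows
    "(\<forall>\<phi> H X. smooth_function \<A> \<phi> \<longrightarrow>
        (AE \<omega> in M.
           (\<forall>\<^sub>F h in at_right 0. ff_step \<A> D E f T (\<lambda>d l. \<xi> d l \<omega>) h p (H h \<omega>) (X h \<omega>)) \<and>
           (\<forall>i\<in>{1..stg T}. ((\<lambda>h. H h \<omega> i) \<longlongrightarrow> p) (at_right 0))) \<longrightarrow>
        formal_expectation M (\<lambda>h \<omega>. \<phi> (X h \<omega>))
          (exotic_Lie_series \<A> D E f (ff_coeff M \<xi> T) \<phi> p)) \<and>
     (\<forall>\<phi> H X. smooth_function \<A> \<phi> \<longrightarrow>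
        bounded_derivs \<A> D E \<phi> \<longrightarrow> (\<forall>d\<in>{1..D}. bounded_derivs \<A> D E (f d)) \<longrightarrow>
        (\<forall>\<^sub>F h in at_right 0. (\<lambda>\<omega>. \<phi> (X h \<omega>)) \<in> borel_measurable M \<and>
           (AE \<omega> in M. ff_step \<A> D E f T (\<lambda>d l. \<xi> d l \<omega>) h p (H h \<omega>) (X h \<omega>))) \<longrightarrow>
        weak_expansion M (\<lambda>h \<omega>. \<phi> (X h \<omega>))
          (exotic_Lie_series \<A> D E f (ff_coeff M \<xi> T) \<phi> p)) \<and>
     shuffle_character (ff_coeff M \<xi> T)"
proof -
  \<comment> \<open>The model space \<open>'e\<close> has a nonempty basis, so an empty family of
    fields cannot span it.\<close>
  have D: "D \<ge> 1"
  proof (rule ccontr)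
    assume "\<not> D \<ge> 1"
    then have "D = 0" by simp
    obtain c where "c \<in> \<A>" "p \<in> fst c" using chart_exists[OF manifold] by blast
    then have "span ((\<lambda>d. E d c p) ` {1..D}) = UNIV" using frame by (simp add: spanning_fields_def)
    then have "(UNIV :: 'e set) = {0}" using \<open>D = 0\<close> by simp
    moreover obtain b :: 'e where "b \<in> Basis" using nonempty_Basis by blast
    ultimately show False using nonzero_Basis[of b] by blast
  qed
  show ?thesis
  proof (intro conjI allI impI)
    fix \<phi> H X
    assume *: "smooth_function \<A> \<phi>"
      "AE \<omega> in M. (\<forall>\<^sub>F h in at_right 0. ff_step \<A> D E f T (\<lambda>d l. \<xi> d l \<omega>) h p (H h \<omega>) (X h \<omega>)) \<and>
         (\<forall>i\<in>{1..stg T}. ((\<lambda>h. H h \<omega> i) \<longlongrightarrow> p) (at_right 0))"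
    show "formal_expectation M (\<lambda>h \<omega>. \<phi> (X h \<omega>)) (exotic_Lie_series \<A> D E f (ff_coeff M \<xi> T) \<phi> p)"
      by (rule formal_expectation_expansion[OF manifold _ _ prob D _ indep *]) (rule fields drift gaussian; assumption)+
  next
    fix \<phi> H X
    assume *: "smooth_function \<A> \<phi>" "bounded_derivs \<A> D E \<phi>" "\<forall>d\<in>{1..D}. bounded_derivs \<A> D E (f d)"
      "\<forall>\<^sub>F h in at_right 0. (\<lambda>\<omega>. \<phi> (X h \<omega>)) \<in> borel_measurable M \<and>
         (AE \<omega> in M. ff_step \<A> D E f T (\<lambda>d l. \<xi> d l \<omega>) h p (H h \<omega>) (X h \<omega>))"
    show "weak_expansion M (\<lambda>h \<omega>. \<phi> (X h \<omega>)) (exotic_Lie_series \<A> D E f (ff_coeff M \<xi> T) \<phi> p)"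
      by (rule weak_expansion_series[OF manifold _ _ prob D _ indep *]) (rule fields drift gaussian; assumption)+
  next
    show "shuffle_character (ff_coeff M \<xi> T)"
      by (rule ff_coeff_character[OF prob D gaussian indep])
  qed
qed

end
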